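(* Let $n\ge1$, $B=B(0,R)\subset\mathbb{R}^n$ a ball, $1<p<\infty$, $1/p<s<n/p$, and $u\in H^{s,p}_{0,rad}(B)$. Then $u$ is almost everywhere equal to a function continuous on $B\setminus\{0\}$ which satisfies, for all $x\in B\setminus\{0\}$, $$ |u(x)| \leq C\, |x|^{-\frac{n}{p}+s}\, \| u \|_{H^{s,p}_0(B)}, $$ with $C$ independent of $u$ and $x$.
   Context: Let $B=\{x\in\mathbb{R}^n:|x|<R\}$ and let $H^t_B(x,y)=\sum_k e^{-\lambda_k t}\varphi_k(x)\varphi_k(y)$ be the Dirichlet heat kernel of $B$, where $(\lambda_k)$ are the Dirichlet eigenvalues of $-\Delta$ in $B$ and $(\varphi_k)$ a corresponding orthonormal basis of eigenfunctions of $L^2(B)$. For $0<s<n$ set $K^s(x,y)=\frac{1}{\Gamma(s/2)}\int_0^\infty t^{s/2-1}H^t_B(x,y)\,dt$ and $(-\Delta_B)^{-s/2}f(x)=\int_B K^s(x,y)f(y)\,dy$ for $f\in L^p(B)$. The potential space of the ball is $H^{s,p}_0(B)=\{u=(-\Delta_B)^{-s/2}f: f\in L^p(B)\}$ with norm $\|u\|_{H^{s,p}_0(B)}=\|f\|_{L^p(B)}$, and $H^{s,p}_{0,rad}(B)$ is its subspace of radially symmetric functions. *)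

theory Defs
  imports "HOL-Analysis.Analysis"
begin

definition dirichlet_eigenpair :: "real \<Rightarrow> real \<Rightarrow> ('a::euclidean_space \<Rightarrow> real) \<Rightarrow> bool" where
  "dirichlet_eigenpair R lam \<phi> \<longleftrightarrow>
     continuous_on (cball 0 R) \<phi> \<and> (\<forall>x. norm x = R \<longrightarrow> \<phi> x = 0) \<and>
     (\<exists>Df D2f. (\<forall>h k. continuous_on (ball 0 R) (\<lambda>y. D2f y h k)) \<and>
        (\<forall>x\<in>ball 0 R. (\<phi> has_derivative Df x) (at x) \<and>
           (\<forall>h. ((\<lambda>y. Df y h) has_derivative D2f x h) (at x)) \<and>
           - (\<Sum>b\<in>Basis. D2f x b b) = lam * \<phi> x))"

definition dirichlet_eigenbasis ::
  "real \<Rightarrow> (nat \<Rightarrow> real) \<Rightarrow> (nat \<Rightarrow> 'a::euclidean_space \<Rightarrow> real) \<Rightarrow> bool" where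
  "dirichlet_eigenbasis R lam \<phi> \<longleftrightarrow>
     (\<forall>k. dirichlet_eigenpair R (lam k) (\<phi> k)) \<and>
     (\<forall>j k. set_lebesgue_integral lebesgue (ball 0 R) (\<lambda>x. \<phi> j x * \<phi> k x)
              = (if j = k then 1 else 0)) \<and>
     (\<forall>g::'a \<Rightarrow> real. set_borel_measurable lebesgue (ball 0 R) g \<and>
        set_integrable lebesgue (ball 0 R) (\<lambda>x. (g x)\<^sup>2) \<and>
        (\<forall>k. set_lebesgue_integral lebesgue (ball 0 R) (\<lambda>x. g x * \<phi> k x) = 0)
        \<longrightarrow> (AE x in lebesgue. x \<in> ball 0 R \<longrightarrow> g x = 0))"

definition heat_kernel ::
  "(nat \<Rightarrow> real) \<Rightarrow> (nat \<Rightarrow> 'a \<Rightarrow> real) \<Rightarrow> real \<Rightarrow> 'a \<Rightarrow> 'a \<Rightarrow> real" where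
  "heat_kernel lam \<phi> t x y = (\<Sum>k. exp (- lam k * t) * \<phi> k x * \<phi> k y)"

definition riesz_kernel ::
  "(nat \<Rightarrow> real) \<Rightarrow> (nat \<Rightarrow> 'a \<Rightarrow> real) \<Rightarrow> real \<Rightarrow> 'a \<Rightarrow> 'a \<Rightarrow> real" where
  "riesz_kernel lam \<phi> s x y =
     1 / Gamma (s / 2) *
     set_lebesgue_integral lborel {0<..} (\<lambda>t. t powr (s / 2 - 1) * heat_kernel lam \<phi> t x y)"

definition dirichlet_riesz_potential ::
  "real \<Rightarrow> (nat \<Rightarrow> real) \<Rightarrow> (nat \<Rightarrow> 'a::euclidean_space \<Rightarrow> real) \<Rightarrow> real \<Rightarrow> ('a \<Rightarrow> real) \<Rightarrow> 'a \<Rightarrow> real" where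
  "dirichlet_riesz_potential R lam \<phi> s f x =
     set_lebesgue_integral lebesgue (ball 0 R) (\<lambda>y. riesz_kernel lam \<phi> s x y * f y)"

definition Lp_on :: "real \<Rightarrow> real \<Rightarrow> ('a::euclidean_space \<Rightarrow> real) \<Rightarrow> bool" where
  "Lp_on R p f \<longleftrightarrow> set_borel_measurable lebesgue (ball 0 R) f \<and>
     set_integrable lebesgue (ball 0 R) (\<lambda>x. \<bar>f x\<bar> powr p)"

definition Lp_norm_on :: "real \<Rightarrow> real \<Rightarrow> ('a::euclidean_space \<Rightarrow> real) \<Rightarrow> real" where
  "Lp_norm_on R p f = (set_lebesgue_integral lebesgue (ball 0 R) (\<lambda>x. \<bar>f x\<bar> powr p)) powr (1 / p)"

end

theory Submission
  imports Defs
begin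

text \<open>
  The parabolic maximum principle compares the heat evolution of a finite combination of
  eigenfunctions with a Gaussian convolution of its absolute value.  Testing with the combination
  whose coefficients are the terms of the kernel itself bounds the diagonal of the heat kernel, so
  the eigenfunction series converges; testing with indicators of small balls, which are
  \<open>L\<^sup>1\<close>-limits of finite combinations by completeness, gives
  \<open>\<bar>H\<^sup>t(x,y)\<bar> \<le> C t\<^bsup>-n/2\<^esup> exp(-\<bar>x - y\<bar>\<^sup>2/8t)\<close>
  and hence \<open>\<bar>K\<^sup>s(x,y)\<bar> \<le> C \<bar>x - y\<bar>\<^bsup>s-n\<^esup>\<close>.

  A radial function equals its spherical means, so \<open>u\<close> is bounded by the spherical mean of a Riesz
  potential of \<open>\<bar>f\<bar>\<close>, whether or not \<open>f\<close> is radial.  Splitting the kernel as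
  \<open>\<bar>x - y\<bar>\<^bsup>-a\<^esup>\<bar>x - y\<bar>\<^bsup>-b\<^esup>\<close> with \<open>ap < n - 1\<close> and \<open>bp' < n\<close>, which is possible exactly because
  \<open>s > 1/p\<close>, and applying Young's inequality gives the decay rate.  Discarding the times \<open>t < \<epsilon>\<close> in the
  kernel changes the spherical mean by an amount that tends to 0 locally uniformly away from the
  origin, by the same bound with a smaller \<open>s\<close>; this yields continuity.
\<close>


section \<open>The parabolic maximum principle and Gaussian convolutions\<close>

text \<open>The assumptions give eigenfunctions that are twice differentiable inside the ball,
  continuous up to the sphere, orthonormal and complete. They say nothing about the size or sign of
  \<open>lam\<close> and give no sup bounds on \<open>\<phi>\<close>, so neither the eigenfunction
  series nor the time integral is known to converge. A divergent \<open>suminf\<close> has an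
  arbitrary value and a divergent integral is 0, so convergence must be proved before the kernel
  means anything. The maximum principle supplies it: it applies to finite combinations whatever the
  sign of \<open>lam\<close>, and its bounds do not depend on the number of terms. Constants need
  not be sharp. Hence the Gaussian is not normalised, and a crude lower bound for its convolution at
  small times replaces the limit of an approximate identity. Young's inequality takes the place of
  Hoelder's because it turns a product into a sum, and each summand can be integrated in the order
  that suits it, over the sphere or over space. The price is a normalisation of \<open>f\<close> and
  a power of the radius chosen so that all summands scale alike.\<close>

text \<open>If \<open>l\<close> were positive, \<open>g1\<close>, which vanishes at 0 because
  \<open>g\<close> is maximal there, would be positive just to the right of 0, and \<open>g\<close>
  would increase.\<close>

lemma second_derivative_nonpos_at_local_max:
  fixes g g1 :: "real \<Rightarrow> real"
  assumes d: "d > 0"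
    and g: "\<And>h. \<bar>h\<bar> < d \<Longrightarrow> (g has_real_derivative g1 h) (at h)"
    and g1: "(g1 has_real_derivative l) (at 0)"
    and max: "\<And>h. \<bar>h\<bar> < d \<Longrightarrow> g h \<le> g 0"
  shows "l \<le> 0"
proof (rule ccontr)
  assume "\<not> l \<le> 0"
  then have l: "l > 0" by simp
  have g10: "g1 0 = 0"
    by (rule DERIV_local_max[OF g d]) (use d max in auto)
  obtain e where e: "e > 0" "\<And>h. 0 < h \<Longrightarrow> h < e \<Longrightarrow> g1 0 < g1 (0 + h)"
    using DERIV_pos_inc_right[OF g1 l] by auto
  define h where "h = min d e / 2"
  have h: "0 < h" "h < d" "h < e" using d e(1) by (auto simp: h_def)
  have "g 0 < g h"
  proof (rule DERIV_pos_imp_increasing_open[OF h(1)])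
    show "\<exists>y. (g has_real_derivative y) (at x) \<and> 0 < y" if "0 < x" "x < h" for x
      using g[of x] e(2)[of x] that h g10 by auto
    show "continuous_on {0..h} g"
      using g h by (intro DERIV_continuous_on[where D=g1])
        (auto intro: has_field_derivative_at_within)
  qed
  with max[of h] h show False by auto
qed

text \<open>Subtracting \<open>e * t\<close> makes the inequality strict. At a positive maximum of
  \<open>v t x - e * t\<close> over the closed cylinder the time derivative of \<open>v\<close> is
  at least \<open>e\<close>, while every pure second derivative is at most 0. Derivatives are taken
  along coordinate lines only, which is all that the Laplacian involves.\<close>

lemma parabolic_maximum_principle:
  fixes v :: "real \<Rightarrow> 'a::euclidean_space \<Rightarrow> real"
  assumes cont: "continuous_on ({0..T} \<times> cball 0 R) (\<lambda>(t,x). v t x)"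
    and dt: "\<And>t x. 0 < t \<Longrightarrow> t \<le> T \<Longrightarrow> x \<in> ball 0 R \<Longrightarrow>
        ((\<lambda>\<tau>. v \<tau> x) has_real_derivative vt t x) (at t)"
    and dx: "\<And>t x b h. 0 < t \<Longrightarrow> t \<le> T \<Longrightarrow> b \<in> Basis \<Longrightarrow> x + h *\<^sub>R b \<in> ball 0 R \<Longrightarrow>
        ((\<lambda>h. v t (x + h *\<^sub>R b)) has_real_derivative vx t b (x + h *\<^sub>R b)) (at h)"
    and dxx: "\<And>t x b. 0 < t \<Longrightarrow> t \<le> T \<Longrightarrow> b \<in> Basis \<Longrightarrow> x \<in> ball 0 R \<Longrightarrow>
        ((\<lambda>h. vx t b (x + h *\<^sub>R b)) has_real_derivative vxx t b x) (at 0)"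
    and heat: "\<And>t x. 0 < t \<Longrightarrow> t \<le> T \<Longrightarrow> x \<in> ball 0 R \<Longrightarrow> vt t x \<le> (\<Sum>b\<in>Basis. vxx t b x)"
    and initial: "\<And>x. x \<in> cball 0 R \<Longrightarrow> v 0 x \<le> 0"
    and lateral: "\<And>t x. 0 \<le> t \<Longrightarrow> t \<le> T \<Longrightarrow> norm x = R \<Longrightarrow> v t x \<le> 0"
    and t: "0 \<le> t" "t \<le> T" and x: "x \<in> cball 0 R"
  shows "v t x \<le> 0"
proof (rule ccontr)
  assume "\<not> v t x \<le> 0"
  then have pos: "v t x > 0" by simp
  \<comment> \<open>With this \<open>e\<close> the penalty \<open>e * t\<close> is at most half of
    \<open>v t x\<close>, so the maximum of the penalised function is still positive.\<close>
  define e where "e = v t x / (2 * (T + 1))"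
  have T: "T + 1 > 0" using t by simp
  have e: "e > 0" using pos T by (simp add: e_def)
  have "e * t \<le> e * (T + 1)" using e t by simp
  also have "\<dots> = v t x / 2" using T unfolding e_def by (simp add: divide_simps)
  finally have et: "e * t < v t x" using pos by simp
  let ?m = "\<lambda>(t,x). v t x - e * t"
  have "\<exists>z\<in>{0..T} \<times> cball 0 R. \<forall>y\<in>{0..T} \<times> cball 0 R. ?m y \<le> ?m z"
  proof (rule continuous_attains_sup)
    show "compact ({0..T} \<times> cball (0::'a) R)" by (intro compact_Times) auto
    have "(t, x) \<in> {0..T} \<times> cball 0 R" using t x by auto
    then show "{0..T} \<times> cball (0::'a) R \<noteq> {}" by blast
    show "continuous_on ({0..T} \<times> cball (0::'a) R) ?m"
      using cont by (auto simp: case_prod_unfold intro!: continuous_intros)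
  qed
  then obtain t0 x0 where z: "t0 \<in> {0..T}" "x0 \<in> cball 0 R"
    and mx: "\<And>\<tau> y. \<tau> \<in> {0..T} \<Longrightarrow> y \<in> cball 0 R \<Longrightarrow> v \<tau> y - e * \<tau> \<le> v t0 x0 - e * t0"
    by auto
  have "v t0 x0 - e * t0 > 0" using mx[of t x] t x et by auto
  then have v0: "v t0 x0 > 0" using e z by (smt (verit) atLeastAtMost_iff mult_nonneg_nonneg)
  have t0: "0 < t0" "t0 \<le> T" using z initial[OF z(2)] v0 by (auto simp: order.order_iff_strict)
  have x0: "x0 \<in> ball 0 R"
    using z(2) lateral[of t0 x0] t0 v0 by (force simp: order.order_iff_strict)
  \<comment> \<open>The maximum may sit at the final time \<open>T\<close>, so it is compared with
    earlier times \<open>t0 - h\<close> only.\<close>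
  have "vt t0 x0 \<ge> e"
  proof (rule ccontr)
    assume "\<not> ?thesis"
    then have l: "vt t0 x0 - e < 0" by simp
    have "((\<lambda>\<tau>. v \<tau> x0 - e * \<tau>) has_real_derivative vt t0 x0 - e) (at t0)"
      by (rule derivative_eq_intros dt t0 x0 | simp)+
    from DERIV_neg_dec_left[OF this l] obtain d where d: "d > 0"
      "\<And>h. 0 < h \<Longrightarrow> h < d \<Longrightarrow> v t0 x0 - e * t0 < v (t0 - h) x0 - e * (t0 - h)" by auto
    define h where "h = min d t0 / 2"
    have "0 < h" "h < d" "h < t0" using d t0 by (auto simp: h_def)
    with d(2)[of h] mx[of "t0 - h" x0] t0 z show False by auto
  qed
  moreover have "vxx t0 b x0 \<le> 0" if b: "b \<in> Basis" for b
  proof (rule second_derivative_nonpos_at_local_max)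
    let ?d = "R - norm x0"
    show d: "?d > 0" using x0 by simp
    have inb: "x0 + h *\<^sub>R b \<in> ball 0 R" if "\<bar>h\<bar> < ?d" for h
      using norm_triangle_ineq[of x0 "h *\<^sub>R b"] that b by simp
    show "((\<lambda>h. v t0 (x0 + h *\<^sub>R b)) has_real_derivative vx t0 b (x0 + h *\<^sub>R b)) (at h)"
      if "\<bar>h\<bar> < ?d" for h
      by (rule dx[OF t0 b inb[OF that]])
    show "((\<lambda>h. vx t0 b (x0 + h *\<^sub>R b)) has_real_derivative vxx t0 b x0) (at 0)"
      by (rule dxx[OF t0 b x0])
    show "v t0 (x0 + h *\<^sub>R b) \<le> v t0 (x0 + 0 *\<^sub>R b)" if "\<bar>h\<bar> < ?d" for h
      using mx[of t0 "x0 + h *\<^sub>R b"] inb[OF that] t0 by auto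
  qed
  then have "(\<Sum>b\<in>Basis. vxx t0 b x0) \<le> 0" by (rule sum_nonpos)
  ultimately show False using heat[OF t0 x0] e by simp
qed

section \<open>Gaussian convolutions as solutions of the heat equation\<close>

text \<open>The heat kernel of the whole space without its factor
  \<open>(4 * pi) powr (- n / 2)\<close>.\<close>

definition gauss :: "real \<Rightarrow> 'a::euclidean_space \<Rightarrow> real" where
  "gauss t z = t powr (- real DIM('a) / 2) * exp (- (norm z)\<^sup>2 / (4 * t))"

lemma gauss_nonneg: "gauss t z \<ge> 0"
  by (simp add: gauss_def)

lemma continuous_on_gauss [continuous_intros]:
  assumes "continuous_on S f" "continuous_on S g" "\<And>x. x \<in> S \<Longrightarrow> f x > 0"
  shows "continuous_on S (\<lambda>x. gauss (f x) (g x))"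
  unfolding gauss_def using assms
  by (intro continuous_intros) (auto simp: less_imp_neq[symmetric])

lemma gauss_derivative_time:
  fixes z :: "'a::euclidean_space"
  assumes "t > 0"
  shows "((\<lambda>t. gauss t z) has_real_derivative
      ((norm z)\<^sup>2 / (4 * t\<^sup>2) - real DIM('a) / (2 * t)) * gauss t z) (at t)"
proof -
  have "t powr (- real DIM('a) / 2 - 1) = t powr (- real DIM('a) / 2) / t"
    using assms by (simp add: powr_diff)
  then show ?thesis
    unfolding gauss_def
    using assms by (auto intro!: derivative_eq_intros simp: field_simps power2_eq_square)
qed

lemma gauss_derivative_space:
  fixes z b :: "'a::euclidean_space"
  assumes "t > 0" "b \<in> Basis"
  shows "((\<lambda>h. gauss t (z + h *\<^sub>R b)) has_real_derivative
      - (((z + h *\<^sub>R b) \<bullet> b) / (2 * t)) * gauss t (z + h *\<^sub>R b)) (at h)"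
proof -
  have b: "b \<bullet> b = 1" using assms by simp
  have "(norm (z + h *\<^sub>R b))\<^sup>2 = (norm z)\<^sup>2 + 2 * h * (z \<bullet> b) + h\<^sup>2" for h
    unfolding power2_norm_eq_inner using b
    by (simp add: algebra_simps inner_commute power2_eq_square)
  then show ?thesis
    unfolding gauss_def using assms b
    by (auto intro!: derivative_eq_intros simp: field_simps power2_eq_square inner_add_left)
qed

lemma gauss_derivative2_space:
  fixes z b :: "'a::euclidean_space"
  assumes "t > 0" "b \<in> Basis"
  shows "((\<lambda>h. - (((z + h *\<^sub>R b) \<bullet> b) / (2 * t)) * gauss t (z + h *\<^sub>R b)) has_real_derivative
      ((((z + h *\<^sub>R b) \<bullet> b)\<^sup>2 / (4 * t\<^sup>2)) - 1 / (2 * t)) * gauss t (z + h *\<^sub>R b)) (at h)"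
proof -
  have b: "b \<bullet> b = 1" using assms by simp
  show ?thesis
    using assms b by (auto intro!: derivative_eq_intros gauss_derivative_space
       simp: field_simps power2_eq_square inner_add_left)
qed

text \<open>Integrating over a box makes the Leibniz rule available: differentiation under the
  integral then needs only continuity of the differentiated integrand.\<close>

definition gconv :: "('a::euclidean_space \<Rightarrow> real) \<Rightarrow> 'a \<Rightarrow> 'a \<Rightarrow> real \<Rightarrow> 'a \<Rightarrow> real" where
  "gconv F l u t x = integral (cbox l u) (\<lambda>y. gauss t (x - y) * F y)"

context
  fixes F :: "'a::euclidean_space \<Rightarrow> real" and l u :: 'a
  assumes F: "continuous_on (cbox l u) F"
begin

lemma continuous_on_F:
  assumes "continuous_on S f" "\<And>x. x \<in> S \<Longrightarrow> f x \<in> cbox l u"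
  shows "continuous_on S (\<lambda>x. F (f x))"
  using continuous_on_compose2[OF F assms(1)] assms(2) by blast

lemma continuous_on_gconv:
  "continuous_on ({0<..} \<times> UNIV) (\<lambda>(t,x). gconv F l u t x)"
proof -
  have "continuous_on (({0<..} \<times> UNIV) \<times> cbox l u) (\<lambda>(p, y). gauss (fst p) (snd p - y) * F y)"
    unfolding case_prod_unfold by (intro continuous_intros continuous_on_F) auto
  from integral_continuous_on_param[OF this] show ?thesis
    by (simp add: gconv_def case_prod_unfold)
qed

lemma gconv_derivative_time:
  assumes "t > 0"
  shows "((\<lambda>t. gconv F l u t x) has_real_derivative
     integral (cbox l u) (\<lambda>y. ((norm (x - y))\<^sup>2 / (4 * t\<^sup>2) - real DIM('a) / (2 * t)) * gauss t (x - y) * F y)) (at t)"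
proof -
  have "((\<lambda>t. integral (cbox l u) (\<lambda>y. gauss t (x - y) * F y)) has_real_derivative
     integral (cbox l u) (\<lambda>y. ((norm (x - y))\<^sup>2 / (4 * t\<^sup>2) - real DIM('a) / (2 * t)) * gauss t (x - y) * F y)) (at t within {0<..})"
  \<comment> \<open>The rule wants a convex parameter set. As \<open>{0<..}\<close> is also open,
    the derivative within it is the derivative at \<open>t\<close>.\<close>
  proof (rule leibniz_rule_field_derivative)
    show "((\<lambda>t. gauss t (x - y) * F y) has_real_derivative
        ((norm (x - y))\<^sup>2 / (4 * s\<^sup>2) - real DIM('a) / (2 * s)) * gauss s (x - y) * F y) (at s within {0<..})"
      if "s \<in> {0<..}" for s y
      using that by (intro has_field_derivative_at_within[OF DERIV_cmult_right] gauss_derivative_time) auto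
    show "(\<lambda>y. gauss s (x - y) * F y) integrable_on cbox l u" if "s \<in> {0<..}" for s
      using that by (intro integrable_continuous continuous_intros continuous_on_F) auto
    show "continuous_on ({0<..} \<times> cbox l u) (\<lambda>(t, y). ((norm (x - y))\<^sup>2 / (4 * t\<^sup>2) - real DIM('a) / (2 * t)) * gauss t (x - y) * F y)"
      unfolding case_prod_unfold by (intro continuous_intros continuous_on_F) auto
  qed (use assms in auto)
  then show ?thesis
    unfolding gconv_def using assms by (simp add: at_within_open[of t "{0<..}"])
qed

lemma gconv_derivative_space:
  assumes "t > 0" "b \<in> Basis"
  shows "((\<lambda>h. gconv F l u t (x + h *\<^sub>R b)) has_real_derivative
     integral (cbox l u) (\<lambda>y. - (((x + h *\<^sub>R b - y) \<bullet> b) / (2 * t)) * gauss t (x + h *\<^sub>R b - y) * F y)) (at h)"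
  unfolding gconv_def
proof (rule leibniz_rule_field_derivative)
  show "((\<lambda>h. gauss t (x + h *\<^sub>R b - y) * F y) has_real_derivative
        - (((x + h *\<^sub>R b - y) \<bullet> b) / (2 * t)) * gauss t (x + h *\<^sub>R b - y) * F y) (at h)" for h y
    using DERIV_cmult_right[OF gauss_derivative_space[OF assms, of "x - y" h], of "F y"]
    by (simp add: add_diff_eq diff_add_eq)
  show "(\<lambda>y. gauss t (x + h *\<^sub>R b - y) * F y) integrable_on cbox l u" for h
    using assms by (intro integrable_continuous continuous_intros continuous_on_F) auto
  show "continuous_on (UNIV \<times> cbox l u) (\<lambda>(h, y). - (((x + h *\<^sub>R b - y) \<bullet> b) / (2 * t)) * gauss t (x + h *\<^sub>R b - y) * F y)"
    using assms unfolding case_prod_unfold by (intro continuous_intros continuous_on_F) auto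
qed auto

lemma gconv_derivative2_space:
  assumes "t > 0" "b \<in> Basis"
  shows "((\<lambda>h. integral (cbox l u) (\<lambda>y. - (((x + h *\<^sub>R b - y) \<bullet> b) / (2 * t)) * gauss t (x + h *\<^sub>R b - y) * F y))
     has_real_derivative
     integral (cbox l u) (\<lambda>y. ((((x + h *\<^sub>R b - y) \<bullet> b)\<^sup>2 / (4 * t\<^sup>2)) - 1 / (2 * t)) * gauss t (x + h *\<^sub>R b - y) * F y)) (at h)"
proof (rule leibniz_rule_field_derivative)
  show "((\<lambda>h. - (((x + h *\<^sub>R b - y) \<bullet> b) / (2 * t)) * gauss t (x + h *\<^sub>R b - y) * F y) has_real_derivative
        ((((x + h *\<^sub>R b - y) \<bullet> b)\<^sup>2 / (4 * t\<^sup>2)) - 1 / (2 * t)) * gauss t (x + h *\<^sub>R b - y) * F y) (at h)" for h y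
    using DERIV_cmult_right[OF gauss_derivative2_space[OF assms, of "x - y" h], of "F y"]
    by (simp add: add_diff_eq diff_add_eq)
  show "(\<lambda>y. - (((x + h *\<^sub>R b - y) \<bullet> b) / (2 * t)) * gauss t (x + h *\<^sub>R b - y) * F y) integrable_on cbox l u" for h
    using assms by (intro integrable_continuous continuous_intros continuous_on_F) auto
  show "continuous_on (UNIV \<times> cbox l u) (\<lambda>(h, y). ((((x + h *\<^sub>R b - y) \<bullet> b)\<^sup>2 / (4 * t\<^sup>2)) - 1 / (2 * t)) * gauss t (x + h *\<^sub>R b - y) * F y)"
    using assms unfolding case_prod_unfold by (intro continuous_intros continuous_on_F) auto
qed auto

text \<open>The left side is the Laplacian of \<open>gconv F l u t\<close> at \<open>x\<close> and
  the right side its time derivative, as computed in the preceding lemmas.\<close>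

lemma gconv_heat_equation:
  assumes "t > 0"
  shows "(\<Sum>b\<in>Basis. integral (cbox l u) (\<lambda>y. ((((x - y) \<bullet> b)\<^sup>2 / (4 * t\<^sup>2)) - 1 / (2 * t)) * gauss t (x - y) * F y))
    = integral (cbox l u) (\<lambda>y. ((norm (x - y))\<^sup>2 / (4 * t\<^sup>2) - real DIM('a) / (2 * t)) * gauss t (x - y) * F y)"
proof -
  have "(\<Sum>b\<in>Basis. integral (cbox l u) (\<lambda>y. ((((x - y) \<bullet> b)\<^sup>2 / (4 * t\<^sup>2)) - 1 / (2 * t)) * gauss t (x - y) * F y))
    = integral (cbox l u) (\<lambda>y. \<Sum>b\<in>Basis. ((((x - y) \<bullet> b)\<^sup>2 / (4 * t\<^sup>2)) - 1 / (2 * t)) * gauss t (x - y) * F y)"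
    using assms by (intro integral_sum[symmetric] integrable_continuous continuous_intros continuous_on_F) auto
  also have "\<dots> = integral (cbox l u) (\<lambda>y. ((norm (x - y))\<^sup>2 / (4 * t\<^sup>2) - real DIM('a) / (2 * t)) * gauss t (x - y) * F y)"
  proof (intro arg_cong2[where f=integral] ext refl)
    fix y
    have "(norm (x - y))\<^sup>2 = (\<Sum>b\<in>Basis. ((x - y) \<bullet> b)\<^sup>2)"
      by (subst power2_norm_eq_inner, subst euclidean_inner) (simp add: power2_eq_square)
    then show "(\<Sum>b\<in>Basis. ((((x - y) \<bullet> b)\<^sup>2 / (4 * t\<^sup>2)) - 1 / (2 * t)) * gauss t (x - y) * F y)
      = ((norm (x - y))\<^sup>2 / (4 * t\<^sup>2) - real DIM('a) / (2 * t)) * gauss t (x - y) * F y"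
      by (simp add: sum_distrib_right[symmetric] sum_subtractf sum_divide_distrib)
  qed
  finally show ?thesis .
qed

end


section \<open>Complete orthonormal systems of bounded functions\<close>

text \<open>On a finite measure space these functions are integrable and closed under sums and
  products, so integrability conditions reduce to syntactic rules. Eigenfunctions, Gaussians,
  indicators and the heat kernel at a fixed time all belong to the class.\<close>

definition bounded_measurable :: "'b measure \<Rightarrow> ('b \<Rightarrow> real) \<Rightarrow> bool" where
  "bounded_measurable M g \<longleftrightarrow> g \<in> borel_measurable M \<and> (\<exists>B. \<forall>x\<in>space M. \<bar>g x\<bar> \<le> B)"

lemma bounded_measurable_const: "bounded_measurable M (\<lambda>_. c)"
  by (auto simp: bounded_measurable_def)

lemma bounded_measurable_add:
  assumes "bounded_measurable M f" "bounded_measurable M g"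
  shows "bounded_measurable M (\<lambda>x. f x + g x)"
proof -
  obtain A B where "\<forall>x\<in>space M. \<bar>f x\<bar> \<le> A" "\<forall>x\<in>space M. \<bar>g x\<bar> \<le> B"
    using assms by (auto simp: bounded_measurable_def)
  then have "\<forall>x\<in>space M. \<bar>f x + g x\<bar> \<le> A + B" by force
  then show ?thesis using assms by (auto simp: bounded_measurable_def)
qed

lemma bounded_measurable_mult:
  assumes "bounded_measurable M f" "bounded_measurable M g"
  shows "bounded_measurable M (\<lambda>x. f x * g x)"
proof -
  obtain A B where "\<forall>x\<in>space M. \<bar>f x\<bar> \<le> A" "\<forall>x\<in>space M. \<bar>g x\<bar> \<le> B"
    using assms by (auto simp: bounded_measurable_def)
  then have "\<forall>x\<in>space M. \<bar>f x * g x\<bar> \<le> A * B"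
    unfolding abs_mult by (intro ballI mult_mono') auto
  then show ?thesis using assms by (auto simp: bounded_measurable_def)
qed

lemma bounded_measurable_sum:
  assumes "\<And>k. k \<in> A \<Longrightarrow> bounded_measurable M (f k)"
  shows "bounded_measurable M (\<lambda>x. \<Sum>k\<in>A. f k x)"
  using assms
  by (induction A rule: infinite_finite_induct)
    (auto intro: bounded_measurable_const bounded_measurable_add)

lemma bounded_measurable_diff:
  assumes "bounded_measurable M f" "bounded_measurable M g"
  shows "bounded_measurable M (\<lambda>x. f x - g x)"
  using bounded_measurable_add[OF assms(1) bounded_measurable_mult[OF bounded_measurable_const[of M "-1"] assms(2)]]
  by simp

lemma bounded_measurable_abs:
  "bounded_measurable M f \<Longrightarrow> bounded_measurable M (\<lambda>x. \<bar>f x\<bar>)"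
  by (auto simp: bounded_measurable_def)

lemma bounded_measurable_power2:
  "bounded_measurable M f \<Longrightarrow> bounded_measurable M (\<lambda>x. (f x)\<^sup>2)"
  using bounded_measurable_mult[of M f f] by (simp add: power2_eq_square)

lemmas bounded_measurable_intros =
  bounded_measurable_const bounded_measurable_add bounded_measurable_mult bounded_measurable_sum
  bounded_measurable_diff bounded_measurable_abs bounded_measurable_power2

lemma (in finite_measure) bounded_measurable_integrable:
  assumes "bounded_measurable M f"
  shows "integrable M f"
proof -
  obtain B where "f \<in> borel_measurable M" "\<forall>x\<in>space M. \<bar>f x\<bar> \<le> B"
    using assms by (auto simp: bounded_measurable_def)
  then show ?thesis by (intro integrable_const_bound[where B=B]) auto
qed

text \<open>Completeness means that the orthogonal complement of the system is trivial. Density of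
  finite combinations is not part of the notion and has to be derived.\<close>

locale complete_orthonormal = finite_measure M for M :: "'b measure" +
  fixes u :: "nat \<Rightarrow> 'b \<Rightarrow> real"
  assumes bmu: "\<And>k. bounded_measurable M (u k)"
    and orthonormal: "\<And>j k. (\<integral>x. u j x * u k x \<partial>M) = (if j = k then 1 else 0)"
    and complete: "\<And>g. g \<in> borel_measurable M \<Longrightarrow> integrable M (\<lambda>x. (g x)\<^sup>2) \<Longrightarrow>
       (\<And>k. (\<integral>x. g x * u k x \<partial>M) = 0) \<Longrightarrow> AE x in M. g x = 0"
begin

lemma integral_mult_finite_expansion:
  assumes "bounded_measurable M f" "finite A"
  shows "(\<integral>x. f x * (\<Sum>k\<in>A. c k * u k x) \<partial>M) = (\<Sum>k\<in>A. c k * (\<integral>x. f x * u k x \<partial>M))"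
proof -
  have "(\<integral>x. f x * (\<Sum>k\<in>A. c k * u k x) \<partial>M) = (\<integral>x. (\<Sum>k\<in>A. c k * (f x * u k x)) \<partial>M)"
    by (simp add: sum_distrib_left mult_ac)
  also have "\<dots> = (\<Sum>k\<in>A. c k * (\<integral>x. f x * u k x \<partial>M))"
    by (subst Bochner_Integration.integral_sum)
      (auto intro!: bounded_measurable_integrable bounded_measurable_intros assms bmu)
  finally show ?thesis .
qed

lemma finite_expansion_coefficient:
  assumes "finite A"
  shows "(\<integral>x. (\<Sum>k\<in>A. c k * u k x) * u j x \<partial>M) = (if j \<in> A then c j else 0)"
proof -
  have "(\<integral>x. (\<Sum>k\<in>A. c k * u k x) * u j x \<partial>M) = (\<integral>x. u j x * (\<Sum>k\<in>A. c k * u k x) \<partial>M)"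
    by (simp only: mult.commute)
  also have "\<dots> = (\<Sum>k\<in>A. c k * (if j = k then 1 else 0))"
    by (subst integral_mult_finite_expansion[OF bmu assms]) (simp only: orthonormal)
  finally show ?thesis using assms by (simp add: if_distrib cong: if_cong)
qed

lemma integral_finite_expansion_power2:
  assumes "finite A"
  shows "(\<integral>x. (\<Sum>k\<in>A. c k * u k x)\<^sup>2 \<partial>M) = (\<Sum>k\<in>A. (c k)\<^sup>2)"
  unfolding power2_eq_square
  by (subst integral_mult_finite_expansion)
    (auto intro!: bounded_measurable_intros bmu sum.cong simp: assms finite_expansion_coefficient)

text \<open>The Cauchy-Schwarz inequality against the constant 1 in arithmetic-geometric form. The
  weight \<open>c\<close> stays free, so that a use can decide how much falls on the quadratic
  term.\<close>

lemma integral_abs_le: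
  assumes f: "bounded_measurable M f" and c: "c > 0"
  shows "(\<integral>x. \<bar>f x\<bar> \<partial>M) \<le> ((\<integral>x. (f x)\<^sup>2 \<partial>M) / c + c * measure M (space M)) / 2"
proof -
  have "\<bar>f x\<bar> \<le> ((f x)\<^sup>2 / c + c) / 2" for x
  proof -
    have "0 \<le> (\<bar>f x\<bar> - c)\<^sup>2" by simp
    then have "2 * \<bar>f x\<bar> * c \<le> (f x)\<^sup>2 + c\<^sup>2" by (simp add: power2_diff)
    then show ?thesis using c by (simp add: field_simps power2_eq_square)
  qed
  moreover have "integrable M (\<lambda>x. (f x)\<^sup>2)" "integrable M (\<lambda>x. \<bar>f x\<bar>)"
    by (intro bounded_measurable_integrable bounded_measurable_power2 bounded_measurable_abs f)+
  ultimately have "(\<integral>x. \<bar>f x\<bar> \<partial>M) \<le> (\<integral>x. ((f x)\<^sup>2 / c + c) / 2 \<partial>M)"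
    by (intro integral_mono) simp_all
  also have "\<dots> = ((\<integral>x. (f x)\<^sup>2 \<partial>M) / c + c * measure M (space M)) / 2"
    using bounded_measurable_integrable[OF bounded_measurable_power2[OF f]] by simp
  finally show ?thesis .
qed

lemma bessel_inequality:
  assumes f: "bounded_measurable M f" and "finite A"
  shows "(\<Sum>k\<in>A. (\<integral>x. f x * u k x \<partial>M)\<^sup>2) \<le> (\<integral>x. (f x)\<^sup>2 \<partial>M)"
proof -
  define c where "c = (\<lambda>k. \<integral>x. f x * u k x \<partial>M)"
  let ?S = "\<lambda>x. \<Sum>k\<in>A. c k * u k x"
  have S: "bounded_measurable M ?S" by (intro bounded_measurable_intros bmu)
  note bi = bounded_measurable_integrable bounded_measurable_intros f S
  have "0 \<le> (\<integral>x. (f x - ?S x)\<^sup>2 \<partial>M)" by simp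
  also have "\<dots> = (\<integral>x. (f x)\<^sup>2 + (?S x)\<^sup>2 - 2 * (f x * ?S x) \<partial>M)"
    by (simp add: power2_diff algebra_simps)
  also have "\<dots> = (\<integral>x. (f x)\<^sup>2 \<partial>M) + (\<integral>x. (?S x)\<^sup>2 \<partial>M) - 2 * (\<integral>x. f x * ?S x \<partial>M)"
    using bi by (simp add: bounded_measurable_integrable bounded_measurable_intros)
  also have "(\<integral>x. f x * ?S x \<partial>M) = (\<Sum>k\<in>A. (c k)\<^sup>2)"
    by (subst integral_mult_finite_expansion[OF f assms(2)]) (simp add: c_def power2_eq_square)
  also have "(\<integral>x. (?S x)\<^sup>2 \<partial>M) = (\<Sum>k\<in>A. (c k)\<^sup>2)"
    by (rule integral_finite_expansion_power2[OF assms(2)])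
  finally show ?thesis by (simp add: c_def)
qed

text \<open>The partial sums along a sequence with square-summable blocks converge almost everywhere and in
  \<open>L\<^sup>1\<close>; completeness of the system identifies the limit, which is square integrable by Fatou's lemma.\<close>

lemma L1_approximation:
  assumes f: "bounded_measurable M f" and e: "e > 0"
  obtains N where "N \<ge> N0"
    "(\<integral>x. \<bar>f x - (\<Sum>k<N. (\<integral>y. f y * u k y \<partial>M) * u k x)\<bar> \<partial>M) < e"
proof -
  define c where "c = (\<lambda>k. \<integral>y. f y * u k y \<partial>M)"
  define V where "V = measure M (space M)"
  have V: "V \<ge> 0" by (simp add: V_def)
  define S where "S = (\<lambda>N x. \<Sum>k<N. c k * u k x)"
  have bS: "bounded_measurable M (S N)" for N unfolding S_def by (intro bounded_measurable_intros bmu)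
  note bi = bounded_measurable_integrable bounded_measurable_intros f bS bmu
  have [measurable]: "u k \<in> borel_measurable M" "f \<in> borel_measurable M" "S k \<in> borel_measurable M" for k
    using bmu f bS by (auto simp: bounded_measurable_def)
  have "summable (\<lambda>k. (c k)\<^sup>2)"
    by (rule summableI_nonneg_bounded[where x="\<integral>x. (f x)\<^sup>2 \<partial>M"])
      (use bessel_inequality[OF f] in \<open>auto simp: c_def\<close>)
  then have "\<forall>e>0. \<exists>N. \<forall>m\<ge>N. \<forall>n. norm (\<Sum>k=m..<n. (c k)\<^sup>2) < e"
    by (simp add: summable_Cauchy)
  \<comment> \<open>Square sums below \<open>(1/4) ^ j\<close> yield, by
    \<open>integral_abs_le\<close> with weight \<open>(1/2) ^ j\<close>, blocks whose L1 norms are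
    of order \<open>(1/2) ^ j\<close> and hence summable.\<close>
  then have "\<forall>j::nat. \<exists>N. \<forall>m\<ge>N. \<forall>n. norm (\<Sum>k=m..<n. (c k)\<^sup>2) < (1/4) ^ j"
    by simp
  then obtain P where P: "\<And>j m n. m \<ge> P j \<Longrightarrow> norm (\<Sum>k=m..<n. (c k)\<^sup>2) < (1/4) ^ j"
    by metis
  \<comment> \<open>The summand \<open>N0\<close> meets the demand \<open>N \<ge> N0\<close>; the
    sum of all \<open>P i + 1\<close> keeps \<open>r\<close> monotone, past \<open>P j\<close>, and
    above \<open>j\<close>.\<close>
  define r where "r = (\<lambda>j::nat. N0 + (\<Sum>i\<le>j. P i + 1))"
  have rP: "r j \<ge> P j" for j
    using member_le_sum[of j "{..j}" "\<lambda>i. P i + 1"] by (simp add: r_def)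
  have rj: "r j > j" for j
    using sum_mono[of "{..j}" "\<lambda>i. 1" "\<lambda>i. P i + 1"] by (simp add: r_def)
  have r0: "r j \<ge> N0" for j by (simp add: r_def)
  have rS: "r j \<le> r (Suc j)" for j by (simp add: r_def)
  define b where "b = (\<lambda>j x. S (r (Suc j)) x - S (r j) x)"
  have bb: "bounded_measurable M (b j)" for j unfolding b_def by (intro bi)
  have b_eq: "b j x = (\<Sum>k\<in>{r j..<r (Suc j)}. c k * u k x)" for j x
    unfolding b_def S_def lessThan_atLeast0 using sum_diff_nat_ivl[of 0 "r j" "r (Suc j)"] rS by simp
  have b1: "(\<integral>x. \<bar>b j x\<bar> \<partial>M) \<le> (1 + V) * (1/2) ^ j" for j
  proof -
    have "(\<integral>x. (b j x)\<^sup>2 \<partial>M) = (\<Sum>k\<in>{r j..<r (Suc j)}. (c k)\<^sup>2)"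
      unfolding b_eq by (rule integral_finite_expansion_power2) simp
    also have "\<dots> \<le> (1/4) ^ j" using P[OF rP, of j "r (Suc j)"] by simp
    finally have "(\<integral>x. (b j x)\<^sup>2 \<partial>M) / (1/2) ^ j \<le> (1/4) ^ j / (1/2) ^ j"
      by (intro divide_right_mono) auto
    also have "\<dots> = (1/2) ^ j" by (simp add: power_divide[symmetric])
    finally have "(\<integral>x. \<bar>b j x\<bar> \<partial>M) \<le> ((1/2) ^ j + (1/2) ^ j * V) / 2"
      using integral_abs_le[OF bb, of "(1/2) ^ j" j] unfolding V_def by simp
    also have "\<dots> \<le> (1 + V) * (1/2) ^ j" using V by (simp add: field_simps)
    finally show ?thesis .
  qed
  have geo: "summable (\<lambda>j. (1 + V) * (1/2) ^ j)" by (intro summable_mult summable_geometric) simp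
  have sb: "summable (\<lambda>j. \<integral>x. \<bar>b j x\<bar> \<partial>M)"
    by (rule summable_comparison_test'[OF geo, of 0]) (use b1 in auto)
  have [measurable]: "b j \<in> borel_measurable M" for j
    using bb by (auto simp: bounded_measurable_def)
  have AEs: "AE x in M. summable (\<lambda>j. \<bar>b j x\<bar>)"
  proof -
    have "(\<integral>\<^sup>+x. (\<Sum>j. ennreal \<bar>b j x\<bar>) \<partial>M) = (\<Sum>j. \<integral>\<^sup>+x. ennreal \<bar>b j x\<bar> \<partial>M)"
      by (intro nn_integral_suminf) auto
    also have "\<dots> = (\<Sum>j. ennreal (\<integral>x. \<bar>b j x\<bar> \<partial>M))"
      by (intro arg_cong[where f=suminf] ext nn_integral_eq_integral bounded_measurable_integrable
          bounded_measurable_abs bb) auto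
    also have "\<dots> \<noteq> \<infinity>" using sb by (simp add: ennreal_suminf_neq_top)
    finally have "AE x in M. (\<Sum>j. ennreal \<bar>b j x\<bar>) \<noteq> \<infinity>"
        by (intro nn_integral_PInf_AE) auto
    then show ?thesis by eventually_elim (auto intro: summable_suminf_not_top)
  qed
  \<comment> \<open>Where the blocks are not summable \<open>F\<close> has an arbitrary value; by
    \<open>AEs\<close> this happens on a null set only.\<close>
  define F where "F = (\<lambda>x. S (r 0) x + (\<Sum>j. b j x))"
  have [measurable]: "F \<in> borel_measurable M" unfolding F_def by measurable
  have tele: "(\<Sum>j<m. b j x) = S (r m) x - S (r 0) x" for m x
    unfolding b_def by (rule sum_lessThan_telescope)
  have lim: "AE x in M. (\<lambda>m. S (r m) x) \<longlonglongrightarrow> F x"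
    using AEs
  proof eventually_elim
    case (elim x)
    then have "(\<lambda>m. \<Sum>j<m. b j x) \<longlonglongrightarrow> (\<Sum>j. b j x)"
      by (rule summable_LIMSEQ[OF summable_rabs_cancel])
    then have "(\<lambda>m. S (r 0) x + (\<Sum>j<m. b j x)) \<longlonglongrightarrow> S (r 0) x + (\<Sum>j. b j x)"
      by (intro tendsto_intros)
    then show ?case by (simp add: tele F_def)
  qed
  have intF: "integrable M F"
    unfolding F_def
    by (intro Bochner_Integration.integrable_add integrable_suminf) (use AEs sb in \<open>simp_all add: bounded_measurable_integrable bS bb\<close>)
  define tail where "tail = (\<lambda>m. \<Sum>j. \<integral>x. \<bar>b (j + m) x\<bar> \<partial>M)"
  have tail: "tail \<longlonglongrightarrow> 0"
    unfolding tail_def by (rule suminf_exist_split2[OF sb])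
  have Ftail: "(\<integral>x. \<bar>F x - S (r m) x\<bar> \<partial>M) \<le> tail m" for m
  proof -
    have s1: "AE x in M. summable (\<lambda>j. norm \<bar>b (j + m) x\<bar>)"
      using AEs by eventually_elim (auto intro: summable_ignore_initial_segment)
    have s2: "summable (\<lambda>j. \<integral>x. norm \<bar>b (j + m) x\<bar> \<partial>M)"
      using summable_ignore_initial_segment[OF sb, of m] by simp
    have ib: "integrable M (\<lambda>x. \<bar>b (j + m) x\<bar>)" for j by (intro bi bb)
    have "(\<integral>x. \<bar>F x - S (r m) x\<bar> \<partial>M) \<le> (\<integral>x. (\<Sum>j. \<bar>b (j + m) x\<bar>) \<partial>M)"
    proof (rule integral_mono_AE)
      show "integrable M (\<lambda>x. \<bar>F x - S (r m) x\<bar>)"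
        by (intro integrable_abs Bochner_Integration.integrable_diff intF bi)
      show "integrable M (\<lambda>x. \<Sum>j. \<bar>b (j + m) x\<bar>)"
        by (rule integrable_suminf[OF ib s1 s2])
      show "AE x in M. \<bar>F x - S (r m) x\<bar> \<le> (\<Sum>j. \<bar>b (j + m) x\<bar>)"
        using AEs
      proof eventually_elim
        case (elim x)
        then have "(\<Sum>j. b j x) = (\<Sum>j. b (j + m) x) + (\<Sum>j<m. b j x)"
          by (rule suminf_split_initial_segment[OF summable_rabs_cancel])
        then have "F x - S (r m) x = (\<Sum>j. b (j + m) x)" by (simp add: F_def tele)
        moreover have "\<bar>\<Sum>j. b (j + m) x\<bar> \<le> (\<Sum>j. \<bar>b (j + m) x\<bar>)"
          using elim by (intro summable_rabs) (auto intro: summable_ignore_initial_segment)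
        ultimately show ?case by simp
      qed
    qed
    also have "\<dots> = tail m" unfolding tail_def by (rule integral_suminf[OF ib s1 s2])
    finally show ?thesis .
  qed
  have "integrable M (\<lambda>x. (F x)\<^sup>2)"
  proof (rule integrableI_bounded)
    let ?C = "\<integral>x. (f x)\<^sup>2 \<partial>M"
    have "(\<integral>\<^sup>+ x. ennreal (norm ((F x)\<^sup>2)) \<partial>M) = (\<integral>\<^sup>+ x. liminf (\<lambda>m. ennreal ((S (r m) x)\<^sup>2)) \<partial>M)"
      using lim
    proof (intro nn_integral_cong_AE, eventually_elim)
      case (elim x)
      then have "(\<lambda>m. ennreal ((S (r m) x)\<^sup>2)) \<longlonglongrightarrow> ennreal ((F x)\<^sup>2)"
        by (intro tendsto_ennrealI tendsto_intros)
      from lim_imp_Liminf[OF sequentially_bot this] show ?case by simp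
    qed
    also have "\<dots> \<le> liminf (\<lambda>m. \<integral>\<^sup>+ x. ennreal ((S (r m) x)\<^sup>2) \<partial>M)"
      by (rule nn_integral_liminf) measurable
    also have "\<dots> \<le> liminf (\<lambda>m. ennreal ?C)"
    proof (intro Liminf_mono always_eventually allI)
      fix m
      have "(\<integral>\<^sup>+ x. ennreal ((S (r m) x)\<^sup>2) \<partial>M) = ennreal (\<integral>x. (S (r m) x)\<^sup>2 \<partial>M)"
        by (intro nn_integral_eq_integral bi) auto
      also have "(\<integral>x. (S (r m) x)\<^sup>2 \<partial>M) = (\<Sum>k<r m. (c k)\<^sup>2)"
        unfolding S_def by (rule integral_finite_expansion_power2) simp
      also have "ennreal (\<Sum>k<r m. (c k)\<^sup>2) \<le> ennreal ?C"
        using bessel_inequality[OF f, of "{..<r m}"] by (intro ennreal_leI) (simp add: c_def)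
      finally show "(\<integral>\<^sup>+ x. ennreal ((S (r m) x)\<^sup>2) \<partial>M) \<le> ennreal ?C" .
    qed
    also have "\<dots> < \<infinity>" by (simp add: Liminf_const)
    finally show "(\<integral>\<^sup>+ x. ennreal (norm ((F x)\<^sup>2)) \<partial>M) < \<infinity>" .
  qed measurable
  have "AE x in M. f x - F x = 0"
  proof (rule complete)
    have "integrable M (\<lambda>x. 2 * (f x)\<^sup>2 + 2 * (F x)\<^sup>2)"
      using \<open>integrable M (\<lambda>x. (F x)\<^sup>2)\<close> f
      by (intro Bochner_Integration.integrable_add integrable_mult_right)
        (simp_all add: bounded_measurable_integrable bounded_measurable_power2)
    then show "integrable M (\<lambda>x. (f x - F x)\<^sup>2)"
    proof (rule Bochner_Integration.integrable_bound)
      have "(f x - F x)\<^sup>2 \<le> 2 * (f x)\<^sup>2 + 2 * (F x)\<^sup>2" for x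
        using zero_le_power2[of "f x + F x"] by (simp add: power2_sum power2_diff)
      then show "AE x in M. norm ((f x - F x)\<^sup>2) \<le> norm (2 * (f x)\<^sup>2 + 2 * (F x)\<^sup>2)"
        by auto
    qed measurable
    fix k
    obtain B where B: "\<And>x. x \<in> space M \<Longrightarrow> \<bar>u k x\<bar> \<le> B"
      using bmu unfolding bounded_measurable_def by meson
    have intk: "integrable M (\<lambda>x. h x * u k x)" if "integrable M h" for h
    proof (rule Bochner_Integration.integrable_bound)
      show "integrable M (\<lambda>x. h x * B)" using that by simp
      show "AE x in M. norm (h x * u k x) \<le> norm (h x * B)"
        using B by (auto simp: abs_mult intro!: mult_left_mono order_trans[OF B abs_ge_self])
    qed (use that in measurable)
    \<comment> \<open>As \<open>r m > k\<close>, the partial sum and \<open>f\<close> have the same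
      \<open>k\<close>-th coefficient. What is left is the L1 tail of the series times a sup bound
      for \<open>u k\<close>.\<close>
    have "norm (\<integral>x. (f x - F x) * u k x \<partial>M) \<le> tail m * \<bar>B\<bar>" if "m \<ge> k" for m
    proof -
      have I: "integrable M (\<lambda>x. f x * u k x)" "integrable M (\<lambda>x. S (r m) x * u k x)"
          "integrable M (\<lambda>x. F x * u k x)"
        by (intro intk intF bounded_measurable_integrable f bS)+
      have "(\<integral>x. S (r m) x * u k x \<partial>M) = c k"
        using rj[of m] that by (simp add: S_def finite_expansion_coefficient)
      then have "(\<integral>x. (f x - F x) * u k x \<partial>M) = (\<integral>x. (S (r m) x - F x) * u k x \<partial>M)"
        using I by (simp add: left_diff_distrib c_def)
      then have "norm (\<integral>x. (f x - F x) * u k x \<partial>M) = norm (\<integral>x. (S (r m) x - F x) * u k x \<partial>M)" by simp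
      also have "\<dots> \<le> (\<integral>x. norm ((S (r m) x - F x) * u k x) \<partial>M)" by simp
      also have "\<dots> \<le> (\<integral>x. \<bar>F x - S (r m) x\<bar> * \<bar>B\<bar> \<partial>M)"
      proof (rule integral_mono)
        show "norm ((S (r m) x - F x) * u k x) \<le> \<bar>F x - S (r m) x\<bar> * \<bar>B\<bar>" if "x \<in> space M" for x
          using B[OF that] by (simp add: abs_mult abs_minus_commute mult_left_mono)
      qed (intro integrable_norm intk integrable_mult_left integrable_abs
            Bochner_Integration.integrable_diff intF bi)+
      also have "\<dots> \<le> tail m * \<bar>B\<bar>" using Ftail[of m] by (simp add: mult_right_mono)
      finally show ?thesis .
    qed
    then have "norm (\<integral>x. (f x - F x) * u k x \<partial>M) \<le> 0 * \<bar>B\<bar>"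
      by (intro LIMSEQ_le_const[OF tendsto_mult_right[OF tail]]) auto
    then show "(\<integral>x. (f x - F x) * u k x \<partial>M) = 0" by simp
  qed measurable
  then have fF: "AE x in M. f x = F x" by eventually_elim simp
  obtain m where m: "tail m < e"
    using order_tendstoD(2)[OF tail e] by (metis eventually_sequentially order_refl)
  have "(\<integral>x. \<bar>f x - S (r m) x\<bar> \<partial>M) = (\<integral>x. \<bar>F x - S (r m) x\<bar> \<partial>M)"
    using fF by (intro integral_cong_AE) auto
  also have "\<dots> < e" using Ftail[of m] m by simp
  finally show ?thesis
    using that[OF r0[of m]] by (simp add: S_def c_def)
qed

end


section \<open>Comparison with the Gaussian\<close>

lemma has_real_derivative_along_line:
  fixes f :: "'a::real_normed_vector \<Rightarrow> real"
  assumes "(f has_derivative D) (at (x + h *\<^sub>R b))"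
  shows "((\<lambda>h. f (x + h *\<^sub>R b)) has_real_derivative D b) (at h)"
proof -
  interpret linear D using assms by (rule has_derivative_linear)
  have "((\<lambda>h. x + h *\<^sub>R b) has_derivative (\<lambda>k. k *\<^sub>R b)) (at h)"
    by (auto intro!: derivative_eq_intros)
  from has_derivative_compose[OF this assms]
  have "((\<lambda>h. f (x + h *\<^sub>R b)) has_derivative (\<lambda>k. D (k *\<^sub>R b))) (at h)" .
  moreover have "(\<lambda>k. D (k *\<^sub>R b)) = (*) (D b)"
    by (auto simp: scale)
  ultimately show ?thesis by (simp add: has_field_derivative_def)
qed

text \<open>The factor 8 in place of 4 absorbs a time shift \<open>d \<le> t\<close>, which keeps the comparison function smooth
  down to time 0.\<close>

definition wide_gauss :: "real \<Rightarrow> 'a::euclidean_space \<Rightarrow> real" where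
  "wide_gauss t z = t powr (- real DIM('a) / 2) * exp (- (norm z)\<^sup>2 / (8 * t))"

lemma wide_gauss_nonneg: "wide_gauss t z \<ge> 0"
  by (simp add: wide_gauss_def)

lemma continuous_on_wide_gauss [continuous_intros]:
  assumes "continuous_on S f" "continuous_on S g" "\<And>x. x \<in> S \<Longrightarrow> f x > 0"
  shows "continuous_on S (\<lambda>x. wide_gauss (f x) (g x))"
proof -
  have "f x \<noteq> 0" if "x \<in> S" for x using assms(3)[OF that] by simp
  then show ?thesis
    unfolding wide_gauss_def using assms(1,2) by (intro continuous_intros) auto
qed

lemma gauss_shift_le_wide_gauss:
  fixes z :: "'a::euclidean_space"
  assumes "0 < d" "d \<le> t"
  shows "gauss (t + d) z \<le> wide_gauss t z"
  unfolding gauss_def wide_gauss_def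
proof (intro mult_mono)
  show "(t + d) powr (- real DIM('a) / 2) \<le> t powr (- real DIM('a) / 2)"
    using assms by (intro powr_mono2') auto
  have "(norm z)\<^sup>2 / (8 * t) \<le> (norm z)\<^sup>2 / (4 * (t + d))"
    using assms by (intro divide_left_mono) (auto simp: zero_le_mult_iff)
  then show "exp (- (norm z)\<^sup>2 / (4 * (t + d))) \<le> exp (- (norm z)\<^sup>2 / (8 * t))"
    by simp
qed auto

text \<open>A lower bound, independent of \<open>d\<close>, for the mass of \<open>gauss d\<close>
  on the ball of radius \<open>sqrt d\<close>: the exponential is at least \<open>exp (-1/4)\<close>
  there, and the volume cancels the power of \<open>d\<close>. It stands in for the normalising
  constant.\<close>

definition gauss_const :: "'a::euclidean_space itself \<Rightarrow> real" where
  "gauss_const _ = exp (-1/4) * measure lborel (ball (0::'a) 1)"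

lemma gauss_const_pos: "gauss_const TYPE('a::euclidean_space) > 0"
  by (simp add: gauss_const_def content_ball_pos)

lemma gconv_nonneg:
  fixes F :: "'a::euclidean_space \<Rightarrow> real"
  assumes "continuous_on (cbox l u) F" "\<And>y. F y \<ge> 0" "t > 0"
  shows "gconv F l u t x \<ge> 0"
  unfolding gconv_def
proof (rule Henstock_Kurzweil_Integration.integral_nonneg)
  show "(\<lambda>y. gauss t (x - y) * F y) integrable_on cbox l u"
    using assms by (intro integrable_continuous continuous_intros) auto
qed (intro mult_nonneg_nonneg assms(2) gauss_nonneg)

text \<open>This supplies the initial comparison for the maximum principle. On the ball of radius
  \<open>sqrt d\<close> about \<open>x\<close> the function \<open>F\<close> exceeds
  \<open>F x - e\<close> by uniform continuity, the Gaussian has mass at least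
  \<open>gauss_const\<close> there, and the rest of the integral is nonnegative. One
  \<open>d0\<close> serves all \<open>x\<close> in the closed ball.\<close>

lemma gconv_lower_bound:
  fixes F :: "'a::euclidean_space \<Rightarrow> real"
  assumes cont: "continuous_on UNIV F" and nonneg: "\<And>y. F y \<ge> 0"
    and box: "ball 0 (R + 1) \<subseteq> cbox l u" and e: "e > 0"
  obtains d0 where "d0 > 0" "\<And>d x. 0 < d \<Longrightarrow> d \<le> d0 \<Longrightarrow> x \<in> cball 0 R \<Longrightarrow>
     gauss_const TYPE('a) * (F x - e) \<le> gconv F l u d x"
proof -
  have "uniformly_continuous_on (cball 0 (R + 1)) F"
    using cont by (intro compact_uniformly_continuous) (auto intro: continuous_on_subset)
  then obtain r where r: "r > 0" "\<And>x y. x \<in> cball 0 (R + 1) \<Longrightarrow> y \<in> cball 0 (R + 1) \<Longrightarrow>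
      dist y x < r \<Longrightarrow> dist (F y) (F x) < e"
    using e unfolding uniformly_continuous_on_def by metis
  \<comment> \<open>\<open>sqrt d \<le> 1\<close> keeps the ball about \<open>x\<close> inside
    \<open>ball 0 (R + 1)\<close> and so inside the box; \<open>sqrt d \<le> r\<close> is the range
    of the uniform continuity.\<close>
  define d0 where "d0 = (min 1 r)\<^sup>2"
  show ?thesis
  proof
    show "d0 > 0" using r by (simp add: d0_def)
    fix d :: real and x :: 'a
    assume d: "0 < d" "d \<le> d0" and x: "x \<in> cball 0 R"
    let ?r = "sqrt d"
    have "?r \<le> sqrt ((min 1 r)\<^sup>2)" using d(2) unfolding d0_def by (rule real_sqrt_le_mono)
    then have "?r \<le> min 1 r" using r(1) by simp
    then have sr: "?r \<le> 1" "?r \<le> r" "?r > 0" using d by auto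
    have sub: "ball x ?r \<subseteq> cbox l u"
    proof -
      have "ball x ?r \<subseteq> ball 0 (R + 1)"
        using x sr by (subst ball_subset_ball_iff) (simp add: dist_norm add_mono)
      then show ?thesis using box by blast
    qed
    have int: "(\<lambda>y. gauss d (x - y) * F y) integrable_on cbox l u"
      using d cont by (intro integrable_continuous continuous_intros) (auto intro: continuous_on_subset)
    have nn: "gauss d (x - y) * F y \<ge> 0" for y
      by (intro mult_nonneg_nonneg nonneg gauss_nonneg)
    have intball: "(\<lambda>y. gauss d (x - y) * F y) integrable_on ball x ?r"
    proof -
      have "(\<lambda>y. gauss d (x - y) * F y) absolutely_integrable_on cbox l u"
        using nn by (intro nonnegative_absolutely_integrable_1 int) auto
      then have "(\<lambda>y. gauss d (x - y) * F y) absolutely_integrable_on ball x ?r"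
        by (rule set_integrable_subset) (use sub in auto)
      then show ?thesis by (rule set_lebesgue_integral_eq_integral)
    qed
    show "gauss_const TYPE('a) * (F x - e) \<le> gconv F l u d x"
    proof (cases "F x - e \<le> 0")
      case True
      then have "gauss_const TYPE('a) * (F x - e) \<le> 0"
        using gauss_const_pos[where 'a='a] by (simp add: mult_le_0_iff)
      also have "0 \<le> gconv F l u d x"
        by (rule gconv_nonneg) (use d nonneg cont in \<open>auto intro: continuous_on_subset\<close>)
      finally show ?thesis .
    next
      case False
      define m where "m = d powr (- real DIM('a) / 2) * exp (-1/4) * (F x - e)"
      have lower: "m \<le> gauss d (x - y) * F y" if "y \<in> ball x ?r" for y
        unfolding m_def gauss_def
      proof (intro mult_mono)
        have "(norm (x - y))\<^sup>2 \<le> d"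
          using that d by (simp add: dist_norm real_less_rsqrt less_imp_le sqrt_ge_absD)
        then show "exp (-1/4) \<le> exp (- (norm (x - y))\<^sup>2 / (4 * d))"
          using d by (simp add: divide_simps)
        have "norm y \<le> norm x + ?r" using that norm_triangle_ineq4[of x "x - y"]
          by (simp add: dist_norm)
        also have "\<dots> \<le> R + 1" using x sr by (simp add: add_mono)
        finally have "dist (F y) (F x) < e"
          using r(2)[of x y] that x sr by (simp add: dist_commute)
        then show "F x - e \<le> F y" by (simp add: dist_real_def)
      qed (use False in auto)
      have "gauss_const TYPE('a) * (F x - e) = m * measure lborel (ball x ?r)"
      proof -
        have "measure lborel (ball x ?r) = ?r ^ DIM('a) * measure lborel (ball (0::'a) 1)"
          using sr by (simp add: content_ball_conv_unit_ball[of ?r x])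
        moreover have "?r ^ DIM('a) = d powr (real DIM('a) / 2)"
          using d by (simp add: powr_half_sqrt[symmetric] powr_realpow[symmetric] powr_powr)
        moreover have "d powr (- real DIM('a) / 2) * d powr (real DIM('a) / 2) = 1"
          using d by (simp add: powr_add[symmetric])
        ultimately show ?thesis
          unfolding m_def gauss_const_def by (simp add: field_simps)
      qed
      also have "\<dots> = integral (ball x ?r) (\<lambda>y. m)"
        using integral_mult_right[of "ball x ?r" m "\<lambda>_. 1"] lmeasure_integral[of "ball x ?r"]
        by simp
      also have "\<dots> \<le> integral (ball x ?r) (\<lambda>y. gauss d (x - y) * F y)"
      proof (intro integral_le)
        show "(\<lambda>y. gauss d (x - y) * F y) integrable_on ball x ?r" by (rule intball)
      qed (use lower in \<open>auto intro!: integrable_on_const\<close>)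
      also have "\<dots> \<le> gconv F l u d x"
        unfolding gconv_def
      proof (intro integral_subset_le sub int)
        show "(\<lambda>y. gauss d (x - y) * F y) integrable_on ball x ?r" by (rule intball)
      qed (use nn in auto)
      finally show ?thesis .
    qed
  qed
qed

text \<open>The definition of an eigenbasis leaves \<open>\<phi> k\<close> arbitrary outside the
  closed ball. Extended by zero it is continuous on the whole space, since it vanishes on the
  sphere, and integrals over boxes reduce to integrals over the ball.\<close>

locale dirichlet_basis =
  fixes R :: real and lam :: "nat \<Rightarrow> real" and \<phi> :: "nat \<Rightarrow> 'a::euclidean_space \<Rightarrow> real"
  assumes R_pos: "R > 0"
    and eigenbasis: "dirichlet_eigenbasis R lam \<phi>"
    and zero_outside: "norm x \<ge> R \<Longrightarrow> \<phi> k x = 0"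
begin

lemma continuous_\<phi>: "continuous_on S (\<phi> k)"
proof -
  have "continuous_on (cball 0 R \<union> {x. norm x \<ge> R}) (\<phi> k)"
  proof (rule continuous_on_closed_Un)
    show "continuous_on (cball 0 R) (\<phi> k)"
      using eigenbasis by (auto simp: dirichlet_eigenbasis_def dirichlet_eigenpair_def)
    show "continuous_on {x. norm x \<ge> R} (\<phi> k)"
      using zero_outside by (subst continuous_on_cong[where g="\<lambda>_. 0"]) auto
  qed (auto intro!: closed_Collect_le continuous_intros)
  moreover have "cball 0 R \<union> {x. norm x \<ge> R} = (UNIV :: 'a set)" by auto
  ultimately show ?thesis using continuous_on_subset by (metis subset_UNIV)
qed

text \<open>The finite combination vanishes on the sphere, where the convolution is nonnegative
  because \<open>F\<close> carries an absolute value; inside, both solve the heat equation. The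
  comparison at time 0 costs \<open>c * e\<close>, which equals the arbitrary
  \<open>e0\<close>.\<close>

lemma finite_heat_solution_le:
  fixes a :: "nat \<Rightarrow> real" and N :: nat
  defines "F \<equiv> \<lambda>y. \<bar>\<Sum>k<N. a k * \<phi> k y\<bar>"
  assumes t: "t > 0" and x: "x \<in> cball 0 R" and box: "ball 0 (R + 1) \<subseteq> cbox l u"
  shows "gauss_const TYPE('a) * (\<Sum>k<N. a k * exp (- lam k * t) * \<phi> k x)
    \<le> integral (cbox l u) (\<lambda>y. wide_gauss t (x - y) * F y)"
proof (rule field_le_epsilon)
  fix e0 :: real assume "e0 > 0"
  define c where "c = gauss_const TYPE('a)"
  have c: "c > 0" unfolding c_def by (rule gauss_const_pos)
  define e where "e = e0 / c"
  have e: "e > 0" using \<open>e0 > 0\<close> c by (simp add: e_def)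
  have contF: "continuous_on UNIV F"
    unfolding F_def by (intro continuous_intros continuous_\<phi>)
  have F0: "F y \<ge> 0" for y by (simp add: F_def)
  obtain d0 where d0: "d0 > 0" "\<And>d x. 0 < d \<Longrightarrow> d \<le> d0 \<Longrightarrow> x \<in> cball 0 R \<Longrightarrow>
     c * (F x - e) \<le> gconv F l u d x"
    using gconv_lower_bound[OF contF F0 box e] unfolding c_def by blast
  \<comment> \<open>\<open>d \<le> d0\<close> is used in the comparison at time 0,
    \<open>d \<le> t\<close> in passing from \<open>gauss (t + d)\<close> to
    \<open>wide_gauss t\<close>.\<close>
  define d where "d = min d0 t"
  have d: "0 < d" "d \<le> d0" "d \<le> t" using d0 t by (auto simp: d_def)
  note cF = continuous_on_subset[OF contF, of "cbox l u", simplified]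
  have "\<forall>k. \<exists>D D2. \<forall>x\<in>ball 0 R. (\<phi> k has_derivative D x) (at x) \<and>
           (\<forall>h. ((\<lambda>y. D y h) has_derivative D2 x h) (at x)) \<and>
           - (\<Sum>b\<in>Basis. D2 x b b) = lam k * \<phi> k x"
    using eigenbasis unfolding dirichlet_eigenbasis_def dirichlet_eigenpair_def by meson
  then obtain D D2 where DD: "\<forall>k. \<forall>x\<in>ball 0 R. (\<phi> k has_derivative D k x) (at x) \<and>
           (\<forall>h. ((\<lambda>y. D k y h) has_derivative D2 k x h) (at x)) \<and>
           - (\<Sum>b\<in>Basis. D2 k x b b) = lam k * \<phi> k x"
    unfolding choice_iff by blast
  then have D: "\<And>k x. x \<in> ball 0 R \<Longrightarrow> (\<phi> k has_derivative D k x) (at x)"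
    and D2: "\<And>k x h. x \<in> ball 0 R \<Longrightarrow> ((\<lambda>y. D k y h) has_derivative D2 k x h) (at x)"
    and lap: "\<And>k x. x \<in> ball 0 R \<Longrightarrow> - (\<Sum>b\<in>Basis. D2 k x b b) = lam k * \<phi> k x"
    by blast+
  define w where "w = (\<lambda>t x. c * (\<Sum>k<N. a k * exp (- lam k * t) * \<phi> k x))"
  define v where "v = (\<lambda>t x. w t x - (gconv F l u (t + d) x + c * e))"
  have "v t x \<le> 0"
  proof (rule parabolic_maximum_principle[of t R v])
    show "continuous_on ({0..t} \<times> cball 0 R) (\<lambda>(t, x). v t x)"
    proof -
      have "continuous_on ({0..t} \<times> cball 0 R) (\<lambda>p. gconv F l u (fst p + d) (snd p))"
        by (rule continuous_on_compose2[OF continuous_on_gconv[OF cF], of _ "\<lambda>p. (fst p + d, snd p)", simplified])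
          (use d in \<open>auto intro!: continuous_intros simp: add_nonneg_pos\<close>)
      moreover have "continuous_on ({0..t} \<times> cball 0 R) (\<lambda>p. \<phi> k (snd p))" for k
        by (rule continuous_on_compose2[OF continuous_\<phi>[of UNIV]]) (auto intro!: continuous_intros)
      ultimately show ?thesis
        unfolding v_def w_def case_prod_unfold by (intro continuous_intros)
    qed
    let ?wt = "\<lambda>t x. c * (\<Sum>k<N. a k * (- lam k * exp (- lam k * t)) * \<phi> k x)"
    let ?gt = "\<lambda>t x. integral (cbox l u) (\<lambda>y. ((norm (x - y))\<^sup>2 / (4 * t\<^sup>2) - real DIM('a) / (2 * t)) * gauss t (x - y) * F y)"
    show "((\<lambda>s. v s y) has_real_derivative ?wt s y - ?gt (s + d) y) (at s)"
      if "0 < s" "s \<le> t" "y \<in> ball 0 R" for s y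
    proof -
      have "s + d > 0" using that d by simp
      from DERIV_shift[THEN iffD1, OF gconv_derivative_time[OF cF this, of y]]
      have 1: "((\<lambda>s. gconv F l u (s + d) y) has_real_derivative ?gt (s + d) y) (at s)" .
      have 2: "((\<lambda>s. w s y) has_real_derivative ?wt s y) (at s)"
        unfolding w_def by (auto intro!: derivative_eq_intros sum.cong simp: mult_ac)
      show ?thesis unfolding v_def
        by (rule derivative_eq_intros 1 2 | simp)+
    qed
    let ?wx = "\<lambda>t b x. c * (\<Sum>k<N. a k * exp (- lam k * t) * D k x b)"
    let ?gx = "\<lambda>t b x. integral (cbox l u) (\<lambda>y. - (((x - y) \<bullet> b) / (2 * t)) * gauss t (x - y) * F y)"
    show "((\<lambda>h. v s (y + h *\<^sub>R b)) has_real_derivative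
        (\<lambda>s b y. ?wx s b y - ?gx (s + d) b y) s b (y + h *\<^sub>R b)) (at h)"
      if "0 < s" "s \<le> t" "b \<in> Basis" "y + h *\<^sub>R b \<in> ball 0 R" for s y b h
    proof -
      have "s + d > 0" using that d by simp
      from gconv_derivative_space[OF cF this that(3), of y h]
      have 1: "((\<lambda>h. gconv F l u (s + d) (y + h *\<^sub>R b)) has_real_derivative ?gx (s + d) b (y + h *\<^sub>R b)) (at h)" .
      have 2: "((\<lambda>h. w s (y + h *\<^sub>R b)) has_real_derivative ?wx s b (y + h *\<^sub>R b)) (at h)"
        unfolding w_def by (intro DERIV_cmult DERIV_sum has_real_derivative_along_line D that)
      show ?thesis unfolding v_def
        by (rule derivative_eq_intros 1 2 | simp)+
    qed
    let ?wxx = "\<lambda>t b x. c * (\<Sum>k<N. a k * exp (- lam k * t) * D2 k x b b)"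
    let ?gxx = "\<lambda>t b x. integral (cbox l u) (\<lambda>y. ((((x - y) \<bullet> b)\<^sup>2 / (4 * t\<^sup>2)) - 1 / (2 * t)) * gauss t (x - y) * F y)"
    show "((\<lambda>h. (\<lambda>s b y. ?wx s b y - ?gx (s + d) b y) s b (y + h *\<^sub>R b)) has_real_derivative
        (\<lambda>s b y. ?wxx s b y - ?gxx (s + d) b y) s b y) (at 0)"
      if "0 < s" "s \<le> t" "b \<in> Basis" "y \<in> ball 0 R" for s y b
    proof -
      have "s + d > 0" using that d by simp
      from gconv_derivative2_space[OF cF this that(3), of y 0]
      have 1: "((\<lambda>h. ?gx (s + d) b (y + h *\<^sub>R b)) has_real_derivative ?gxx (s + d) b y) (at 0)"
        by simp
      have 2: "((\<lambda>h. ?wx s b (y + h *\<^sub>R b)) has_real_derivative ?wxx s b y) (at 0)"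
        by (intro DERIV_cmult DERIV_sum has_real_derivative_along_line) (use D2 that in auto)
      show ?thesis
        by (rule derivative_eq_intros 1 2 | simp)+
    qed
    show "?wt s y - ?gt (s + d) y \<le> (\<Sum>b\<in>Basis. (\<lambda>s b y. ?wxx s b y - ?gxx (s + d) b y) s b y)"
      if "0 < s" "s \<le> t" "y \<in> ball 0 R" for s y
    proof -
      have sd: "s + d > 0" using that d by simp
      have "(\<Sum>b\<in>Basis. ?wxx s b y) = c * (\<Sum>k<N. a k * exp (- lam k * s) * (\<Sum>b\<in>Basis. D2 k y b b))"
        unfolding sum_distrib_left[symmetric] by (subst sum.swap) (simp add: sum_distrib_left)
      also have "\<dots> = ?wt s y"
      proof -
        have "(\<Sum>b\<in>Basis. D2 k y b b) = - lam k * \<phi> k y" for k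
          using lap[OF that(3), of k] by simp
        then show ?thesis by (simp add: mult.assoc mult.left_commute)
      qed
      finally show ?thesis
        using gconv_heat_equation[OF cF sd, of y] by (simp add: sum_subtractf)
    qed
    show "v 0 y \<le> 0" if "y \<in> cball 0 R" for y
    proof -
      have "w 0 y \<le> c * F y" unfolding w_def F_def using c by (intro mult_left_mono) auto
      then show ?thesis using d0(2)[OF d(1,2) that] unfolding v_def by (simp add: algebra_simps)
    qed
    show "v s y \<le> 0" if "0 \<le> s" "s \<le> t" "norm y = R" for s y
    proof -
      have "w s y = 0" unfolding w_def using zero_outside that by simp
      moreover have "gconv F l u (s + d) y \<ge> 0"
        by (rule gconv_nonneg) (use that d F0 cF in auto)
      ultimately show ?thesis
        using mult_pos_pos[OF c e] unfolding v_def by linarith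
    qed
  qed (use t x in auto)
  moreover have "gconv F l u (t + d) x \<le> integral (cbox l u) (\<lambda>y. wide_gauss t (x - y) * F y)"
    unfolding gconv_def
  proof (rule Henstock_Kurzweil_Integration.integral_le)
    show "(\<lambda>y. gauss (t + d) (x - y) * F y) integrable_on cbox l u"
      "(\<lambda>y. wide_gauss t (x - y) * F y) integrable_on cbox l u"
      using t d cF by (auto intro!: integrable_continuous continuous_intros)
    show "gauss (t + d) (x - y) * F y \<le> wide_gauss t (x - y) * F y" for y
      using d F0 by (intro mult_right_mono gauss_shift_le_wide_gauss) auto
  qed
  moreover have "c * e = e0" using c by (simp add: e_def)
  ultimately show "gauss_const TYPE('a) * (\<Sum>k<N. a k * exp (- lam k * t) * \<phi> k x)
    \<le> integral (cbox l u) (\<lambda>y. wide_gauss t (x - y) * F y) + e0"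
    unfolding v_def w_def c_def by simp
qed

end


section \<open>The Dirichlet heat kernel\<close>

text \<open>The squared factor bounds the heat evolution at time \<open>t / 2\<close> from L1 to the
  sup norm. The resulting order \<open>t powr (- n)\<close> is worse than the true
  \<open>t powr (- n / 2)\<close> for small \<open>t\<close>, but the bound serves only to make the
  series converge.\<close>

definition diag_bound :: "'a::euclidean_space itself \<Rightarrow> real \<Rightarrow> real \<Rightarrow> real" where
  "diag_bound T R t = ((t / 2) powr (- real DIM('a) / 2) / gauss_const T)\<^sup>2 * measure lborel (ball (0::'a) R)"

lemma diag_bound_nonneg: "diag_bound T R t \<ge> 0"
  by (simp add: diag_bound_def)

context dirichlet_basis
begin

abbreviation MB :: "'a measure" where
  "MB \<equiv> restrict_space lborel (ball 0 R)"

lemma space_MB: "space MB = ball 0 R"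
  by (simp add: space_restrict_space)

lemma measurable_\<phi> [measurable]: "\<phi> k \<in> borel_measurable borel"
  by (rule borel_measurable_continuous_onI[OF continuous_\<phi>])

lemma finite_measure_MB: "finite_measure MB"
  by (rule finite_measureI)
    (use emeasure_lborel_ball_finite[of "0::'a" R] in \<open>simp add: space_MB emeasure_restrict_space\<close>)

lemma integral_MB: "(\<integral>x. f x \<partial>MB) = set_lebesgue_integral lborel (ball 0 R) f"
  for f :: "'a \<Rightarrow> real"
  by (subst integral_restrict_space) (auto simp: set_lebesgue_integral_def)

lemma set_integral_lebesgue_MB:
  fixes f :: "'a \<Rightarrow> real"
  assumes [measurable]: "(\<lambda>x. indicator (ball 0 R) x *\<^sub>R f x) \<in> borel_measurable borel"
  shows "set_lebesgue_integral lebesgue (ball 0 R) f = (\<integral>x. f x \<partial>MB)"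
  unfolding integral_MB set_lebesgue_integral_def by (rule integral_completion) (use assms in simp)

lemma bounded_measurable_MB_continuous:
  assumes "continuous_on UNIV f"
  shows "bounded_measurable MB f"
proof -
  have "bounded (f ` cball 0 R)"
    by (intro compact_imp_bounded compact_continuous_image continuous_on_subset[OF assms]) auto
  then obtain B where "\<forall>x\<in>cball 0 R. \<bar>f x\<bar> \<le> B"
    unfolding bounded_iff real_norm_def by blast
  then have "\<forall>x\<in>space MB. \<bar>f x\<bar> \<le> B" by (simp add: space_MB)
  moreover have "f \<in> borel_measurable MB"
    using borel_measurable_continuous_onI[OF assms] by (intro measurable_restrict_space1) simp
  ultimately show ?thesis unfolding bounded_measurable_def by blast
qed

text \<open>Completeness is given for Lebesgue measurable functions. A Borel function on the ball is
  one of them, with the same integrals, so the property passes to the Borel measure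
  \<open>MB\<close>.\<close>

sublocale MB: complete_orthonormal MB \<phi>
proof -
  interpret finite_measure MB by (rule finite_measure_MB)
  show "complete_orthonormal MB \<phi>"
  proof
    show "bounded_measurable MB (\<phi> k)" for k
      by (rule bounded_measurable_MB_continuous[OF continuous_\<phi>])
    show "(\<integral>x. \<phi> j x * \<phi> k x \<partial>MB) = (if j = k then 1 else 0)" for j k
    proof (subst set_integral_lebesgue_MB[symmetric])
      show "(\<lambda>x. indicator (ball 0 R) x *\<^sub>R (\<phi> j x * \<phi> k x)) \<in> borel_measurable borel"
        by (intro borel_measurable_scaleR borel_measurable_indicator borel_measurable_times measurable_\<phi>) auto
    qed (use eigenbasis in \<open>auto simp: dirichlet_eigenbasis_def\<close>)
    fix g :: "'a \<Rightarrow> real"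
    assume g: "g \<in> borel_measurable MB" and g2: "integrable MB (\<lambda>x. (g x)\<^sup>2)"
      and ortho: "\<And>k. (\<integral>x. g x * \<phi> k x \<partial>MB) = 0"
    have gm [measurable]: "(\<lambda>x. indicator (ball 0 R) x *\<^sub>R g x) \<in> borel_measurable borel"
      using g by (subst (asm) borel_measurable_restrict_space_iff) auto
    have "set_borel_measurable lebesgue (ball 0 R) g"
      unfolding set_borel_measurable_def by (rule measurable_completion) (use gm in simp)
    moreover have "set_integrable lebesgue (ball 0 R) (\<lambda>x. (g x)\<^sup>2)"
    proof -
      have "integrable lborel (\<lambda>x. indicator (ball 0 R) x *\<^sub>R (g x)\<^sup>2)"
        using g2 by (subst (asm) integrable_restrict_space) auto
      then show ?thesis unfolding set_integrable_def
        by (subst integrable_completion) auto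
    qed
    moreover have "set_lebesgue_integral lebesgue (ball 0 R) (\<lambda>x. g x * \<phi> k x) = 0" for k
    proof (subst set_integral_lebesgue_MB)
      have "(\<lambda>x. (indicator (ball 0 R) x *\<^sub>R g x) * \<phi> k x) \<in> borel_measurable borel"
        by measurable
      then show "(\<lambda>x. indicator (ball 0 R) x *\<^sub>R (g x * \<phi> k x)) \<in> borel_measurable borel"
        by (simp add: mult.assoc)
    qed (rule ortho)
    ultimately have "AE x in lebesgue. x \<in> ball 0 R \<longrightarrow> g x = 0"
      using eigenbasis unfolding dirichlet_eigenbasis_def by blast
    then have "AE x in lborel. x \<in> ball 0 R \<longrightarrow> g x = 0"
      by (subst (asm) AE_completion_iff) (use gm in auto)
    then show "AE x in MB. g x = 0"
      by (subst AE_restrict_space_iff) auto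
  qed
qed

lemma measure_MB: "measure MB (space MB) = measure lborel (ball (0::'a) R)"
  unfolding space_MB by (rule measure_restrict_space) auto

text \<open>The one-sided bound is applied to \<open>a\<close> and to \<open>- a\<close>, which
  share the same right side. The box drops out because the eigenfunctions vanish outside the
  ball.\<close>

lemma finite_heat_solution_abs_le:
  assumes t: "t > 0" and x: "x \<in> cball 0 R"
  shows "gauss_const TYPE('a) * \<bar>\<Sum>k<N. a k * exp (- lam k * t) * \<phi> k x\<bar>
    \<le> (\<integral>y. wide_gauss t (x - y) * \<bar>\<Sum>k<N. a k * \<phi> k y\<bar> \<partial>MB)"
proof -
  let ?h = "\<lambda>y. wide_gauss t (x - y) * \<bar>\<Sum>k<N. a k * \<phi> k y\<bar>"
  obtain u where u: "ball 0 (R + 1) \<subseteq> cbox (- u) (u::'a)"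
    using bounded_subset_cbox_symmetric[OF bounded_ball] by blast
  have sub: "ball 0 R \<subseteq> cbox (- u) u" using u by (auto simp: subset_iff)
  have ch: "continuous_on S ?h" for S
    using t by (intro continuous_intros continuous_\<phi>) auto
  have int: "set_integrable lborel (cbox (- u) u) ?h"
    unfolding set_integrable_def by (rule borel_integrable_compact[OF compact_cbox ch])
  have "integral (cbox (- u) u) ?h = set_lebesgue_integral lborel (cbox (- u) u) ?h"
    by (rule set_borel_integral_eq_integral(2)[symmetric, OF int])
  also have "\<dots> = (\<integral>y. ?h y \<partial>MB)"
    unfolding integral_MB set_lebesgue_integral_def
  proof (intro Bochner_Integration.integral_cong refl)
    fix y :: 'a
    have "?h y = 0" if "y \<notin> ball 0 R" using that zero_outside by simp
    then show "indicator (cbox (- u) u) y *\<^sub>R ?h y = indicator (ball 0 R) y *\<^sub>R ?h y"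
      using sub by (cases "y \<in> ball 0 R") (auto simp: indicator_def split: if_splits)
  qed
  finally have eq: "integral (cbox (- u) u) ?h = (\<integral>y. ?h y \<partial>MB)" .
  have "gauss_const TYPE('a) * (\<Sum>k<N. a k * exp (- lam k * t) * \<phi> k x) \<le> (\<integral>y. ?h y \<partial>MB)"
    using finite_heat_solution_le[OF t x u, of a N] by (simp only: eq)
  moreover have "gauss_const TYPE('a) * (\<Sum>k<N. - a k * exp (- lam k * t) * \<phi> k x) \<le> (\<integral>y. ?h y \<partial>MB)"
    using finite_heat_solution_le[OF t x u, of "\<lambda>k. - a k" N] eq by (simp add: sum_negf)
  ultimately show ?thesis
    using gauss_const_pos[where 'a='a] by (auto simp: abs_if sum_negf)
qed

lemma wide_gauss_le: "t > 0 \<Longrightarrow> wide_gauss t (z::'a) \<le> t powr (- real DIM('a) / 2)"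
  unfolding wide_gauss_def by (intro mult_left_le) auto

lemma bounded_measurable_wide_gauss:
  assumes "t > 0" shows "bounded_measurable MB (\<lambda>y. wide_gauss t (x - y))"
  using assms by (intro bounded_measurable_MB_continuous continuous_intros) auto

section \<open>Convergence of the eigenfunction series\<close>

text \<open>With these coefficients \<open>W\<close> occurs twice: as the value at \<open>x\<close>
  of the heat evolution at time \<open>t / 2\<close>, and, by orthonormality, as the squared L2 norm
  of the initial data. An inequality bounding the first by the second therefore bounds
  \<open>W\<close> itself.\<close>

lemma diagonal_bound:
  assumes t: "t > 0"
  shows "(\<Sum>k<N. exp (- lam k * t) * (\<phi> k x)\<^sup>2) \<le> diag_bound TYPE('a) R t"
proof (cases "x \<in> cball 0 R")
  case False
  then show ?thesis using zero_outside diag_bound_nonneg by simp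
next
  case x: True
  define s where "s = t / 2"
  have s: "s > 0" using t by (simp add: s_def)
  define a where "a = (\<lambda>k. exp (- lam k * s) * \<phi> k x)"
  define K where "K = s powr (- real DIM('a) / 2) / gauss_const TYPE('a)"
  have K: "K > 0" using gauss_const_pos[where 'a='a] s by (simp add: K_def)
  define W where "W = (\<Sum>k<N. (a k)\<^sup>2)"
  let ?F = "\<lambda>y. \<Sum>k<N. a k * \<phi> k y"
  have bF: "bounded_measurable MB ?F" by (intro bounded_measurable_intros MB.bmu)
  have "gauss_const TYPE('a) * W = gauss_const TYPE('a) * (\<Sum>k<N. a k * exp (- lam k * s) * \<phi> k x)"
    by (simp add: W_def a_def power2_eq_square mult_ac)
  also have "\<dots> \<le> gauss_const TYPE('a) * \<bar>\<Sum>k<N. a k * exp (- lam k * s) * \<phi> k x\<bar>"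
    using gauss_const_pos[where 'a='a] by (intro mult_left_mono) auto
  also have "\<dots> \<le> (\<integral>y. wide_gauss s (x - y) * \<bar>?F y\<bar> \<partial>MB)"
    by (rule finite_heat_solution_abs_le[OF s x])
  also have "\<dots> \<le> (\<integral>y. s powr (- real DIM('a) / 2) * \<bar>?F y\<bar> \<partial>MB)"
    by (intro integral_mono MB.bounded_measurable_integrable bounded_measurable_mult bounded_measurable_const
        bounded_measurable_wide_gauss s bounded_measurable_abs bF mult_right_mono wide_gauss_le) auto
  also have "\<dots> = s powr (- real DIM('a) / 2) * (\<integral>y. \<bar>?F y\<bar> \<partial>MB)" by simp
  finally have "W \<le> K * (\<integral>y. \<bar>?F y\<bar> \<partial>MB)"
    using gauss_const_pos[where 'a='a] by (simp add: K_def field_simps)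
  \<comment> \<open>The weight \<open>K\<close> turns the quadratic term into \<open>W / 2\<close>,
    which the left side absorbs.\<close>
  also have "\<dots> \<le> K * ((W / K + K * measure lborel (ball (0::'a) R)) / 2)"
  proof (intro mult_left_mono)
    have "(\<integral>y. (?F y)\<^sup>2 \<partial>MB) = W"
      unfolding W_def by (rule MB.integral_finite_expansion_power2) simp
    then show "(\<integral>y. \<bar>?F y\<bar> \<partial>MB) \<le> (W / K + K * measure lborel (ball (0::'a) R)) / 2"
      using MB.integral_abs_le[OF bF K] unfolding measure_MB by simp
  qed (use K in simp)
  also have "\<dots> = (W + K\<^sup>2 * measure lborel (ball (0::'a) R)) / 2" using K by (simp add: field_simps power2_eq_square)
  finally have "W \<le> K\<^sup>2 * measure lborel (ball (0::'a) R)" by simp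
  moreover have "exp (- lam k * t) = (exp (- lam k * s))\<^sup>2" for k
    unfolding power2_eq_square exp_add[symmetric] by (simp add: s_def)
  then have "W = (\<Sum>k<N. exp (- lam k * t) * (\<phi> k x)\<^sup>2)"
    unfolding W_def a_def by (simp add: power_mult_distrib)
  ultimately show ?thesis by (simp add: diag_bound_def K_def s_def)
qed

lemma diagonal_summable:
  assumes "t > 0" shows "summable (\<lambda>k. exp (- lam k * t) * (\<phi> k x)\<^sup>2)"
  by (rule summableI_nonneg_bounded[OF _ diagonal_bound[OF assms]]) simp

lemma diagonal_suminf_le:
  assumes "t > 0" shows "(\<Sum>k. exp (- lam k * t) * (\<phi> k x)\<^sup>2) \<le> diag_bound TYPE('a) R t"
  by (rule suminf_le_const[OF diagonal_summable[OF assms] diagonal_bound[OF assms]])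

text \<open>The weight \<open>\<eta>\<close> is free because the two diagonal series are controlled
  differently: at a fixed \<open>x\<close> the tail is small, at a varying \<open>y\<close> it is
  only bounded.\<close>

lemma heat_term_bound:
  assumes "\<eta> > 0"
  shows "\<bar>exp (- lam k * t) * \<phi> k x * \<phi> k y\<bar>
    \<le> (exp (- lam k * t) * (\<phi> k x)\<^sup>2) / (2 * \<eta>) + \<eta> / 2 * (exp (- lam k * t) * (\<phi> k y)\<^sup>2)"
proof -
  have "0 \<le> (\<bar>\<phi> k x\<bar> - \<eta> * \<bar>\<phi> k y\<bar>)\<^sup>2" by simp
  then have "\<bar>\<phi> k x\<bar> * \<bar>\<phi> k y\<bar> \<le> (\<phi> k x)\<^sup>2 / (2 * \<eta>) + \<eta> / 2 * (\<phi> k y)\<^sup>2"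
    using assms by (simp add: power2_diff field_simps power2_eq_square)
  then have "exp (- lam k * t) * (\<bar>\<phi> k x\<bar> * \<bar>\<phi> k y\<bar>) \<le> exp (- lam k * t) * ((\<phi> k x)\<^sup>2 / (2 * \<eta>) + \<eta> / 2 * (\<phi> k y)\<^sup>2)"
    by (intro mult_left_mono) auto
  then show ?thesis by (simp add: abs_mult algebra_simps)
qed

lemma heat_summable:
  assumes t: "t > 0" shows "summable (\<lambda>k. \<bar>exp (- lam k * t) * \<phi> k x * \<phi> k y\<bar>)"
proof (rule summable_comparison_test')
  show "summable (\<lambda>k. (exp (- lam k * t) * (\<phi> k x)\<^sup>2) / (2 * 1) + 1 / 2 * (exp (- lam k * t) * (\<phi> k y)\<^sup>2))"
    by (intro summable_add summable_divide summable_mult diagonal_summable t)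
  show "norm \<bar>exp (- lam k * t) * \<phi> k x * \<phi> k y\<bar>
      \<le> (exp (- lam k * t) * (\<phi> k x)\<^sup>2) / (2 * 1) + 1 / 2 * (exp (- lam k * t) * (\<phi> k y)\<^sup>2)"
    if "0 \<le> k" for k using heat_term_bound[of 1 k t x y] by simp
qed

text \<open>The tail of the diagonal series need not be small uniformly in \<open>y\<close>, but it
  never exceeds \<open>D\<close>. The weight \<open>\<eta> = e / D\<close> makes the
  \<open>y\<close> part at most \<open>e / 2\<close>; the \<open>x\<close> part is divided by
  \<open>2 * \<eta>\<close> and still tends to 0, as \<open>x\<close> is fixed.\<close>

lemma heat_kernel_uniform_limit:
  assumes t: "t > 0"
  shows "uniform_limit UNIV (\<lambda>N y. \<Sum>k<N. exp (- lam k * t) * \<phi> k x * \<phi> k y) (heat_kernel lam \<phi> t x) sequentially"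
proof (rule uniform_limitI)
  fix e :: real assume e: "e > 0"
  define D where "D = diag_bound TYPE('a) R t + 1"
  have D: "D > 0" using diag_bound_nonneg[of "TYPE('a)" R t] by (simp add: D_def)
  define \<eta> where "\<eta> = e / D"
  have \<eta>: "\<eta> > 0" using e D by (simp add: \<eta>_def)
  let ?d = "\<lambda>x k. exp (- lam k * t) * (\<phi> k x)\<^sup>2"
  have "(\<lambda>N. \<Sum>k. ?d x (k + N)) \<longlonglongrightarrow> 0"
    by (rule suminf_exist_split2[OF diagonal_summable[OF t]])
  then have "\<forall>\<^sub>F N in sequentially. (\<Sum>k. ?d x (k + N)) < \<eta> * e"
    by (rule order_tendstoD) (use \<eta> e in simp)
  then show "\<forall>\<^sub>F N in sequentially. \<forall>y\<in>UNIV. dist (\<Sum>k<N. exp (- lam k * t) * \<phi> k x * \<phi> k y) (heat_kernel lam \<phi> t x y) < e"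
  proof (rule eventually_mono, intro ballI)
    fix N y assume N: "(\<Sum>k. ?d x (k + N)) < \<eta> * e"
    let ?T = "\<lambda>k. exp (- lam k * t) * \<phi> k x * \<phi> k y"
    have sT: "summable (\<lambda>k. \<bar>?T (k + N)\<bar>)"
      using summable_ignore_initial_segment[OF heat_summable[OF t, of x y], of N] by simp
    have s1: "summable (\<lambda>k. ?d z (k + N))" for z
      by (rule summable_ignore_initial_segment[OF diagonal_summable[OF t]])
    have "heat_kernel lam \<phi> t x y = (\<Sum>k. ?T (k + N)) + (\<Sum>k<N. ?T k)"
      unfolding heat_kernel_def
      by (rule suminf_split_initial_segment[OF summable_rabs_cancel[OF heat_summable[OF t]]])
    then have "dist (\<Sum>k<N. ?T k) (heat_kernel lam \<phi> t x y) = \<bar>\<Sum>k. ?T (k + N)\<bar>"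
      by (simp add: dist_real_def)
    also have "\<dots> \<le> (\<Sum>k. \<bar>?T (k + N)\<bar>)" by (rule summable_rabs[OF sT])
    also have "\<dots> \<le> (\<Sum>k. ?d x (k + N) / (2 * \<eta>) + \<eta> / 2 * ?d y (k + N))"
      by (intro suminf_le sT summable_add summable_divide summable_mult s1 heat_term_bound \<eta>)
    also have "\<dots> = (\<Sum>k. ?d x (k + N)) / (2 * \<eta>) + \<eta> / 2 * (\<Sum>k. ?d y (k + N))"
      by (subst suminf_add[symmetric], intro summable_divide s1, intro summable_mult s1)
        (simp only: suminf_divide[OF s1] suminf_mult[OF s1])
    also have "\<dots> < e / 2 + e / 2"
    proof (intro add_less_le_mono)
      show "(\<Sum>k. ?d x (k + N)) / (2 * \<eta>) < e / 2" using N \<eta> by (simp add: field_simps)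
      have "(\<Sum>k. ?d y k) = (\<Sum>k. ?d y (k + N)) + (\<Sum>k<N. ?d y k)"
        by (rule suminf_split_initial_segment[OF diagonal_summable[OF t]])
      moreover have "(\<Sum>k<N. ?d y k) \<ge> 0" by (intro sum_nonneg) auto
      ultimately have "(\<Sum>k. ?d y (k + N)) \<le> D"
        using diagonal_suminf_le[OF t, of y] by (simp add: D_def)
      then have "\<eta> / 2 * (\<Sum>k. ?d y (k + N)) \<le> \<eta> / 2 * D" using \<eta> by (intro mult_left_mono) auto
      also have "\<dots> = e / 2" using D by (simp add: \<eta>_def)
      finally show "\<eta> / 2 * (\<Sum>k. ?d y (k + N)) \<le> e / 2" .
    qed
    finally show "dist (\<Sum>k<N. ?T k) (heat_kernel lam \<phi> t x y) < e" by simp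
  qed
qed

lemma heat_kernel_continuous:
  assumes "t > 0" shows "continuous_on UNIV (heat_kernel lam \<phi> t x)"
  by (rule uniform_limit_theorem[OF _ heat_kernel_uniform_limit[OF assms]])
    (auto intro!: always_eventually continuous_intros continuous_\<phi>)

lemma heat_kernel_sym: "heat_kernel lam \<phi> t x y = heat_kernel lam \<phi> t y x"
  by (simp add: heat_kernel_def mult_ac)

lemma heat_kernel_outside: "x \<notin> ball 0 R \<or> y \<notin> ball 0 R \<Longrightarrow> heat_kernel lam \<phi> t x y = 0"
  using zero_outside by (auto simp: heat_kernel_def)

section \<open>The Gaussian upper bound\<close>

text \<open>Bounded data are replaced by a truncated expansion. On the Gaussian side this costs the
  L1 error times \<open>K\<close>, the maximum of \<open>wide_gauss t\<close>; on the kernel side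
  the truncated kernel is uniformly close to the heat kernel.\<close>

lemma heat_semigroup_bound:
  assumes t: "t > 0" and x: "x \<in> cball 0 R" and f: "bounded_measurable MB f"
  shows "gauss_const TYPE('a) * \<bar>\<integral>y. f y * heat_kernel lam \<phi> t x y \<partial>MB\<bar> \<le> (\<integral>y. wide_gauss t (x - y) * \<bar>f y\<bar> \<partial>MB)"
proof (rule field_le_epsilon)
  fix e :: real assume e: "e > 0"
  define c where "c = (\<lambda>k. \<integral>y. f y * \<phi> k y \<partial>MB)"
  define K where "K = t powr (- real DIM('a) / 2)"
  have K: "K > 0" using t by (simp add: K_def)
  have gc0: "gauss_const TYPE('a) > 0" by (rule gauss_const_pos)
  define L where "L = (\<integral>y. \<bar>f y\<bar> \<partial>MB)"
  have L: "L \<ge> 0" by (simp add: L_def)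
  \<comment> \<open>This makes the kernel error \<open>gauss_const * (d * L)\<close> at most
    \<open>e / 2\<close>; \<open>L + 1\<close> avoids a division by zero.\<close>
  define d where "d = e / (2 * gauss_const TYPE('a) * (L + 1))"
  have d: "d > 0" using e gc0 L by (simp add: d_def)
  let ?T = "\<lambda>N y. \<Sum>k<N. exp (- lam k * t) * \<phi> k x * \<phi> k y"
  from uniform_limitD[OF heat_kernel_uniform_limit[OF t] d] obtain N0 where
    N0: "\<And>N y. N \<ge> N0 \<Longrightarrow> \<bar>?T N y - heat_kernel lam \<phi> t x y\<bar> < d"
    unfolding eventually_sequentially dist_real_def by blast
  have e2: "e / (2 * K) > 0" using e K by simp
  \<comment> \<open>A single \<open>N\<close> must truncate both the kernel and \<open>f\<close>,
    because integrating \<open>f\<close> against the \<open>N\<close>-th truncated kernel yields the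
    heat evolution of the \<open>N\<close>-th partial expansion. This is why
    \<open>L1_approximation\<close> accepts a lower bound for \<open>N\<close>.\<close>
  obtain N where N: "N \<ge> N0" "(\<integral>y. \<bar>f y - (\<Sum>k<N. c k * \<phi> k y)\<bar> \<partial>MB) < e / (2 * K)"
    using MB.L1_approximation[OF f e2] unfolding c_def by blast
  let ?S = "\<lambda>y. \<Sum>k<N. c k * \<phi> k y"
  have bH: "bounded_measurable MB (heat_kernel lam \<phi> t x)"
    by (rule bounded_measurable_MB_continuous[OF heat_kernel_continuous[OF t]])
  have bT: "bounded_measurable MB (?T N)" by (intro bounded_measurable_intros MB.bmu)
  have bS: "bounded_measurable MB ?S" by (intro bounded_measurable_intros MB.bmu)
  note bw = bounded_measurable_wide_gauss[OF t, of x]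
  note bi = MB.bounded_measurable_integrable
  have "(\<integral>y. f y * ?T N y \<partial>MB) = (\<Sum>k<N. exp (- lam k * t) * \<phi> k x * c k)"
    unfolding c_def by (rule MB.integral_mult_finite_expansion[OF f]) simp
  also have "\<dots> = (\<Sum>k<N. c k * exp (- lam k * t) * \<phi> k x)" by (simp add: mult_ac)
  finally have T: "(\<integral>y. f y * ?T N y \<partial>MB) = (\<Sum>k<N. c k * exp (- lam k * t) * \<phi> k x)" .
  have "\<bar>(\<integral>y. f y * heat_kernel lam \<phi> t x y \<partial>MB) - (\<integral>y. f y * ?T N y \<partial>MB)\<bar>
      = \<bar>\<integral>y. f y * heat_kernel lam \<phi> t x y - f y * ?T N y \<partial>MB\<bar>"
    by (subst Bochner_Integration.integral_diff) (intro bi bounded_measurable_mult f bH bT refl)+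
  also have "\<dots> \<le> (\<integral>y. \<bar>f y * heat_kernel lam \<phi> t x y - f y * ?T N y\<bar> \<partial>MB)"
    by (rule integral_abs_bound)
  also have "\<dots> \<le> (\<integral>y. d * \<bar>f y\<bar> \<partial>MB)"
  proof (rule integral_mono)
    fix y
    show "\<bar>f y * heat_kernel lam \<phi> t x y - f y * ?T N y\<bar> \<le> d * \<bar>f y\<bar>"
      using N0[OF N(1), of y] unfolding right_diff_distrib[symmetric] abs_mult
      by (subst mult.commute, intro mult_right_mono) auto
  qed (intro bi bounded_measurable_abs bounded_measurable_diff bounded_measurable_mult bounded_measurable_const f bH bT)+
  also have "\<dots> = d * L" by (simp add: L_def)
  finally have A: "\<bar>\<integral>y. f y * heat_kernel lam \<phi> t x y \<partial>MB\<bar> \<le> \<bar>\<Sum>k<N. c k * exp (- lam k * t) * \<phi> k x\<bar> + d * L"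
    unfolding T by linarith
  have dL: "gauss_const TYPE('a) * (d * L) \<le> e / 2"
  proof -
    have "gauss_const TYPE('a) * d = (e / 2) / (L + 1)" using gc0 by (simp add: d_def)
    then have "gauss_const TYPE('a) * (d * L) = (e / 2) * (L / (L + 1))" by (simp add: mult.assoc[symmetric])
    also have "\<dots> \<le> (e / 2) * 1" using e L by (intro mult_left_mono) auto
    finally show ?thesis by simp
  qed
  have "gauss_const TYPE('a) * \<bar>\<Sum>k<N. c k * exp (- lam k * t) * \<phi> k x\<bar> \<le> (\<integral>y. wide_gauss t (x - y) * \<bar>?S y\<bar> \<partial>MB)"
    by (rule finite_heat_solution_abs_le[OF t x])
  also have "\<dots> \<le> (\<integral>y. wide_gauss t (x - y) * \<bar>f y\<bar> + K * \<bar>f y - ?S y\<bar> \<partial>MB)"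
  proof (rule integral_mono)
    fix y
    have "wide_gauss t (x - y) * \<bar>?S y\<bar> \<le> wide_gauss t (x - y) * (\<bar>f y\<bar> + \<bar>f y - ?S y\<bar>)"
      by (intro mult_left_mono wide_gauss_nonneg) auto
    also have "\<dots> \<le> wide_gauss t (x - y) * \<bar>f y\<bar> + K * \<bar>f y - ?S y\<bar>"
      unfolding distrib_left K_def by (intro add_left_mono mult_right_mono wide_gauss_le t) auto
    finally show "wide_gauss t (x - y) * \<bar>?S y\<bar> \<le> wide_gauss t (x - y) * \<bar>f y\<bar> + K * \<bar>f y - ?S y\<bar>" .
  qed (intro bi bounded_measurable_add bounded_measurable_abs bounded_measurable_diff bounded_measurable_mult bounded_measurable_const f bw bS)+
  also have "\<dots> = (\<integral>y. wide_gauss t (x - y) * \<bar>f y\<bar> \<partial>MB) + (\<integral>y. K * \<bar>f y - ?S y\<bar> \<partial>MB)"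
    by (intro Bochner_Integration.integral_add bi bounded_measurable_abs bounded_measurable_diff bounded_measurable_mult bounded_measurable_const f bw bS)
  also have "(\<integral>y. K * \<bar>f y - ?S y\<bar> \<partial>MB) \<le> e / 2"
    using N(2) K by (simp add: field_simps)
  finally have B: "gauss_const TYPE('a) * \<bar>\<Sum>k<N. c k * exp (- lam k * t) * \<phi> k x\<bar> \<le> (\<integral>y. wide_gauss t (x - y) * \<bar>f y\<bar> \<partial>MB) + e / 2"
    by simp
  have "gauss_const TYPE('a) * \<bar>\<integral>y. f y * heat_kernel lam \<phi> t x y \<partial>MB\<bar> \<le> gauss_const TYPE('a) * (\<bar>\<Sum>k<N. c k * exp (- lam k * t) * \<phi> k x\<bar> + d * L)"
    using A gc0 by (intro mult_left_mono) auto
  then show "gauss_const TYPE('a) * \<bar>\<integral>y. f y * heat_kernel lam \<phi> t x y \<partial>MB\<bar> \<le> (\<integral>y. wide_gauss t (x - y) * \<bar>f y\<bar> \<partial>MB) + e"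
    using B dL by (simp add: distrib_left)
qed

text \<open>No limit of shrinking balls is taken. Both sides are continuous in \<open>y\<close>, so
  a failure at one point persists with a margin on a small ball, and the indicator of that ball
  contradicts \<open>heat_semigroup_bound\<close>.\<close>

lemma heat_kernel_gaussian_bound:
  assumes t: "t > 0"
  shows "gauss_const TYPE('a) * \<bar>heat_kernel lam \<phi> t x y\<bar> \<le> wide_gauss t (x - y)"
proof (cases "x \<in> ball 0 R \<and> y \<in> ball 0 R")
  case False
  then show ?thesis using heat_kernel_outside[of x y t] wide_gauss_nonneg[of t "x - y"] by auto
next
  case True
  then have x: "x \<in> cball 0 R" and y: "y \<in> ball 0 R" by auto
  show ?thesis
  proof (rule ccontr)
    assume neg: "\<not> ?thesis"
    \<comment> \<open>The sign of the kernel at \<open>y\<close>. It replaces the absolute value, so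
      that \<open>h\<close> is linear in the kernel and can be integrated against
      \<open>f\<close>.\<close>
    define \<sigma> :: real where "\<sigma> = (if heat_kernel lam \<phi> t x y \<ge> 0 then 1 else -1)"
    define h where "h = (\<lambda>z. gauss_const TYPE('a) * (\<sigma> * heat_kernel lam \<phi> t x z) - wide_gauss t (x - z))"
    have hy: "h y > 0" using neg by (auto simp: h_def \<sigma>_def abs_if split: if_splits)
    have ch: "continuous_on UNIV h"
      unfolding h_def using t heat_kernel_continuous[OF t] by (intro continuous_intros) auto
    have "open {z. h z > h y / 2}"
      by (intro open_Collect_less continuous_on_const ch)
    moreover have "y \<in> {z. h z > h y / 2}" using hy by simp
    ultimately have "\<exists>r>0. ball y r \<subseteq> {z. h z > h y / 2} \<inter> ball 0 R"
      using y open_contains_ball[of "{z. h z > h y / 2} \<inter> ball 0 R"] by auto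
    then obtain r where r: "r > 0" and sub: "ball y r \<subseteq> {z. h z > h y / 2}" "ball y r \<subseteq> ball 0 R" by auto
    define f :: "'a \<Rightarrow> real" where "f = indicator (ball y r)"
    have f: "bounded_measurable MB f"
      unfolding bounded_measurable_def f_def
      by (intro conjI measurable_restrict_space1 borel_measurable_indicator exI[of _ 1]) auto
    have bH: "bounded_measurable MB (heat_kernel lam \<phi> t x)"
      by (rule bounded_measurable_MB_continuous[OF heat_kernel_continuous[OF t]])
    note bi = MB.bounded_measurable_integrable
    note bw = bounded_measurable_wide_gauss[OF t, of x]
    have "(\<integral>z. f z * h z \<partial>MB) = gauss_const TYPE('a) * (\<sigma> * (\<integral>z. f z * heat_kernel lam \<phi> t x z \<partial>MB)) - (\<integral>z. wide_gauss t (x - z) * \<bar>f z\<bar> \<partial>MB)"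
    proof -
      have "(\<lambda>z. f z * h z) = (\<lambda>z. gauss_const TYPE('a) * \<sigma> * (f z * heat_kernel lam \<phi> t x z) - wide_gauss t (x - z) * \<bar>f z\<bar>)"
        by (auto simp: h_def f_def algebra_simps)
      moreover have "integrable MB (\<lambda>z. f z * heat_kernel lam \<phi> t x z)" "integrable MB (\<lambda>z. wide_gauss t (x - z) * \<bar>f z\<bar>)"
        by (intro bi bounded_measurable_mult bounded_measurable_abs f bH bw)+
      ultimately show ?thesis by simp
    qed
    also have "\<dots> \<le> gauss_const TYPE('a) * \<bar>\<integral>z. f z * heat_kernel lam \<phi> t x z \<partial>MB\<bar> - (\<integral>z. wide_gauss t (x - z) * \<bar>f z\<bar> \<partial>MB)"
      using gauss_const_pos[where 'a='a] by (intro diff_right_mono mult_left_mono) (auto simp: \<sigma>_def)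
    also have "\<dots> \<le> 0" using heat_semigroup_bound[OF t x f] by simp
    finally have "(\<integral>z. f z * h z \<partial>MB) \<le> 0" .
    moreover have "(\<integral>z. f z * (h y / 2) \<partial>MB) \<le> (\<integral>z. f z * h z \<partial>MB)"
    proof (rule integral_mono)
      show "integrable MB (\<lambda>z. f z * h z)"
        unfolding h_def by (intro bi bounded_measurable_mult bounded_measurable_diff bounded_measurable_const f bH bw)
      show "integrable MB (\<lambda>z. f z * (h y / 2))"
        by (intro bi bounded_measurable_mult bounded_measurable_const f)
      show "f z * (h y / 2) \<le> f z * h z" for z
        using sub(1) by (cases "z \<in> ball y r") (auto simp: f_def)
    qed
    moreover have "(\<integral>z. f z * (h y / 2) \<partial>MB) = measure lborel (ball y r) * (h y / 2)"
    proof -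
      have "(\<integral>z. f z \<partial>MB) = measure lborel (ball y r)"
        unfolding integral_MB set_lebesgue_integral_def f_def
        using sub(2) by (simp add: indicator_inter_arith[symmetric] Int_absorb1)
      then show ?thesis by simp
    qed
    moreover have "measure lborel (ball y r) * (h y / 2) > 0"
      using r hy by (intro mult_pos_pos content_ball_pos) auto
    ultimately show False by linarith
  qed
qed

end


section \<open>Spherical means of powers of the distance\<close>

text \<open>On the shell \<open>\<rho> k / 2 \<le> d x < \<rho> k\<close> the integrand is at most
  \<open>(\<rho> k / 2) powr - \<beta>\<close>, and the shell lies in a sublevel set of known
  measure. Measure and distance are left abstract so that one estimate serves both space and the
  sphere. Points with \<open>d x = 0\<close> contribute nothing, since
  \<open>0 powr - \<beta>\<close> is 0.\<close>

lemma nn_integral_dyadic: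
  fixes d :: "'b \<Rightarrow> real" and \<rho> :: "nat \<Rightarrow> real"
  assumes d[measurable]: "d \<in> borel_measurable M" and A[measurable]: "A \<in> sets M"
    and \<beta>: "\<beta> \<ge> 0" and K: "K \<ge> 0" and \<rho>: "\<And>k. \<rho> k > 0"
    and cover: "\<And>x. x \<in> A \<Longrightarrow> d x \<noteq> 0 \<Longrightarrow> \<exists>k. \<rho> k / 2 \<le> d x \<and> d x < \<rho> k"
    and vol: "\<And>k. emeasure M {x\<in>space M. d x < \<rho> k} \<le> ennreal (K * \<rho> k powr \<gamma>)"
    and S: "(\<lambda>k. \<rho> k powr (\<gamma> - \<beta>)) sums S"
  shows "(\<integral>\<^sup>+x. ennreal (d x powr - \<beta>) * indicator A x \<partial>M) \<le> ennreal (K * 2 powr \<beta> * S)"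
proof -
  let ?B = "\<lambda>k. {x\<in>space M. d x < \<rho> k}"
  let ?w = "\<lambda>k. (\<rho> k / 2) powr - \<beta>"
  have "(\<integral>\<^sup>+x. ennreal (d x powr - \<beta>) * indicator A x \<partial>M) \<le> (\<integral>\<^sup>+x. (\<Sum>k. ennreal (?w k) * indicator (?B k) x) \<partial>M)"
  proof (rule nn_integral_mono)
    fix x assume x: "x \<in> space M"
    show "ennreal (d x powr - \<beta>) * indicator A x \<le> (\<Sum>k. ennreal (?w k) * indicator (?B k) x)"
    proof (cases "x \<in> A \<and> d x \<noteq> 0")
      case True
      then obtain k where k: "\<rho> k / 2 \<le> d x" "d x < \<rho> k" using cover by blast
      have "d x powr - \<beta> \<le> ?w k" using k \<rho>[of k] \<beta> by (intro powr_mono2') auto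
      then have le: "ennreal (d x powr - \<beta>) * indicator A x \<le> ennreal (?w k) * indicator (?B k) x"
        using True k x by (auto intro: ennreal_leI)
      have single: "f k \<le> suminf f" for f :: "nat \<Rightarrow> ennreal"
        using sum_le_suminf[of f "{k}"] by simp
      show ?thesis
        by (rule order_trans[OF le], rule single)
    qed auto
  qed
  also have "\<dots> = (\<Sum>k. \<integral>\<^sup>+x. ennreal (?w k) * indicator (?B k) x \<partial>M)"
    by (rule nn_integral_suminf) measurable
  also have "\<dots> = (\<Sum>k. ennreal (?w k) * emeasure M (?B k))"
    by (intro arg_cong[where f=suminf] ext nn_integral_cmult_indicator) measurable
  also have "\<dots> \<le> (\<Sum>k. ennreal (K * 2 powr \<beta> * \<rho> k powr (\<gamma> - \<beta>)))"
  proof (intro suminf_le summableI)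
    fix k
    have "ennreal (?w k) * emeasure M (?B k) \<le> ennreal (?w k) * ennreal (K * \<rho> k powr \<gamma>)"
      by (intro mult_left_mono vol) auto
    also have "\<dots> = ennreal (K * 2 powr \<beta> * \<rho> k powr (\<gamma> - \<beta>))"
      using K \<rho>[of k]
      by (simp add: ennreal_mult'[symmetric] powr_divide powr_minus powr_diff field_simps)
    finally show "ennreal (?w k) * emeasure M (?B k) \<le> ennreal (K * 2 powr \<beta> * \<rho> k powr (\<gamma> - \<beta>))" .
  qed
  also have "\<dots> = ennreal (K * 2 powr \<beta> * S)"
    using K by (intro suminf_ennreal_eq sums_mult S) auto
  finally show ?thesis .
qed

lemma ex_power_between:
  fixes x :: real assumes "x \<ge> 1"
  obtains k :: nat where "2 ^ k \<le> x" "x < 2 ^ Suc k"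
proof -
  define P where "P = (\<lambda>m::nat. x < 2 ^ m)"
  obtain m where m: "P m" using real_arch_pow[of 2 x] by (auto simp: P_def)
  define l where "l = (LEAST m. P m)"
  have l: "P l" unfolding l_def by (rule LeastI[of P, OF m])
  have "l \<noteq> 0"
  proof
    assume "l = 0"
    then show False using l assms by (simp add: P_def)
  qed
  then obtain k where k: "l = Suc k" by (cases l) auto
  have "\<not> P k" using not_less_Least[of k P] k by (simp add: l_def)
  then show ?thesis using that[of k] l k by (auto simp: P_def)
qed

text \<open>Radii \<open>r / 2 ^ k\<close>: the geometric series converges because
  \<open>\<beta> < \<gamma>\<close>.\<close>

lemma nn_integral_near_diagonal:
  fixes d :: "'b \<Rightarrow> real"
  assumes d[measurable]: "d \<in> borel_measurable M" and nonneg: "\<And>x. d x \<ge> 0"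
    and \<beta>: "0 \<le> \<beta>" "\<beta> < \<gamma>" and K: "K \<ge> 0" and r: "r > 0"
    and vol: "\<And>\<rho>. 0 < \<rho> \<Longrightarrow> \<rho> \<le> r \<Longrightarrow> emeasure M {x\<in>space M. d x < \<rho>} \<le> ennreal (K * \<rho> powr \<gamma>)"
  shows "(\<integral>\<^sup>+x. ennreal (d x powr - \<beta>) * indicator {x\<in>space M. d x < r} x \<partial>M)
    \<le> ennreal (K * 2 powr \<beta> * (r powr (\<gamma> - \<beta>) / (1 - 2 powr - (\<gamma> - \<beta>))))"
proof (rule nn_integral_dyadic[where \<rho>="\<lambda>k. r / 2 ^ k" and \<gamma>=\<gamma>])
  show "\<exists>k. r / 2 ^ k / 2 \<le> d x \<and> d x < r / 2 ^ k" if "x \<in> {x\<in>space M. d x < r}" "d x \<noteq> 0" for x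
  proof -
    have dx: "0 < d x" "d x < r" using that nonneg[of x] by auto
    obtain k :: nat where k: "2 ^ k \<le> r / d x" "r / d x < 2 ^ Suc k"
      using ex_power_between[of "r / d x"] dx by auto
    show ?thesis
    \<comment> \<open>The shells are half-open, so a point at distance exactly
      \<open>r / 2 ^ k\<close> belongs to the shell of the preceding index, which exists because
      \<open>d x < r\<close>.\<close>
    proof (cases "d x = r / 2 ^ k")
      case True
      have "k \<noteq> 0"
      proof
        assume "k = 0"
        then show False using True dx by simp
      qed
      then obtain j where "k = Suc j" by (cases k) auto
      then show ?thesis using True r by (intro exI[of _ j]) (simp add: field_simps)
    next
      case False
      have "d x \<le> r / 2 ^ k" using k dx by (simp add: field_simps)
      moreover have "r / 2 ^ k / 2 \<le> d x" using k dx by (simp add: field_simps)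
      ultimately show ?thesis using False by (intro exI[of _ k]) auto
    qed
  qed
  have "(2::real) powr - (\<gamma> - \<beta>) < 2 powr 0" using \<beta> by (intro powr_less_mono) auto
  then have "(\<lambda>k. r powr (\<gamma> - \<beta>) * (2 powr - (\<gamma> - \<beta>)) ^ k) sums (r powr (\<gamma> - \<beta>) * (1 / (1 - 2 powr - (\<gamma> - \<beta>))))"
    by (intro sums_mult geometric_sums) simp
  moreover have "(r / 2 ^ k) powr (\<gamma> - \<beta>) = r powr (\<gamma> - \<beta>) * (2 powr - (\<gamma> - \<beta>)) ^ k" for k
  proof -
    have "((2::real) ^ k) powr (\<gamma> - \<beta>) = (2 powr (\<gamma> - \<beta>)) ^ k"
      by (simp add: powr_realpow[symmetric] powr_powr mult.commute)
    moreover have "(r / 2 ^ k) powr (\<gamma> - \<beta>) = r powr (\<gamma> - \<beta>) / (2 ^ k) powr (\<gamma> - \<beta>)"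
      using r by (simp add: powr_divide)
    ultimately show ?thesis unfolding powr_minus power_inverse divide_inverse by simp
  qed
  ultimately show "(\<lambda>k. (r / 2 ^ k) powr (\<gamma> - \<beta>)) sums (r powr (\<gamma> - \<beta>) / (1 - 2 powr - (\<gamma> - \<beta>)))"
    by simp
  show "emeasure M {x \<in> space M. d x < r / 2 ^ k} \<le> ennreal (K * (r / 2 ^ k) powr \<gamma>)" for k
    by (rule vol) (use r in \<open>auto simp: field_simps\<close>)
qed (use \<beta> K r in auto)

text \<open>Radii \<open>2 * r * 2 ^ k\<close>, starting at \<open>2 * r\<close> so that the first
  shell begins at \<open>r\<close>; now \<open>\<gamma> < \<beta>\<close> makes the series
  converge.\<close>

lemma nn_integral_away_from_diagonal:
  fixes d :: "'b \<Rightarrow> real"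
  assumes d[measurable]: "d \<in> borel_measurable M" and nonneg: "\<And>x. d x \<ge> 0"
    and \<beta>: "0 \<le> \<beta>" "\<gamma> < \<beta>" and K: "K \<ge> 0" and r: "r > 0"
    and vol: "\<And>\<rho>. r \<le> \<rho> \<Longrightarrow> emeasure M {x\<in>space M. d x < \<rho>} \<le> ennreal (K * \<rho> powr \<gamma>)"
  shows "(\<integral>\<^sup>+x. ennreal (d x powr - \<beta>) * indicator {x\<in>space M. r \<le> d x} x \<partial>M)
    \<le> ennreal (K * 2 powr \<beta> * ((2 * r) powr (\<gamma> - \<beta>) / (1 - 2 powr (\<gamma> - \<beta>))))"
proof (rule nn_integral_dyadic[where \<rho>="\<lambda>k. 2 * r * 2 ^ k" and \<gamma>=\<gamma>])
  show "\<exists>k. 2 * r * 2 ^ k / 2 \<le> d x \<and> d x < 2 * r * 2 ^ k" if "x \<in> {x\<in>space M. r \<le> d x}" "d x \<noteq> 0" for x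
  proof -
    have dx: "r \<le> d x" using that by auto
    obtain k :: nat where k: "2 ^ k \<le> d x / r" "d x / r < 2 ^ Suc k"
      using ex_power_between[of "d x / r"] dx r by auto
    show ?thesis using k r by (intro exI[of _ k]) (simp add: field_simps)
  qed
  have "(2::real) powr (\<gamma> - \<beta>) < 2 powr 0" using \<beta> by (intro powr_less_mono) auto
  then have "(\<lambda>k. (2 * r) powr (\<gamma> - \<beta>) * (2 powr (\<gamma> - \<beta>)) ^ k) sums ((2 * r) powr (\<gamma> - \<beta>) * (1 / (1 - 2 powr (\<gamma> - \<beta>))))"
    by (intro sums_mult geometric_sums) simp
  moreover have "(2 * r * 2 ^ k) powr (\<gamma> - \<beta>) = (2 * r) powr (\<gamma> - \<beta>) * (2 powr (\<gamma> - \<beta>)) ^ k" for k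
  proof -
    have "((2::real) ^ k) powr (\<gamma> - \<beta>) = (2 powr (\<gamma> - \<beta>)) ^ k"
      by (simp add: powr_realpow[symmetric] powr_powr mult.commute)
    then show ?thesis using r by (subst powr_mult) auto
  qed
  ultimately show "(\<lambda>k. (2 * r * 2 ^ k) powr (\<gamma> - \<beta>)) sums ((2 * r) powr (\<gamma> - \<beta>) / (1 - 2 powr (\<gamma> - \<beta>)))"
    by simp
  show "emeasure M {x \<in> space M. d x < 2 * r * 2 ^ k} \<le> ennreal (K * (2 * r * 2 ^ k) powr \<gamma>)" for k
  proof (rule vol)
    have "(1::real) \<le> 2 * 2 ^ k" using one_le_power[of "2::real" k] by linarith
    then show "r \<le> 2 * r * 2 ^ k" using r by (simp add: mult.assoc mult.left_commute)
  qed
qed (use \<beta> K r in auto)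

lemma emeasure_ball_powr:
  fixes x :: "'a::euclidean_space"
  assumes "r > 0"
  shows "emeasure lborel (ball x r) = ennreal (measure lborel (ball (0::'a) 1) * r powr real DIM('a))"
proof -
  have "emeasure lborel (ball x r) = ennreal (measure lborel (ball x r))"
    using emeasure_lborel_ball_finite[of x r] by (intro emeasure_eq_ennreal_measure) auto
  then show ?thesis
    using assms by (simp add: content_ball_conv_unit_ball[of r x] powr_realpow mult.commute)
qed

lemma nn_integral_norm_near:
  fixes x :: "'a::euclidean_space"
  assumes "0 \<le> \<beta>" "\<beta> < real DIM('a)" "r > 0"
  shows "(\<integral>\<^sup>+y. ennreal (norm (x - y) powr - \<beta>) * indicator (ball x r) y \<partial>lborel)
    \<le> ennreal (measure lborel (ball (0::'a) 1) * 2 powr \<beta> * (r powr (real DIM('a) - \<beta>) / (1 - 2 powr - (real DIM('a) - \<beta>))))"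
proof -
  have *: "{y\<in>space lborel. norm (x - y) < s} = ball x s" for s by (auto simp: dist_norm)
  show ?thesis
    using nn_integral_near_diagonal[of "\<lambda>y. norm (x - y)" lborel \<beta> "real DIM('a)" "measure lborel (ball (0::'a) 1)" r]
    unfolding * using assms by (simp add: emeasure_ball_powr)
qed

lemma nn_integral_norm_far:
  assumes "0 \<le> \<beta>" "real DIM('a::euclidean_space) < \<beta>" "r > 0"
  shows "(\<integral>\<^sup>+y. ennreal (norm (y::'a) powr - \<beta>) * indicator {y. r \<le> norm y} y \<partial>lborel)
    \<le> ennreal (measure lborel (ball (0::'a) 1) * 2 powr \<beta> * ((2 * r) powr (real DIM('a) - \<beta>) / (1 - 2 powr (real DIM('a) - \<beta>))))"
proof -
  have *: "{y\<in>space lborel. norm (y::'a) < s} = ball 0 s" for s by auto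
  show ?thesis
    using nn_integral_away_from_diagonal[of "\<lambda>y::'a. norm y" lborel \<beta> "real DIM('a)" "measure lborel (ball (0::'a) 1)" r]
    unfolding * using assms by (simp add: emeasure_ball_powr)
qed

text \<open>Spherical means are taken as integrals of \<open>v (\<rho> *\<^sub>R sgn z)\<close> over the unit ball, which avoids the surface
  measure; \<open>sgn z = z / \<bar>z\<bar>\<close>, with the junk value 0 at the origin.\<close>

definition unif_ball :: "'a::euclidean_space measure" where
  "unif_ball = uniform_measure lborel (ball 0 1)"

lemma sets_unif_ball [simp, measurable_cong]: "sets unif_ball = sets borel"
  by (simp add: unif_ball_def)

lemma space_unif_ball [simp]: "space unif_ball = UNIV"
  by (simp add: unif_ball_def)

lemma emeasure_unit_ball:
  "emeasure lborel (ball (0::'a::euclidean_space) 1) \<noteq> 0" "emeasure lborel (ball (0::'a::euclidean_space) 1) < \<infinity>"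
proof -
  show "emeasure lborel (ball (0::'a::euclidean_space) 1) < \<infinity>" by (rule emeasure_lborel_ball_finite)
  show "emeasure lborel (ball (0::'a::euclidean_space) 1) \<noteq> 0"
    using content_ball_pos[of 1 "0::'a"] by (auto simp: measure_def)
qed

lemma emeasure_unif_ball: "A \<in> sets borel \<Longrightarrow> emeasure unif_ball (A::'a::euclidean_space set) =
    emeasure lborel (ball 0 1 \<inter> A) / emeasure lborel (ball (0::'a) 1)"
  by (simp add: unif_ball_def)

lemma emeasure_unif_ball_UNIV [simp]: "emeasure unif_ball (UNIV :: 'a::euclidean_space set) = 1"
  using emeasure_unit_ball[where 'a='a] by (simp add: emeasure_unif_ball ennreal_divide_self)

lemma finite_measure_unif_ball: "finite_measure unif_ball"
  by (rule finite_measureI) simp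

section \<open>Caps of the sphere and means of powers of the distance\<close>

text \<open>A point \<open>z\<close> of the cone is within \<open>2 * \<rho>\<close> of
  \<open>norm z *\<^sub>R w\<close>, since the directions of \<open>z\<close> and \<open>w\<close>
  are both close to \<open>y\<close>, and that point is within \<open>\<rho>\<close> of a multiple
  of \<open>\<rho> *\<^sub>R w\<close>. The cone over a cap is thus a thin tube around the ray of
  \<open>w\<close>. The axis is not \<open>y\<close> itself because \<open>y\<close> is any point of
  space.\<close>

lemma cone_subset:
  fixes y w :: "'a::euclidean_space"
  assumes w: "norm w = 1" "norm (w - y) < \<rho>" and \<rho>: "0 < \<rho>" "\<rho> \<le> 1"
  shows "{z \<in> ball 0 1. norm (sgn z - y) < \<rho>} \<subseteq> (\<Union>j\<le>nat \<lfloor>1 / \<rho>\<rfloor>. ball ((real j * \<rho>) *\<^sub>R w) (3 * \<rho>))"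
proof
  fix z assume "z \<in> {z \<in> ball 0 1. norm (sgn z - y) < \<rho>}"
  then have z: "norm z < 1" "norm (sgn z - y) < \<rho>" by auto
  define j where "j = nat \<lfloor>norm z / \<rho>\<rfloor>"
  have j: "real j \<le> norm z / \<rho>" "norm z / \<rho> < real j + 1" using \<rho> by (auto simp: j_def)
  have "norm z / \<rho> \<le> 1 / \<rho>" using z \<rho> by (simp add: divide_right_mono)
  then have "j \<le> nat \<lfloor>1 / \<rho>\<rfloor>" unfolding j_def by (intro nat_mono floor_mono)
  moreover have "norm ((real j * \<rho>) *\<^sub>R w - z) < 3 * \<rho>"
  proof -
    have "norm (norm z *\<^sub>R w - z) \<le> 2 * \<rho>"
    proof (cases "z = 0")
      case False
      have "norm z *\<^sub>R w - z = norm z *\<^sub>R ((w - y) - (sgn z - y))"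
        using False by (simp add: sgn_div_norm scaleR_diff_right)
      also have "norm \<dots> = norm z * norm ((w - y) - (sgn z - y))" by simp
      also have "\<dots> \<le> 1 * (2 * \<rho>)"
        using norm_triangle_ineq4[of "w - y" "sgn z - y"] w z by (intro mult_mono) auto
      finally show ?thesis by simp
    qed (use \<rho> in simp)
    moreover have "norm ((real j * \<rho>) *\<^sub>R w - norm z *\<^sub>R w) < \<rho>"
    proof -
      have "norm ((real j * \<rho>) *\<^sub>R w - norm z *\<^sub>R w) = \<bar>real j * \<rho> - norm z\<bar>"
        using w by (simp add: scaleR_diff_left[symmetric])
      also have "\<dots> < \<rho>" using j \<rho> by (simp add: field_simps abs_if)
      finally show ?thesis .
    qed
    ultimately show ?thesis
      using norm_triangle_ineq[of "(real j * \<rho>) *\<^sub>R w - norm z *\<^sub>R w" "norm z *\<^sub>R w - z"] by simp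
  qed
  ultimately show "z \<in> (\<Union>j\<le>nat \<lfloor>1 / \<rho>\<rfloor>. ball ((real j * \<rho>) *\<^sub>R w) (3 * \<rho>))"
    by (auto simp: dist_norm)
qed

text \<open>At most \<open>2 / \<rho>\<close> balls of radius \<open>3 * \<rho>\<close> cover the
  cone, so one power of \<open>\<rho>\<close> is lost against the volume of a ball: caps have
  dimension \<open>n - 1\<close>. For \<open>\<rho> > 1\<close> the total mass 1 suffices, and if no
  nonzero \<open>z\<close> qualifies, at most the origin is left.\<close>

lemma emeasure_cone_le:
  fixes y :: "'a::euclidean_space"
  assumes \<rho>: "0 < \<rho>"
  shows "emeasure unif_ball {z. norm (sgn z - y) < \<rho>} \<le> ennreal (2 * 3 ^ DIM('a) * \<rho> powr (real DIM('a) - 1))"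
proof (cases "\<rho> \<le> 1")
  case False
  have "emeasure unif_ball {z. norm (sgn z - y) < \<rho>} \<le> emeasure unif_ball (UNIV :: 'a set)"
    by (intro emeasure_mono) auto
  also have "\<dots> = ennreal 1" by simp
  also have "\<dots> \<le> ennreal (2 * 3 ^ DIM('a) * \<rho> powr (real DIM('a) - 1))"
  proof (rule ennreal_leI)
    have "1 \<le> \<rho> powr (real DIM('a) - 1)" using False by (intro ge_one_powr_ge_zero) auto
    moreover have "(1::real) \<le> 2 * 3 ^ DIM('a)" using one_le_power[of "3::real" "DIM('a)"] by linarith
    ultimately show "1 \<le> 2 * 3 ^ DIM('a) * \<rho> powr (real DIM('a) - 1)"
      using mult_mono[of 1 "2 * 3 ^ DIM('a) :: real" 1 "\<rho> powr (real DIM('a) - 1)"] by simp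
  qed
  finally show ?thesis .
next
  case True
  let ?v = "measure lborel (ball (0::'a) 1)"
  have v: "?v > 0" by (simp add: content_ball_pos)
  have ev: "emeasure lborel (ball (0::'a) 1) = ennreal ?v"
    using emeasure_ball_powr[of 1 "0::'a"] by simp
  let ?S = "{z. norm (sgn z - y) < \<rho>}"
  have Sm: "?S \<in> sets borel" by measurable
  have "emeasure lborel (ball 0 1 \<inter> ?S) \<le> ennreal (2 * 3 ^ DIM('a) * \<rho> powr (real DIM('a) - 1) * ?v)"
  proof (cases "\<exists>z. z \<in> ?S \<and> z \<noteq> 0")
    case False
    then have "ball 0 1 \<inter> ?S \<subseteq> {0}" by auto
    then have "emeasure lborel (ball 0 1 \<inter> ?S) \<le> emeasure lborel {0::'a}" by (intro emeasure_mono) auto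
    then show ?thesis by simp
  next
    case True': True
    then obtain z0 where z0: "norm (sgn z0 - y) < \<rho>" "z0 \<noteq> 0" by auto
    define w where "w = sgn z0"
    have w: "norm w = 1" "norm (w - y) < \<rho>" using z0 by (auto simp: w_def norm_sgn)
    let ?J = "nat \<lfloor>1 / \<rho>\<rfloor>"
    have "ball 0 1 \<inter> ?S = {z \<in> ball 0 1. norm (sgn z - y) < \<rho>}" by auto
    then have "emeasure lborel (ball 0 1 \<inter> ?S) \<le> emeasure lborel (\<Union>j\<le>?J. ball ((real j * \<rho>) *\<^sub>R w) (3 * \<rho>))"
      using cone_subset[OF w \<rho> True] by (intro emeasure_mono) auto
    also have "\<dots> \<le> (\<Sum>j\<le>?J. emeasure lborel (ball ((real j * \<rho>) *\<^sub>R w) (3 * \<rho>)))"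
      by (rule emeasure_subadditive_finite) auto
    also have "\<dots> = (\<Sum>j\<le>?J. ennreal (?v * (3 * \<rho>) powr real DIM('a)))"
      using \<rho> by (intro sum.cong refl emeasure_ball_powr) simp
    also have "\<dots> = ennreal ((real ?J + 1) * (?v * (3 * \<rho>) powr real DIM('a)))"
      by (subst sum_ennreal) (simp_all add: add.commute)
    also have "\<dots> \<le> ennreal ((2 / \<rho>) * (?v * (3 * \<rho>) powr real DIM('a)))"
    proof (intro ennreal_leI mult_right_mono)
      have "real ?J \<le> 1 / \<rho>" using \<rho> by (simp add: of_nat_floor)
      moreover have "1 \<le> 1 / \<rho>" using \<rho> True by simp
      ultimately show "real ?J + 1 \<le> 2 / \<rho>" by simp
    qed (use v in simp)
    also have "(2 / \<rho>) * (?v * (3 * \<rho>) powr real DIM('a)) = 2 * 3 ^ DIM('a) * \<rho> powr (real DIM('a) - 1) * ?v"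
      using \<rho> by (simp add: powr_mult powr_diff powr_realpow)
    finally show ?thesis .
  qed
  then have "emeasure lborel (ball 0 1 \<inter> ?S) / emeasure lborel (ball (0::'a) 1)
    \<le> ennreal (2 * 3 ^ DIM('a) * \<rho> powr (real DIM('a) - 1) * ?v) / ennreal ?v"
    unfolding ev by (rule divide_right_mono_ennreal)
  also have "\<dots> = ennreal (2 * 3 ^ DIM('a) * \<rho> powr (real DIM('a) - 1))"
    using v by (simp add: divide_ennreal)
  finally show ?thesis using emeasure_unif_ball[OF Sm] by simp
qed

text \<open>Where the distance is at least 1 the integrand is at most 1 and the measure has mass 1,
  hence the \<open>C + 1\<close>. The constant does not depend on \<open>y\<close>, which may lie on
  the sphere itself.\<close>

lemma spherical_mean_bound_1:
  assumes "0 \<le> \<beta>" "\<beta> < real DIM('a::euclidean_space) - 1"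
  shows "\<exists>C\<ge>0. \<forall>y::'a. (\<integral>\<^sup>+z. ennreal (norm (sgn z - y) powr - \<beta>) \<partial>unif_ball) \<le> ennreal C"
proof -
  let ?K = "2 * 3 ^ DIM('a) :: real"
  define C where "C = ?K * 2 powr \<beta> * (1 powr (real DIM('a) - 1 - \<beta>) / (1 - 2 powr - (real DIM('a) - 1 - \<beta>)))"
  have "(2::real) powr - (real DIM('a) - 1 - \<beta>) < 2 powr 0" using assms by (intro powr_less_mono) auto
  then have C: "C \<ge> 0" unfolding C_def by simp
  have "(\<integral>\<^sup>+z. ennreal (norm (sgn z - y) powr - \<beta>) \<partial>unif_ball) \<le> ennreal (C + 1)" for y :: 'a
  proof -
    let ?A = "{z::'a. norm (sgn z - y) < 1}"
    have [measurable]: "?A \<in> sets borel" by measurable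
    have "(\<integral>\<^sup>+z. ennreal (norm (sgn z - y) powr - \<beta>) \<partial>unif_ball)
      \<le> (\<integral>\<^sup>+z. ennreal (norm (sgn z - y) powr - \<beta>) * indicator ?A z + 1 \<partial>unif_ball)"
    proof (rule nn_integral_mono)
      fix z :: 'a
      have "norm (sgn z - y) powr - \<beta> \<le> 1" if "\<not> norm (sgn z - y) < 1"
        using powr_mono2'[of "- \<beta>" 1 "norm (sgn z - y)"] that assms by simp
      then show "ennreal (norm (sgn z - y) powr - \<beta>) \<le> ennreal (norm (sgn z - y) powr - \<beta>) * indicator ?A z + 1"
        by (auto simp: indicator_def ennreal_le_1)
    qed
    also have "\<dots> = (\<integral>\<^sup>+z. ennreal (norm (sgn z - y) powr - \<beta>) * indicator ?A z \<partial>unif_ball) + 1"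
      by (subst nn_integral_add) auto
    also have "(\<integral>\<^sup>+z. ennreal (norm (sgn z - y) powr - \<beta>) * indicator ?A z \<partial>unif_ball) \<le> ennreal C"
      using nn_integral_near_diagonal[of "\<lambda>z. norm (sgn z - y)" unif_ball \<beta> "real DIM('a) - 1" ?K 1]
        emeasure_cone_le[of _ y] assms by (simp add: C_def)
    also have "ennreal C + 1 = ennreal (C + 1)" using C by (simp add: ennreal_plus)
    finally show ?thesis by (simp add: add_right_mono)
  qed
  then show ?thesis using C by (intro exI[of _ "C + 1"]) auto
qed

lemma spherical_mean_bound:
  assumes "0 \<le> \<beta>" "\<beta> < real DIM('a::euclidean_space) - 1"
  shows "\<exists>C\<ge>0. \<forall>\<rho>>0. \<forall>y::'a. (\<integral>\<^sup>+z. ennreal (norm (\<rho> *\<^sub>R sgn z - y) powr - \<beta>) \<partial>unif_ball) \<le> ennreal (C * \<rho> powr - \<beta>)"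
proof -
  obtain C where C: "C \<ge> 0" "\<And>y::'a. (\<integral>\<^sup>+z. ennreal (norm (sgn z - y) powr - \<beta>) \<partial>unif_ball) \<le> ennreal C"
    using spherical_mean_bound_1[OF assms] by blast
  have "(\<integral>\<^sup>+z. ennreal (norm (\<rho> *\<^sub>R sgn z - y) powr - \<beta>) \<partial>unif_ball) \<le> ennreal (C * \<rho> powr - \<beta>)"
    if \<rho>: "\<rho> > 0" for \<rho> and y :: 'a
  proof -
    have "norm (\<rho> *\<^sub>R sgn z - y) powr - \<beta> = \<rho> powr - \<beta> * norm (sgn z - y /\<^sub>R \<rho>) powr - \<beta>" for z
    proof -
      have "\<rho> *\<^sub>R sgn z - y = \<rho> *\<^sub>R (sgn z - y /\<^sub>R \<rho>)" using \<rho> by (simp add: scaleR_diff_right)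
      then show ?thesis using \<rho> by (simp add: powr_mult)
    qed
    then have "(\<integral>\<^sup>+z. ennreal (norm (\<rho> *\<^sub>R sgn z - y) powr - \<beta>) \<partial>unif_ball)
        = ennreal (\<rho> powr - \<beta>) * (\<integral>\<^sup>+z. ennreal (norm (sgn z - y /\<^sub>R \<rho>) powr - \<beta>) \<partial>unif_ball)"
      by (simp add: ennreal_mult nn_integral_cmult)
    also have "\<dots> \<le> ennreal (\<rho> powr - \<beta>) * ennreal C" by (intro mult_left_mono C) auto
    also have "\<dots> = ennreal (C * \<rho> powr - \<beta>)" using C by (simp add: ennreal_mult mult.commute)
    finally show ?thesis .
  qed
  with C show ?thesis by blast
qed

section \<open>Decay of spherical means of Riesz potentials\<close>

text \<open>The mean over the sphere of radius \<open>\<rho>\<close> of the Riesz potential of order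
  \<open>s\<close> of \<open>F\<close>, without the usual constant.\<close>

abbreviation riesz_mean :: "real \<Rightarrow> real \<Rightarrow> ('a::euclidean_space \<Rightarrow> real) \<Rightarrow> ennreal" where
  "riesz_mean s \<rho> F \<equiv> \<integral>\<^sup>+z. \<integral>\<^sup>+y. ennreal (norm (\<rho> *\<^sub>R sgn z - y) powr (s - real DIM('a)) * F y) \<partial>lborel \<partial>unif_ball"

text \<open>The split into \<open>a\<close> and \<open>b\<close> handles only
  \<open>norm y < 2 * \<rho>\<close>, because \<open>b * q < n\<close> gives local integrability but
  none at infinity. For larger \<open>y\<close> the distance to the sphere is comparable with
  \<open>norm y\<close>, the kernel need not be split, and integrability at infinity is the
  condition \<open>s < n / p\<close>.\<close>

lemma radial_riesz_bound:
  fixes s p :: real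
  assumes p: "1 < p" and s1: "1 / p < s" and s2: "s < real DIM('a::euclidean_space) / p"
  shows "\<exists>C\<ge>0. \<forall>\<rho>>0. \<forall>F::'a \<Rightarrow> real. F \<in> borel_measurable borel \<longrightarrow> (\<forall>y. F y \<ge> 0) \<longrightarrow>
     (\<integral>\<^sup>+y. ennreal (F y powr p) \<partial>lborel) \<le> 1 \<longrightarrow>
     riesz_mean s \<rho> F
       \<le> ennreal (C * \<rho> powr (s - real DIM('a) / p))"
proof -
  let ?n = "real DIM('a)"
  define q where "q = p / (p - 1)"
  define \<sigma> where "\<sigma> = s - ?n / p"
  \<comment> \<open>\<open>a p < n - 1\<close> makes spherical means of \<open>\<bar>w - y\<bar> powr (- a p)\<close> bounded, \<open>b q < n\<close> makes
    \<open>\<bar>w - y\<bar> powr (- b q)\<close> locally integrable, and \<open>\<alpha>\<close> balances the powers of \<open>\<rho>\<close>.\<close>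
  define e where "e = min (s - 1 / p) (?n * (1 - 1 / p)) / 2"
  define a where "a = ?n / p - s + e"
  define b where "b = ?n - ?n / p - e"
  define \<alpha> where "\<alpha> = a + \<sigma> / p"
  have q: "q > 1" "1 / p + 1 / q = 1" "q * (1 - 1 / p) = 1" using p by (auto simp: q_def field_simps)
  have n: "?n \<ge> 1" by (simp add: Suc_le_eq)
  \<comment> \<open>In this order the three bounds give \<open>b * q < n\<close>,
    \<open>a * p < n - 1\<close> and \<open>b \<ge> 0\<close>.\<close>
  have e: "e > 0" "e < s - 1 / p" "e < ?n * (1 - 1 / p)"
  proof -
    have "0 < ?n * (1 - 1 / p)" using p n by simp
    moreover have "0 < s - 1 / p" using s1 by simp
    moreover have "0 < min A B / 2 \<and> min A B / 2 < A \<and> min A B / 2 < B" if "0 < A" "0 < B" for A B :: real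
      using that by (auto simp: min_def)
    ultimately show "e > 0" "e < s - 1 / p" "e < ?n * (1 - 1 / p)" unfolding e_def by blast+
  qed
  have sn: "s < ?n"
  proof -
    have "?n / p \<le> ?n" using p n by (simp add: field_simps)
    then show ?thesis using s2 by simp
  qed
  have ap: "0 \<le> a * p" "a * p < ?n - 1"
  proof -
    show "0 \<le> a * p" using s2 e p by (simp add: a_def)
    have "a < (?n - 1) / p" using e(2) by (simp add: a_def diff_divide_distrib)
    then show "a * p < ?n - 1" using p by (simp add: field_simps)
  qed
  have bq: "0 \<le> b * q" "b * q < ?n"
  proof -
    have "b \<ge> 0" using e(3) by (simp add: b_def algebra_simps)
    then show "0 \<le> b * q" using q by simp
    have "b * q < (?n * (1 - 1 / p)) * q" using e(1) q(1) by (intro mult_strict_right_mono) (auto simp: b_def algebra_simps)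
    also have "\<dots> = ?n" using q(3) by (simp add: mult.assoc mult.commute)
    finally show "b * q < ?n" .
  qed
  have nsq: "0 \<le> (?n - s) * q" "?n < (?n - s) * q"
  proof -
    show "0 \<le> (?n - s) * q" using sn q by simp
    have "?n = (?n * (1 - 1 / p)) * q" using q(3) by (simp add: mult.assoc mult.commute)
    also have "\<dots> < (?n - s) * q" using s2 q(1) by (intro mult_strict_right_mono) (auto simp: algebra_simps)
    finally show "?n < (?n - s) * q" .
  qed
  have nq: "?n = ?n * (q * (1 - 1 / p))" using q(3) by simp
  \<comment> \<open>\<open>E1\<close>, \<open>E2\<close> and \<open>E3\<close> say that the powers
    of \<open>\<rho>\<close> collected in the integrals of \<open>T1\<close>, \<open>T2\<close> and
    \<open>T4\<close> below all equal \<open>\<sigma>\<close>; \<open>T3\<close> carries that power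
    from the start.\<close>
  have E1: "\<alpha> * p - a * p = \<sigma>" using p by (simp add: \<alpha>_def field_simps)
  have E2: "- \<alpha> * q + (?n - b * q) = \<sigma>"
  proof -
    have "\<alpha> + b = ?n - s + \<sigma> / p" by (simp add: \<alpha>_def a_def b_def)
    moreover have "- \<alpha> * q + (?n - b * q) = ?n - q * (\<alpha> + b)" by (simp add: algebra_simps)
    ultimately have "- \<alpha> * q + (?n - b * q) = ?n - q * (?n - s + \<sigma> / p)" by simp
    also have "\<dots> = ?n * (q * (1 - 1 / p)) - q * (?n - s + \<sigma> / p)" using nq by simp
    also have "\<dots> = q * (\<sigma> - \<sigma> / p)" by (simp add: \<sigma>_def algebra_simps)
    also have "\<dots> = \<sigma> * (q * (1 - 1 / p))" by (simp add: algebra_simps)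
    finally show ?thesis using q(3) by simp
  qed
  have E3: "- (\<sigma> / p) * q + (?n - (?n - s) * q) = \<sigma>"
  proof -
    have "- (\<sigma> / p) * q + (?n - (?n - s) * q) = ?n * (q * (1 - 1 / p)) - q * (?n - s + \<sigma> / p)"
      using nq by (simp add: algebra_simps)
    also have "\<dots> = q * (\<sigma> - \<sigma> / p)" by (simp add: \<sigma>_def algebra_simps)
    also have "\<dots> = \<sigma> * (q * (1 - 1 / p))" by (simp add: algebra_simps)
    finally show ?thesis using q(3) by simp
  qed
  obtain C1 where C1: "C1 \<ge> 0"
    "\<And>\<rho> (y::'a). \<rho> > 0 \<Longrightarrow> (\<integral>\<^sup>+z. ennreal (norm (\<rho> *\<^sub>R sgn z - y) powr - (a * p)) \<partial>unif_ball) \<le> ennreal (C1 * \<rho> powr - (a * p))"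
    using spherical_mean_bound[OF ap] by blast
  \<comment> \<open>The 4 in \<open>C2\<close> is the radius of the near ball in units of
    \<open>\<rho>\<close>. The 4 in \<open>C4\<close> is twice the inner radius 2 of the far region,
    as the dyadic sum there starts at \<open>2 * r\<close>.\<close>
  define C2 where "C2 = measure lborel (ball (0::'a) 1) * 2 powr (b * q) * (4 powr (?n - b * q) / (1 - 2 powr - (?n - b * q)))"
  define C4 where "C4 = measure lborel (ball (0::'a) 1) * 2 powr ((?n - s) * q) * (4 powr (?n - (?n - s) * q) / (1 - 2 powr (?n - (?n - s) * q)))"
  \<comment> \<open>The cost of replacing the distance by \<open>norm y / 2\<close> in the far
    region.\<close>
  define D where "D = (2::real) powr (?n - s)"
  have D: "D \<ge> 0" by (simp add: D_def)
  have C2: "C2 \<ge> 0"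
  proof -
    have "(2::real) powr - (?n - b * q) < 2 powr 0" using bq by (intro powr_less_mono) auto
    then show ?thesis unfolding C2_def by simp
  qed
  have C4: "C4 \<ge> 0"
  proof -
    have "(2::real) powr (?n - (?n - s) * q) < 2 powr 0" using nsq by (intro powr_less_mono) auto
    then show ?thesis unfolding C4_def by simp
  qed
  define C where "C = C1 + C2 + D + D * C4"
  have C: "C \<ge> 0" using C1 C2 D C4 by (simp add: C_def)
  interpret U: finite_measure "unif_ball :: 'a measure" by (rule finite_measure_unif_ball)
  interpret pair_sigma_finite "unif_ball :: 'a measure" "lborel :: 'a measure" ..
  have young: "x * y \<le> x powr p + y powr q" if "x \<ge> 0" "y \<ge> 0" for x y :: real
  proof -
    have "x * y \<le> x powr p / p + y powr q / q" using p q that by (intro Youngs_inequality) auto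
    also have "x powr p / p \<le> x powr p" using p divide_left_mono[of 1 p "x powr p"] by simp
    also have "y powr q / q \<le> y powr q" using q divide_left_mono[of 1 q "y powr q"] by simp
    finally show ?thesis by simp
  qed
  have "riesz_mean s \<rho> F \<le> ennreal (C * \<rho> powr \<sigma>)"
    if \<rho>: "\<rho> > 0" and F[measurable]: "F \<in> borel_measurable borel" and F0: "\<And>y. F y \<ge> 0"
      and Fp: "(\<integral>\<^sup>+y. ennreal (F y powr p) \<partial>lborel) \<le> 1" for \<rho> and F :: "'a \<Rightarrow> real"
  proof -
    \<comment> \<open>Young's inequality yields \<open>T1 + T2\<close> on
      \<open>norm y < 2 * \<rho>\<close> and \<open>T3 + T4\<close> elsewhere. \<open>T1\<close>
      contains \<open>F\<close> and is integrated over the sphere first; \<open>T2\<close> is free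
      of \<open>F\<close> and is integrated over \<open>y\<close> first.\<close>
    define T1 where "T1 = (\<lambda>(z::'a) y. ennreal (\<rho> powr (\<alpha> * p) * (norm (\<rho> *\<^sub>R sgn z - y) powr - (a * p) * F y powr p)))"
    define T2 where "T2 = (\<lambda>(z::'a) y. ennreal (\<rho> powr (- \<alpha> * q)) * (ennreal (norm (\<rho> *\<^sub>R sgn z - y) powr - (b * q)) * indicator (ball (\<rho> *\<^sub>R sgn z) (4 * \<rho>)) y))"
    define T3 where "T3 = (\<lambda>y. ennreal (D * \<rho> powr \<sigma>) * ennreal (F y powr p))"
    define T4 where "T4 = (\<lambda>y::'a. ennreal (D * \<rho> powr (- (\<sigma> / p) * q)) * (ennreal (norm y powr - ((?n - s) * q)) * indicator {y. 2 * \<rho> \<le> norm y} y))"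
    have ns: "norm (\<rho> *\<^sub>R sgn z) \<le> \<rho>" for z :: 'a using \<rho> by (simp add: norm_sgn)
    have im: "(\<lambda>p. indicator (ball (\<rho> *\<^sub>R sgn (fst p)) (4 * \<rho>)) (snd p) :: ennreal) \<in> borel_measurable (borel \<Otimes>\<^sub>M (borel :: 'a measure))"
    proof -
      have "(\<lambda>p. indicator (ball (\<rho> *\<^sub>R sgn (fst p)) (4 * \<rho>)) (snd p) :: ennreal)
        = (\<lambda>p::'a\<times>'a. indicator {p. norm (\<rho> *\<^sub>R sgn (fst p) - snd p) < 4 * \<rho>} p)"
        by (auto simp: indicator_def dist_norm)
      also have "\<dots> \<in> borel_measurable (borel \<Otimes>\<^sub>M borel)"
        by measurable
      finally show ?thesis .
    qed
    have UB: "sets (unif_ball \<Otimes>\<^sub>M (lborel :: 'a measure)) = sets (borel \<Otimes>\<^sub>M (borel :: 'a measure))"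
      by (intro sets_pair_measure_cong) auto
    have T1m: "case_prod T1 \<in> borel_measurable (unif_ball \<Otimes>\<^sub>M lborel)"
      unfolding T1_def case_prod_unfold by measurable
    have T2m: "case_prod T2 \<in> borel_measurable (unif_ball \<Otimes>\<^sub>M lborel)"
      unfolding T2_def case_prod_unfold measurable_cong_sets[OF UB refl]
    proof (intro borel_measurable_times_ennreal borel_measurable_const im)
      show "(\<lambda>p. ennreal (norm (\<rho> *\<^sub>R sgn (fst p) - snd p) powr - (b * q))) \<in> borel_measurable (borel \<Otimes>\<^sub>M (borel :: 'a measure))"
        by measurable
    qed
    have T1z[measurable]: "T1 z \<in> borel_measurable borel" for z
      using measurable_Pair2[OF T1m, of z] by simp
    have T2z[measurable]: "T2 z \<in> borel_measurable borel" for z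
      using measurable_Pair2[OF T2m, of z] by simp
    have T3z[measurable]: "T3 \<in> borel_measurable borel" unfolding T3_def by simp
    have T4z[measurable]: "T4 \<in> borel_measurable borel"
    proof -
      have "{y::'a. 2 * \<rho> \<le> norm y} \<in> sets borel" by measurable
      then show ?thesis unfolding T4_def by simp
    qed
    have pw: "ennreal (norm (\<rho> *\<^sub>R sgn z - y) powr (s - ?n) * F y) \<le> (T1 z y + T2 z y) + (T3 y + T4 y)" for z y
    proof (cases "norm y < 2 * \<rho>")
      case True
      define d where "d = norm (\<rho> *\<^sub>R sgn z - y)"
      have "d < 4 * \<rho>"
        using norm_triangle_ineq4[of "\<rho> *\<^sub>R sgn z" y] ns[of z] True \<rho> unfolding d_def by linarith
      then have in_ball: "y \<in> ball (\<rho> *\<^sub>R sgn z) (4 * \<rho>)" by (simp add: dist_norm d_def)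
      have d0: "d \<ge> 0" by (simp add: d_def)
      have ab: "s - ?n = - a + - b" by (simp add: a_def b_def)
      have "d powr (s - ?n) * F y = (\<rho> powr \<alpha> * d powr - a * F y) * (\<rho> powr - \<alpha> * d powr - b)"
        unfolding ab powr_add using \<rho> by (simp add: powr_minus field_simps)
      also have "\<dots> \<le> (\<rho> powr \<alpha> * d powr - a * F y) powr p + (\<rho> powr - \<alpha> * d powr - b) powr q"
        by (rule young) (use F0 in auto)
      also have "(\<rho> powr \<alpha> * d powr - a * F y) powr p = \<rho> powr (\<alpha> * p) * (d powr - (a * p) * F y powr p)"
        using F0 by (simp add: powr_mult powr_powr)
      also have "(\<rho> powr - \<alpha> * d powr - b) powr q = \<rho> powr (- \<alpha> * q) * d powr - (b * q)"
        by (simp add: powr_mult powr_powr)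
      finally have "ennreal (d powr (s - ?n) * F y) \<le> ennreal (\<rho> powr (\<alpha> * p) * (d powr - (a * p) * F y powr p) + \<rho> powr (- \<alpha> * q) * d powr - (b * q))"
        by (rule ennreal_leI)
      also have "\<dots> = T1 z y + T2 z y"
        using in_ball unfolding T1_def T2_def d_def[symmetric]
        by (subst ennreal_plus) (auto simp: ennreal_mult)
      finally show ?thesis unfolding d_def using add_increasing2[of "T3 y + T4 y"] by simp
    next
      case False
      define d where "d = norm (\<rho> *\<^sub>R sgn z - y)"
      have "norm y / 2 \<le> d"
        using norm_triangle_ineq2[of y "\<rho> *\<^sub>R sgn z"] ns[of z] False
        unfolding d_def norm_minus_commute[of _ y] by linarith
      then have "d powr (s - ?n) \<le> (norm y / 2) powr (s - ?n)"
        using sn False \<rho> by (intro powr_mono2') auto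
      also have "\<dots> = D * norm y powr (s - ?n)"
        unfolding D_def by (simp add: powr_divide powr_diff)
      finally have "d powr (s - ?n) * F y \<le> D * norm y powr (s - ?n) * F y"
        by (intro mult_right_mono F0)
      also have "\<dots> = D * ((\<rho> powr (\<sigma> / p) * F y) * (\<rho> powr - (\<sigma> / p) * norm y powr (s - ?n)))"
        using \<rho> by (simp add: powr_minus field_simps)
      also have "\<dots> \<le> D * ((\<rho> powr (\<sigma> / p) * F y) powr p + (\<rho> powr - (\<sigma> / p) * norm y powr (s - ?n)) powr q)"
        by (intro mult_left_mono young D) (use F0 in auto)
      also have "(\<rho> powr (\<sigma> / p) * F y) powr p = \<rho> powr \<sigma> * F y powr p"
        using F0 p by (simp add: powr_mult powr_powr)
      also have "(\<rho> powr - (\<sigma> / p) * norm y powr (s - ?n)) powr q = \<rho> powr (- (\<sigma> / p) * q) * norm y powr - ((?n - s) * q)"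
        by (simp add: powr_mult powr_powr algebra_simps)
      finally have "ennreal (d powr (s - ?n) * F y) \<le> ennreal (D * \<rho> powr \<sigma> * F y powr p + D * \<rho> powr (- (\<sigma> / p) * q) * norm y powr - ((?n - s) * q))"
        by (intro ennreal_leI) (simp add: algebra_simps)
      also have "\<dots> = T3 y + T4 y"
        using False D F0 unfolding T3_def T4_def
        by (subst ennreal_plus) (auto simp: ennreal_mult mult.assoc)
      finally show ?thesis unfolding d_def using add_increasing[of "T1 z y + T2 z y"] by simp
    qed
    have I1: "(\<integral>\<^sup>+z. \<integral>\<^sup>+y. T1 z y \<partial>lborel \<partial>unif_ball) \<le> ennreal (C1 * \<rho> powr \<sigma>)"
    proof -
      have "(\<integral>\<^sup>+z. \<integral>\<^sup>+y. T1 z y \<partial>lborel \<partial>unif_ball) = (\<integral>\<^sup>+y. \<integral>\<^sup>+z. T1 z y \<partial>unif_ball \<partial>lborel)"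
        by (rule Fubini'[symmetric, OF T1m])
      also have "\<dots> \<le> (\<integral>\<^sup>+y. ennreal (C1 * \<rho> powr \<sigma>) * ennreal (F y powr p) \<partial>lborel)"
      proof (rule nn_integral_mono)
        fix y :: 'a
        have "(\<integral>\<^sup>+z. T1 z y \<partial>unif_ball) = (\<integral>\<^sup>+z. ennreal (\<rho> powr (\<alpha> * p) * F y powr p) * ennreal (norm (\<rho> *\<^sub>R sgn z - y) powr - (a * p)) \<partial>unif_ball)"
          unfolding T1_def by (intro nn_integral_cong) (simp add: ennreal_mult[symmetric] mult_ac)
        also have "\<dots> = ennreal (\<rho> powr (\<alpha> * p) * F y powr p) * (\<integral>\<^sup>+z. ennreal (norm (\<rho> *\<^sub>R sgn z - y) powr - (a * p)) \<partial>unif_ball)"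
          by (rule nn_integral_cmult) measurable
        also have "\<dots> \<le> ennreal (\<rho> powr (\<alpha> * p) * F y powr p) * ennreal (C1 * \<rho> powr - (a * p))"
          by (intro mult_left_mono C1(2) \<rho>) auto
        also have "\<dots> = ennreal (C1 * (\<rho> powr (\<alpha> * p) * \<rho> powr - (a * p))) * ennreal (F y powr p)"
          using C1(1) by (simp add: ennreal_mult[symmetric] mult_ac)
        also have "\<rho> powr (\<alpha> * p) * \<rho> powr - (a * p) = \<rho> powr \<sigma>"
          using E1 by (simp add: powr_add[symmetric])
        finally show "(\<integral>\<^sup>+z. T1 z y \<partial>unif_ball) \<le> ennreal (C1 * \<rho> powr \<sigma>) * ennreal (F y powr p)" .
      qed
      also have "\<dots> = ennreal (C1 * \<rho> powr \<sigma>) * (\<integral>\<^sup>+y. ennreal (F y powr p) \<partial>lborel)"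
        by (rule nn_integral_cmult) measurable
      also have "\<dots> \<le> ennreal (C1 * \<rho> powr \<sigma>) * 1" by (intro mult_left_mono Fp) auto
      finally show ?thesis by simp
    qed
    have I2: "(\<integral>\<^sup>+z. \<integral>\<^sup>+y. T2 z y \<partial>lborel \<partial>unif_ball) \<le> ennreal (C2 * \<rho> powr \<sigma>)"
    proof -
      have "(\<integral>\<^sup>+z. \<integral>\<^sup>+y. T2 z y \<partial>lborel \<partial>unif_ball) \<le> (\<integral>\<^sup>+(z::'a). ennreal (C2 * \<rho> powr \<sigma>) \<partial>unif_ball)"
      proof (rule nn_integral_mono)
        fix z :: 'a
        let ?w = "\<rho> *\<^sub>R sgn z"
        have "(\<integral>\<^sup>+y. T2 z y \<partial>lborel) = ennreal (\<rho> powr (- \<alpha> * q)) * (\<integral>\<^sup>+y. ennreal (norm (?w - y) powr - (b * q)) * indicator (ball ?w (4 * \<rho>)) y \<partial>lborel)"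
          unfolding T2_def
        proof (rule nn_integral_cmult, rule borel_measurable_times_ennreal)
          show "(\<lambda>y. ennreal (norm (?w - y) powr - (b * q))) \<in> borel_measurable lborel" by measurable
          show "indicator (ball ?w (4 * \<rho>)) \<in> borel_measurable lborel"
            by (rule borel_measurable_indicator) simp
        qed
        also have "\<dots> \<le> ennreal (\<rho> powr (- \<alpha> * q)) * ennreal (C2 * \<rho> powr (?n - b * q))"
          using nn_integral_norm_near[OF bq, of "4 * \<rho>" ?w] \<rho>
          by (intro mult_left_mono) (auto simp: C2_def powr_mult mult_ac)
        also have "\<dots> = ennreal (C2 * (\<rho> powr (- \<alpha> * q) * \<rho> powr (?n - b * q)))"
          using C2 by (simp add: ennreal_mult[symmetric] mult_ac)
        also have "\<rho> powr (- \<alpha> * q) * \<rho> powr (?n - b * q) = \<rho> powr \<sigma>"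
          unfolding powr_add[symmetric] E2 ..
        finally show "(\<integral>\<^sup>+y. T2 z y \<partial>lborel) \<le> ennreal (C2 * \<rho> powr \<sigma>)" .
      qed
      then show ?thesis by simp
    qed
    have I3: "(\<integral>\<^sup>+y. T3 y \<partial>lborel) \<le> ennreal (D * \<rho> powr \<sigma>)"
    proof -
      have "(\<integral>\<^sup>+y. T3 y \<partial>lborel) = ennreal (D * \<rho> powr \<sigma>) * (\<integral>\<^sup>+y. ennreal (F y powr p) \<partial>lborel)"
        unfolding T3_def by (rule nn_integral_cmult) measurable
      also have "\<dots> \<le> ennreal (D * \<rho> powr \<sigma>) * 1" by (intro mult_left_mono Fp) auto
      finally show ?thesis by simp
    qed
    have I4: "(\<integral>\<^sup>+y. T4 y \<partial>lborel) \<le> ennreal (D * C4 * \<rho> powr \<sigma>)"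
    proof -
      have "(\<integral>\<^sup>+y. T4 y \<partial>lborel) = ennreal (D * \<rho> powr (- (\<sigma> / p) * q)) * (\<integral>\<^sup>+(y::'a). ennreal (norm y powr - ((?n - s) * q)) * indicator {y. 2 * \<rho> \<le> norm y} y \<partial>lborel)"
        unfolding T4_def by (rule nn_integral_cmult) measurable
      also have "\<dots> \<le> ennreal (D * \<rho> powr (- (\<sigma> / p) * q)) * ennreal (C4 * \<rho> powr (?n - (?n - s) * q))"
        using nn_integral_norm_far[OF nsq, of "2 * \<rho>"] \<rho>
        by (intro mult_left_mono) (auto simp: C4_def powr_mult mult_ac)
      also have "\<dots> = ennreal (D * C4 * (\<rho> powr (- (\<sigma> / p) * q) * \<rho> powr (?n - (?n - s) * q)))"
        using C4 D by (simp add: ennreal_mult[symmetric] mult_ac)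
      also have "\<rho> powr (- (\<sigma> / p) * q) * \<rho> powr (?n - (?n - s) * q) = \<rho> powr \<sigma>"
        unfolding powr_add[symmetric] E3 ..
      finally show ?thesis .
    qed
    have "riesz_mean s \<rho> F
      \<le> (\<integral>\<^sup>+z. \<integral>\<^sup>+y. (T1 z y + T2 z y) + (T3 y + T4 y) \<partial>lborel \<partial>unif_ball)"
      by (intro nn_integral_mono pw)
    also have "\<dots> = (\<integral>\<^sup>+z. ((\<integral>\<^sup>+y. T1 z y \<partial>lborel) + (\<integral>\<^sup>+y. T2 z y \<partial>lborel)) + ((\<integral>\<^sup>+y. T3 y \<partial>lborel) + (\<integral>\<^sup>+y. T4 y \<partial>lborel)) \<partial>unif_ball)"
      by (simp add: nn_integral_add)
    also have "\<dots> = ((\<integral>\<^sup>+z. \<integral>\<^sup>+y. T1 z y \<partial>lborel \<partial>unif_ball) + (\<integral>\<^sup>+z. \<integral>\<^sup>+y. T2 z y \<partial>lborel \<partial>unif_ball)) + ((\<integral>\<^sup>+y. T3 y \<partial>lborel) + (\<integral>\<^sup>+y. T4 y \<partial>lborel))"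
    proof -
      have [measurable]: "(\<lambda>z. \<integral>\<^sup>+y. T1 z y \<partial>lborel) \<in> borel_measurable unif_ball" "(\<lambda>z. \<integral>\<^sup>+y. T2 z y \<partial>lborel) \<in> borel_measurable unif_ball"
        by (rule lborel.borel_measurable_nn_integral[OF T1m], rule lborel.borel_measurable_nn_integral[OF T2m])
      show ?thesis by (subst nn_integral_add) (auto simp: nn_integral_add)
    qed
    also have "\<dots> \<le> (ennreal (C1 * \<rho> powr \<sigma>) + ennreal (C2 * \<rho> powr \<sigma>)) + (ennreal (D * \<rho> powr \<sigma>) + ennreal (D * C4 * \<rho> powr \<sigma>))"
      by (intro add_mono I1 I2 I3 I4)
    also have "\<dots> = ennreal (C * \<rho> powr \<sigma>)"
      using C1 C2 D C4 unfolding C_def by (simp add: ennreal_plus[symmetric] distrib_right del: ennreal_plus)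
    finally show ?thesis .
  qed
  then show ?thesis using C unfolding \<sigma>_def by blast
qed

section \<open>Null sets seen on spheres\<close>

lemma AE_lborel_scaleR:
  fixes P :: "'a::euclidean_space \<Rightarrow> bool"
  assumes [measurable]: "Measurable.pred borel P" and "c \<noteq> 0" and ae: "AE x in lborel. P x"
  shows "AE x in lborel. P (c *\<^sub>R x)"
proof -
  have "AE x in density (distr lborel borel (\<lambda>x. 0 + c *\<^sub>R x)) (\<lambda>_. ennreal (\<bar>c\<bar> ^ DIM('a))). P x"
    using ae lborel_affine[OF assms(2), of "0::'a"] by (metis ennreal_power abs_ge_zero)
  then have "AE x in distr lborel borel (\<lambda>x. 0 + c *\<^sub>R x). P x"
    using assms(2) by (simp only: AE_density borel_measurable_const) simp
  then show ?thesis by (subst (asm) AE_distr_iff) auto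
qed

text \<open>The preimage of a null set of radii under the norm is null. For fixed \<open>x\<close>
  almost every \<open>r\<close> satisfies \<open>Q (r * norm x)\<close>, so by Fubini some
  \<open>r > 0\<close> works for almost every \<open>x\<close>, and a dilation by
  \<open>1 / r\<close> removes it.\<close>

lemma AE_norm_of_AE_real:
  fixes Q :: "real \<Rightarrow> bool"
  assumes [measurable]: "Measurable.pred borel Q" and ae: "AE r in lborel. r > 0 \<longrightarrow> Q r"
  shows "AE x::'a::euclidean_space in lborel. x \<noteq> 0 \<longrightarrow> Q (norm x)"
proof -
  have "AE r in lborel. r > 0 \<and> x \<noteq> 0 \<longrightarrow> Q (r * norm x)" for x :: 'a
  proof (cases "x = 0")
    case False
    then have "AE r in lborel. 0 + norm x * r > 0 \<longrightarrow> Q (0 + norm x * r)"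
      by (intro AE_borel_affine[OF _ _ ae]) auto
    then show ?thesis by eventually_elim (use False in \<open>auto simp: mult.commute\<close>)
  qed simp
  then have "AE x::'a in lborel. AE r in lborel. r > 0 \<and> x \<noteq> 0 \<longrightarrow> Q (r * norm x)" by simp
  then have swap: "AE r in lborel. AE x::'a in lborel. r > 0 \<and> x \<noteq> 0 \<longrightarrow> Q (r * norm x)"
    by (subst (asm) lborel_pair.AE_commute) measurable
  \<comment> \<open>Almost every \<open>r\<close> qualifies, and \<open>{0<..<1}\<close> is not a
    null set.\<close>
  have "\<exists>r>0. AE x::'a in lborel. x \<noteq> 0 \<longrightarrow> Q (r * norm x)"
  proof (rule ccontr)
    assume "\<not> ?thesis"
    then have "AE r::real in lborel. r \<notin> {0<..<1}"
      using swap by (auto elim!: eventually_mono)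
    then have "emeasure lborel {0<..<1::real} = 0"
      by (subst (asm) AE_iff_measurable[where N="{0<..<1}"]) auto
    then show False by simp
  qed
  then obtain r where r: "r > 0" "AE x::'a in lborel. x \<noteq> 0 \<longrightarrow> Q (r * norm x)" by blast
  have "AE x::'a in lborel. (1 / r) *\<^sub>R x \<noteq> 0 \<longrightarrow> Q (r * norm ((1 / r) *\<^sub>R x))"
    by (rule AE_lborel_scaleR[OF _ _ r(2)]) (use r in auto)
  then show ?thesis by eventually_elim (use r in auto)
qed

text \<open>Instead of polar coordinates: for fixed \<open>r\<close> the dilate of a null set is null, so by Fubini almost
  every ray meets the null set in a null set of radii.\<close>

lemma AE_spheres:
  fixes P :: "'a::euclidean_space \<Rightarrow> bool"
  assumes [measurable]: "Measurable.pred borel P" and ae: "AE x in lborel. P x"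
  shows "AE x::'a in lborel. AE z in unif_ball. x \<noteq> 0 \<longrightarrow> P (norm x *\<^sub>R sgn z)"
proof -
  interpret U: finite_measure "unif_ball :: 'a measure" by (rule finite_measure_unif_ball)
  interpret B: pair_sigma_finite "unif_ball :: 'a measure" "lborel :: 'a measure" ..
  have "AE z in lborel. r > 0 \<longrightarrow> P (r *\<^sub>R z)" for r :: real
    using AE_lborel_scaleR[OF assms(1) _ ae, of r] by (cases "r > 0") auto
  then have "AE r in lborel. AE z in lborel. r > (0::real) \<longrightarrow> P (r *\<^sub>R z)" by simp
  then have "AE z in lborel. AE r in lborel. r > (0::real) \<longrightarrow> P (r *\<^sub>R z)"
    by (subst (asm) lborel_pair.AE_commute) measurable
  then have "AE z in unif_ball. AE r in lborel. r > (0::real) \<longrightarrow> P (r *\<^sub>R z)"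
    unfolding unif_ball_def by (intro AE_uniform_measureI) (auto elim: eventually_mono)
  moreover have "AE z in unif_ball. z \<noteq> (0::'a)"
    unfolding unif_ball_def using AE_lborel_singleton[of "0::'a"] by (intro AE_uniform_measureI) (auto elim: eventually_mono)
  ultimately have "AE z in unif_ball. AE x::'a in lborel. x \<noteq> 0 \<longrightarrow> P (norm x *\<^sub>R sgn z)"
  proof eventually_elim
    case (elim z)
    have "AE r in lborel. 0 + (1 / norm z) * r > 0 \<longrightarrow> P ((0 + (1 / norm z) * r) *\<^sub>R z)"
      by (rule AE_borel_affine[OF _ _ elim(1)]) (use elim in auto)
    then have "AE r in lborel. r > 0 \<longrightarrow> P (r *\<^sub>R sgn z)"
      by eventually_elim (use elim in \<open>auto simp: sgn_div_norm divide_inverse mult.commute\<close>)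
    then show ?case by (intro AE_norm_of_AE_real) auto
  qed
  then show ?thesis by (subst (asm) B.AE_commute) measurable
qed


section \<open>The Riesz kernel\<close>

text \<open>The inequality \<open>x / m \<le> exp (x / m)\<close> raised to the power
  \<open>m\<close>.\<close>

lemma exp_minus_le_powr:
  fixes x m :: real assumes "x > 0" "m > 0"
  shows "exp (- x) \<le> (m / x) powr m"
proof -
  have "x / m \<le> exp (x / m)" using exp_ge_add_one_self[of "x / m"] by linarith
  then have "(x / m) powr m \<le> exp (x / m) powr m" using assms by (intro powr_mono2) auto
  also have "\<dots> = exp x" using assms by (simp add: powr_def)
  finally have "1 / exp x \<le> 1 / (x / m) powr m" using assms by (intro divide_left_mono) auto
  also have "\<dots> = (m / x) powr m" using assms by (simp add: powr_divide)
  finally show ?thesis by (simp add: exp_minus divide_inverse)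
qed

text \<open>A bound uniform in time: trading the exponential for a power of order
  \<open>n / 2\<close> cancels the factor \<open>t powr (- n / 2)\<close>.\<close>

lemma wide_gauss_le_norm:
  fixes z :: "'a::euclidean_space"
  assumes "t > 0" "z \<noteq> 0"
  shows "wide_gauss t z \<le> (4 * real DIM('a)) powr (real DIM('a) / 2) * norm z powr - real DIM('a)"
proof -
  let ?m = "real DIM('a) / 2"
  have m: "?m > 0" by simp
  have "exp (- (norm z)\<^sup>2 / (8 * t)) \<le> (?m / ((norm z)\<^sup>2 / (8 * t))) powr ?m"
    using exp_minus_le_powr[of "(norm z)\<^sup>2 / (8 * t)" ?m] assms m by simp
  also have "?m / ((norm z)\<^sup>2 / (8 * t)) = t * (4 * real DIM('a) / (norm z)\<^sup>2)" using assms by (simp add: field_simps)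
  also have "\<dots> powr ?m = t powr ?m * ((4 * real DIM('a)) powr ?m / ((norm z)\<^sup>2) powr ?m)"
    using assms by (simp add: powr_mult powr_divide)
  also have "((norm z)\<^sup>2) powr ?m = norm z powr real DIM('a)"
    using assms by (simp add: powr_powr flip: powr_numeral)
  finally have "wide_gauss t z \<le> t powr - ?m * (t powr ?m * ((4 * real DIM('a)) powr ?m / norm z powr real DIM('a)))"
    unfolding wide_gauss_def minus_divide_left[symmetric] by (intro mult_left_mono) auto
  also have "\<dots> = (4 * real DIM('a)) powr ?m * norm z powr - real DIM('a)"
    using assms by (simp add: powr_minus field_simps)
  finally show ?thesis .
qed

lemma measurable_wide_gauss [measurable]: "(\<lambda>t. wide_gauss t z) \<in> borel_measurable borel"
  unfolding wide_gauss_def by measurable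

lemma nn_integral_powr_from_0:
  assumes "a > -1" "c \<ge> 0"
  shows "(\<integral>\<^sup>+t. ennreal (indicator {0..c} t * t powr a) \<partial>lborel) = ennreal (c powr (a + 1) / (a + 1))"
  by (rule nn_integral_has_integral_lebesgue[OF _ has_integral_powr_from_0[OF assms]]) auto

lemma nn_integral_powr_to_inf:
  assumes "a < -1" "c > 0"
  shows "(\<integral>\<^sup>+t. ennreal (indicator {c..} t * t powr a) \<partial>lborel) = ennreal (- (c powr (a + 1)) / (a + 1))"
  by (rule nn_integral_has_integral_lebesgue[OF _ has_integral_powr_to_inf[OF assms]]) auto

text \<open>The time integral of the Riesz kernel over \<open>I\<close>, with the Gaussian bound in
  place of the heat kernel.\<close>

abbreviation gauss_time :: "real \<Rightarrow> real set \<Rightarrow> 'a::euclidean_space \<Rightarrow> ennreal" where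
  "gauss_time s I z \<equiv> \<integral>\<^sup>+t. ennreal (t powr (s / 2 - 1) * wide_gauss t z) * indicator I t \<partial>lborel"

text \<open>The time axis is cut at \<open>(norm z)\<^sup>2\<close>. Before it the time-uniform
  bound applies, and \<open>\<sigma> > 0\<close> gives integrability at 0; after it the exponential
  is dropped, and \<open>\<sigma> < n\<close> gives integrability at infinity. Both parts have the
  order \<open>norm z powr (\<sigma> - n)\<close>.\<close>

lemma nn_integral_wide_gauss_time:
  assumes \<sigma>: "0 < \<sigma>" "\<sigma> < real DIM('a::euclidean_space)"
  shows "\<exists>C\<ge>0. \<forall>z::'a. z \<noteq> 0 \<longrightarrow>
    gauss_time \<sigma> {0<..} z
      \<le> ennreal (C * norm z powr (\<sigma> - real DIM('a)))"
proof -
  let ?n = "real DIM('a)"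
  define K where "K = (4 * ?n) powr (?n / 2)"
  define C where "C = K * (2 / \<sigma>) + 2 / (?n - \<sigma>)"
  have K: "K \<ge> 0" by (simp add: K_def)
  have C: "C \<ge> 0" using \<sigma> K by (simp add: C_def)
  have "gauss_time \<sigma> {0<..} z
      \<le> ennreal (C * norm z powr (\<sigma> - ?n))" if z: "z \<noteq> 0" for z :: 'a
  proof -
    define c where "c = (norm z)\<^sup>2"
    define e where "e = \<sigma> / 2 - 1 - ?n / 2"
    have c: "c > 0" using z by (simp add: c_def)
    have cp: "c powr x = norm z powr (2 * x)" for x
      unfolding c_def using z by (simp add: powr_powr flip: powr_numeral)
    have two: "(2::real) \<noteq> 0" by simp
    have "gauss_time \<sigma> {0<..} z
      \<le> (\<integral>\<^sup>+t. ennreal (K * norm z powr - ?n) * ennreal (indicator {0..c} t * t powr (\<sigma> / 2 - 1))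
            + ennreal (indicator {c..} t * t powr e) \<partial>lborel)"
    proof (rule nn_integral_mono)
      fix t :: real
      show "ennreal (t powr (\<sigma> / 2 - 1) * wide_gauss t z) * indicator {0<..} t
        \<le> ennreal (K * norm z powr - ?n) * ennreal (indicator {0..c} t * t powr (\<sigma> / 2 - 1))
            + ennreal (indicator {c..} t * t powr e)"
      proof (cases "t > 0")
        case t: True
        show ?thesis
        proof (cases "t \<le> c")
          case True
          have "t powr (\<sigma> / 2 - 1) * wide_gauss t z \<le> t powr (\<sigma> / 2 - 1) * (K * norm z powr - ?n)"
            unfolding K_def by (intro mult_left_mono wide_gauss_le_norm t z) auto
          then have "ennreal (t powr (\<sigma> / 2 - 1) * wide_gauss t z) \<le> ennreal ((K * norm z powr - ?n) * (t powr (\<sigma> / 2 - 1)))"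
            by (intro ennreal_leI) (simp add: mult_ac)
          then show ?thesis using t True K by (simp add: ennreal_mult add_increasing2)
        next
          case False
          have "wide_gauss t z \<le> t powr (- ?n / 2)"
            using t unfolding wide_gauss_def by (intro mult_left_le) auto
          then have "t powr (\<sigma> / 2 - 1) * wide_gauss t z \<le> t powr (\<sigma> / 2 - 1) * t powr (- ?n / 2)"
            by (intro mult_left_mono) auto
          also have "\<dots> = t powr e" unfolding powr_add[symmetric] e_def by simp
          finally show ?thesis using t False by (simp add: ennreal_leI add_increasing)
        qed
      qed simp
    qed
    also have "\<dots> = ennreal (K * norm z powr - ?n) * (\<integral>\<^sup>+t. ennreal (indicator {0..c} t * t powr (\<sigma> / 2 - 1)) \<partial>lborel)
            + (\<integral>\<^sup>+t. ennreal (indicator {c..} t * t powr e) \<partial>lborel)"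
      by (subst nn_integral_add) (simp_all add: nn_integral_cmult)
    also have "\<dots> = ennreal (K * norm z powr - ?n) * ennreal (c powr (\<sigma> / 2) / (\<sigma> / 2)) + ennreal (c powr ((\<sigma> - ?n) / 2) * (2 / (?n - \<sigma>)))"
    proof (intro arg_cong2[where f="(+)"] arg_cong2[where f="(*)"] refl)
      show "(\<integral>\<^sup>+t. ennreal (indicator {0..c} t * t powr (\<sigma> / 2 - 1)) \<partial>lborel) = ennreal (c powr (\<sigma> / 2) / (\<sigma> / 2))"
        using nn_integral_powr_from_0[of "\<sigma> / 2 - 1" c] \<sigma> c by simp
      have "e < -1" using \<sigma> by (simp add: e_def)
      have e1: "e + 1 = (\<sigma> - ?n) / 2" by (simp add: e_def diff_divide_distrib)
      have "- (c powr (e + 1)) / (e + 1) = c powr ((\<sigma> - ?n) / 2) * (2 / (?n - \<sigma>))"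
      proof -
        have "- X / ((\<sigma> - ?n) / 2) = X * (2 / d)" if "d = ?n - \<sigma>" for X d :: real
        proof -
          have "(\<sigma> - ?n) / 2 = - (d / 2)" by (simp add: that diff_divide_distrib)
          then show ?thesis by simp
        qed
        then show ?thesis unfolding e1 by blast
      qed
      then show "(\<integral>\<^sup>+t. ennreal (indicator {c..} t * t powr e) \<partial>lborel) = ennreal (c powr ((\<sigma> - ?n) / 2) * (2 / (?n - \<sigma>)))"
        using nn_integral_powr_to_inf[OF \<open>e < -1\<close> c] by simp
    qed
    also have "\<dots> = ennreal (K * norm z powr - ?n * (norm z powr \<sigma> * (2 / \<sigma>)) + norm z powr (\<sigma> - ?n) * (2 / (?n - \<sigma>)))"
      using K \<sigma> unfolding cp times_divide_eq_right nonzero_mult_div_cancel_left[OF two]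
      by (simp add: ennreal_mult[symmetric] ennreal_plus[symmetric] del: ennreal_plus)
    also have "K * norm z powr - ?n * (norm z powr \<sigma> * (2 / \<sigma>)) + norm z powr (\<sigma> - ?n) * (2 / (?n - \<sigma>)) = C * norm z powr (\<sigma> - ?n)"
    proof -
      have "norm z powr - ?n * norm z powr \<sigma> = norm z powr (\<sigma> - ?n)"
        unfolding powr_add[symmetric] by simp
      moreover have "K * norm z powr - ?n * (norm z powr \<sigma> * (2 / \<sigma>)) = (K * (2 / \<sigma>)) * (norm z powr - ?n * norm z powr \<sigma>)"
        by (simp only: mult_ac)
      ultimately have "K * norm z powr - ?n * (norm z powr \<sigma> * (2 / \<sigma>)) = (K * (2 / \<sigma>)) * norm z powr (\<sigma> - ?n)"
        by (simp only:)
      then show ?thesis unfolding C_def distrib_right by (simp only: mult.commute)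
    qed
    finally show ?thesis .
  qed
  then show ?thesis using C by blast
qed

context dirichlet_basis
begin

abbreviation kern_integrand :: "real \<Rightarrow> real set \<Rightarrow> 'a \<Rightarrow> 'a \<Rightarrow> real \<Rightarrow> real" where
  "kern_integrand s I x y t \<equiv> indicator I t * (t powr (s / 2 - 1) * heat_kernel lam \<phi> t x y)"

text \<open>The time set is a parameter: \<open>{0<..}\<close> gives the full kernel,
  \<open>{e<..}\<close> a bounded truncation that is continuous in \<open>x\<close>, and
  \<open>{0<..e}\<close> the difference of the two.\<close>

definition kern :: "real \<Rightarrow> real set \<Rightarrow> 'a \<Rightarrow> 'a \<Rightarrow> real" where
  "kern s I x y = 1 / Gamma (s / 2) *
     (\<integral>t. kern_integrand s I x y t \<partial>lborel)"

lemma riesz_kernel_eq: "riesz_kernel lam \<phi> s x y = kern s {0<..} x y"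
  by (simp add: riesz_kernel_def kern_def set_lebesgue_integral_def)

lemma measurable_heat_kernel [measurable]:
  assumes [measurable]: "f \<in> borel_measurable M" "g \<in> borel_measurable M" "h \<in> borel_measurable M"
  shows "(\<lambda>w. heat_kernel lam \<phi> (f w) (g w) (h w)) \<in> borel_measurable M"
proof -
  have [measurable]: "(\<lambda>w. \<phi> k (g w)) \<in> borel_measurable M" "(\<lambda>w. \<phi> k (h w)) \<in> borel_measurable M" for k
    by (rule measurable_compose[OF _ measurable_\<phi>], fact)+
  show ?thesis unfolding heat_kernel_def by measurable
qed

lemma measurable_kern:
  assumes I[measurable]: "I \<in> sets borel" and [measurable]: "g \<in> borel_measurable M" "h \<in> borel_measurable M"
  shows "(\<lambda>w. kern s I (g w) (h w)) \<in> borel_measurable M"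
proof -
  have "(\<lambda>(w, t). indicator I t * (t powr (s / 2 - 1) * heat_kernel lam \<phi> t (g w) (h w))) \<in> borel_measurable (M \<Otimes>\<^sub>M lborel)"
    unfolding case_prod_unfold
    by (intro borel_measurable_times measurable_heat_kernel) measurable
  from lborel.borel_measurable_lebesgue_integral[OF this]
  show ?thesis unfolding kern_def by (intro borel_measurable_times) auto
qed

lemma measurable_kern_integrand:
  assumes I[measurable]: "I \<in> sets borel"
  shows "(\<lambda>t. kern_integrand s I x y t) \<in> borel_measurable lborel"
  by (intro borel_measurable_times measurable_heat_kernel) measurable

lemma kern_integrand_bound:
  assumes I: "I \<subseteq> {0<..}"
  shows "\<bar>kern_integrand s I x y t\<bar>
    \<le> 1 / gauss_const TYPE('a) * (t powr (s / 2 - 1) * wide_gauss t (x - y)) * indicator I t"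
proof (cases "t \<in> I")
  case True
  then have t: "t > 0" using I by auto
  have g: "gauss_const TYPE('a) > 0" by (rule gauss_const_pos)
  have "\<bar>heat_kernel lam \<phi> t x y\<bar> \<le> 1 / gauss_const TYPE('a) * wide_gauss t (x - y)"
    using heat_kernel_gaussian_bound[OF t, of x y] g by (simp add: field_simps)
  then have "t powr (s / 2 - 1) * \<bar>heat_kernel lam \<phi> t x y\<bar> \<le> t powr (s / 2 - 1) * (1 / gauss_const TYPE('a) * wide_gauss t (x - y))"
    by (intro mult_left_mono) auto
  then show ?thesis using True by (simp add: abs_mult)
qed simp

lemma nn_integral_kern_integrand:
  assumes I[measurable]: "I \<in> sets borel" and sub: "I \<subseteq> {0<..}"
  shows "(\<integral>\<^sup>+t. ennreal \<bar>kern_integrand s I x y t\<bar> \<partial>lborel)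
    \<le> ennreal (1 / gauss_const TYPE('a)) * gauss_time s I (x - y)"
proof -
  have g: "gauss_const TYPE('a) > 0" by (rule gauss_const_pos)
  have "(\<integral>\<^sup>+t. ennreal \<bar>kern_integrand s I x y t\<bar> \<partial>lborel)
    \<le> (\<integral>\<^sup>+t. ennreal (1 / gauss_const TYPE('a)) * (ennreal (t powr (s / 2 - 1) * wide_gauss t (x - y)) * indicator I t) \<partial>lborel)"
  proof (rule nn_integral_mono)
    fix t
    show "ennreal \<bar>kern_integrand s I x y t\<bar>
      \<le> ennreal (1 / gauss_const TYPE('a)) * (ennreal (t powr (s / 2 - 1) * wide_gauss t (x - y)) * indicator I t)"
      using ennreal_leI[OF kern_integrand_bound[OF sub, of t s x y]] g wide_gauss_nonneg[of t "x - y"]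
      by (cases "t \<in> I") (simp_all add: ennreal_mult[symmetric])
  qed
  also have "\<dots> = ennreal (1 / gauss_const TYPE('a)) * gauss_time s I (x - y)"
    by (rule nn_integral_cmult) measurable
  finally show ?thesis .
qed

lemma kern_abs_le:
  assumes I: "I \<in> sets borel" "I \<subseteq> {0<..}" and s: "s > 0" and C: "C \<ge> 0"
    and le: "gauss_time s I (x - y) \<le> ennreal C"
  shows "integrable lborel (\<lambda>t. kern_integrand s I x y t)"
    and "\<bar>kern s I x y\<bar> \<le> 1 / (Gamma (s / 2) * gauss_const TYPE('a)) * C"
proof -
  let ?f = "\<lambda>t. kern_integrand s I x y t"
  have g: "gauss_const TYPE('a) > 0" by (rule gauss_const_pos)
  have G: "Gamma (s / 2) > 0" using s by (intro Gamma_real_pos) simp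
  have "(\<integral>\<^sup>+t. ennreal \<bar>?f t\<bar> \<partial>lborel) \<le> ennreal (1 / gauss_const TYPE('a)) * ennreal C"
    using nn_integral_kern_integrand[OF I, of s x y] le by (meson mult_left_mono order_trans zero_le)
  also have "\<dots> = ennreal (1 / gauss_const TYPE('a) * C)" using g C by (simp add: ennreal_mult[symmetric])
  finally have nn: "(\<integral>\<^sup>+t. ennreal (norm (?f t)) \<partial>lborel) \<le> ennreal (1 / gauss_const TYPE('a) * C)" by simp
  show int: "integrable lborel ?f"
    using nn by (intro integrableI_bounded measurable_kern_integrand I) (auto simp: le_less_trans)
  have "ennreal (norm (integral\<^sup>L lborel ?f)) \<le> ennreal (1 / gauss_const TYPE('a) * C)"
    using integral_norm_bound_ennreal[OF int] nn by (rule order_trans)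
  then have "\<bar>integral\<^sup>L lborel ?f\<bar> \<le> 1 / gauss_const TYPE('a) * C"
    using g C by simp
  then have "1 / Gamma (s / 2) * \<bar>integral\<^sup>L lborel ?f\<bar> \<le> 1 / Gamma (s / 2) * (1 / gauss_const TYPE('a) * C)"
    using G by (intro mult_left_mono) auto
  then show "\<bar>kern s I x y\<bar> \<le> 1 / (Gamma (s / 2) * gauss_const TYPE('a)) * C"
    unfolding kern_def using G by (simp add: abs_mult)
qed

text \<open>One constant serves all time sets, since \<open>gauss_time\<close> is monotone in the
  set.\<close>

lemma kern_bound:
  assumes s: "0 < s" "s < real DIM('a)"
  shows "\<exists>C\<ge>0. \<forall>I x y. I \<in> sets borel \<longrightarrow> I \<subseteq> {0<..} \<longrightarrow> x \<noteq> y \<longrightarrow>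
    integrable lborel (\<lambda>t. kern_integrand s I x y t) \<and>
    \<bar>kern s I x y\<bar> \<le> C * norm (x - y) powr (s - real DIM('a))"
proof -
  obtain C where C: "C \<ge> 0" "\<And>z::'a. z \<noteq> 0 \<Longrightarrow>
    gauss_time s {0<..} z \<le> ennreal (C * norm z powr (s - real DIM('a)))"
    using nn_integral_wide_gauss_time[OF s] by blast
  let ?C = "1 / (Gamma (s / 2) * gauss_const TYPE('a)) * C"
  have "?C \<ge> 0" using C(1) s Gamma_real_pos[of "s / 2"] gauss_const_pos[where 'a='a] by simp
  moreover have "integrable lborel (\<lambda>t. kern_integrand s I x y t) \<and>
    \<bar>kern s I x y\<bar> \<le> ?C * norm (x - y) powr (s - real DIM('a))"
    if I: "I \<in> sets borel" "I \<subseteq> {0<..}" and xy: "x \<noteq> y" for I x y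
  proof -
    have "gauss_time s I (x - y)
      \<le> gauss_time s {0<..} (x - y)"
      using I(2) by (intro nn_integral_mono mult_left_mono) (auto simp: indicator_def)
    also have "\<dots> \<le> ennreal (C * norm (x - y) powr (s - real DIM('a)))" using C(2) xy by simp
    finally show ?thesis
      using kern_abs_le[OF I s(1), of "C * norm (x - y) powr (s - real DIM('a))" x y] C(1)
      by (simp add: mult.assoc)
  qed
  ultimately show ?thesis by blast
qed

text \<open>For \<open>t \<le> e\<close> part of the power of \<open>t\<close> can be traded for
  \<open>e powr ((s - s') / 2)\<close>, leaving a kernel of the smaller order
  \<open>s'\<close>.\<close>

lemma kern_small_time:
  assumes s: "0 < s'" "s' < s" "s < real DIM('a)"
  shows "\<exists>C\<ge>0. \<forall>e x y. e > 0 \<longrightarrow> x \<noteq> y \<longrightarrow>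
    \<bar>kern s {0<..} x y - kern s {e<..} x y\<bar> \<le> C * e powr ((s - s') / 2) * norm (x - y) powr (s' - real DIM('a))"
proof -
  have s0: "s > 0" "s' < real DIM('a)" using s by auto
  obtain C where C: "C \<ge> 0" "\<And>z::'a. z \<noteq> 0 \<Longrightarrow>
    gauss_time s' {0<..} z \<le> ennreal (C * norm z powr (s' - real DIM('a)))"
    using nn_integral_wide_gauss_time[OF s(1) s0(2)] by blast
  obtain C' where C': "\<And>I x y. I \<in> sets borel \<Longrightarrow> I \<subseteq> {0<..} \<Longrightarrow> x \<noteq> y \<Longrightarrow>
    integrable lborel (\<lambda>t. kern_integrand s I x y t)"
    using kern_bound[OF s0(1) s(3)] by blast
  let ?C = "1 / (Gamma (s / 2) * gauss_const TYPE('a)) * C"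
  have "?C \<ge> 0" using C(1) s Gamma_real_pos[of "s / 2"] gauss_const_pos[where 'a='a] by simp
  moreover have "\<bar>kern s {0<..} x y - kern s {e<..} x y\<bar> \<le> ?C * e powr ((s - s') / 2) * norm (x - y) powr (s' - real DIM('a))"
    if e: "e > 0" and xy: "x \<noteq> y" for e x y
  proof -
    let ?h = "\<lambda>t. t powr (s / 2 - 1) * heat_kernel lam \<phi> t x y"
    have int: "integrable lborel (\<lambda>t. indicator {0<..} t * ?h t)" "integrable lborel (\<lambda>t. indicator {e<..} t * ?h t)"
      using e xy by (auto intro!: C')
    have "indicator {0<..} t * ?h t - indicator {e<..} t * ?h t = indicator {0<..e} t * ?h t" for t
      using e by (auto simp: indicator_def)
    then have eq: "kern s {0<..} x y - kern s {e<..} x y = kern s {0<..e} x y"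
      unfolding kern_def right_diff_distrib[symmetric] Bochner_Integration.integral_diff[OF int, symmetric] by simp
    have "gauss_time s {0<..e} (x - y)
      \<le> (\<integral>\<^sup>+t. ennreal (e powr ((s - s') / 2)) * (ennreal (t powr (s' / 2 - 1) * wide_gauss t (x - y)) * indicator {0<..} t) \<partial>lborel)"
    proof (rule nn_integral_mono)
      fix t
      show "ennreal (t powr (s / 2 - 1) * wide_gauss t (x - y)) * indicator {0<..e} t
        \<le> ennreal (e powr ((s - s') / 2)) * (ennreal (t powr (s' / 2 - 1) * wide_gauss t (x - y)) * indicator {0<..} t)"
      proof (cases "0 < t \<and> t \<le> e")
        case True
        have "t powr (s / 2 - 1) = t powr ((s - s') / 2) * t powr (s' / 2 - 1)"
          unfolding powr_add[symmetric] by (simp add: field_simps)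
        also have "\<dots> \<le> e powr ((s - s') / 2) * t powr (s' / 2 - 1)"
          using True s by (intro mult_right_mono powr_mono2) auto
        finally have "t powr (s / 2 - 1) * wide_gauss t (x - y) \<le> e powr ((s - s') / 2) * t powr (s' / 2 - 1) * wide_gauss t (x - y)"
          by (intro mult_right_mono wide_gauss_nonneg)
        then have "ennreal (t powr (s / 2 - 1) * wide_gauss t (x - y)) \<le> ennreal (e powr ((s - s') / 2) * (t powr (s' / 2 - 1) * wide_gauss t (x - y)))"
          by (intro ennreal_leI) (simp add: mult.assoc)
        then show ?thesis using True wide_gauss_nonneg[of t "x - y"] by (simp add: ennreal_mult)
      qed auto
    qed
    also have "\<dots> = ennreal (e powr ((s - s') / 2)) * gauss_time s' {0<..} (x - y)"
    by (rule nn_integral_cmult) measurable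
    also have "\<dots> \<le> ennreal (e powr ((s - s') / 2)) * ennreal (C * norm (x - y) powr (s' - real DIM('a)))"
      using xy by (intro mult_left_mono C(2)) auto
    also have "\<dots> = ennreal (e powr ((s - s') / 2) * (C * norm (x - y) powr (s' - real DIM('a))))"
      using C(1) by (simp add: ennreal_mult[symmetric])
    finally have "\<bar>kern s {0<..e} x y\<bar> \<le> 1 / (Gamma (s / 2) * gauss_const TYPE('a)) * (e powr ((s - s') / 2) * (C * norm (x - y) powr (s' - real DIM('a))))"
      by (intro kern_abs_le(2)) (use C(1) s0 in auto)
    then show ?thesis unfolding eq by (simp add: mult_ac)
  qed
  ultimately show ?thesis by blast
qed

text \<open>Away from time 0 the integrand is dominated, uniformly in space, by a multiple of
  \<open>t powr a\<close>, and \<open>a < -1\<close> because \<open>s < n\<close>. The same majorant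
  serves dominated convergence.\<close>

lemma kern_large_time:
  assumes s: "0 < s" "s < real DIM('a)" and e: "e > 0"
  shows "\<exists>B. \<forall>x y. \<bar>kern s {e<..} x y\<bar> \<le> B"
    and "continuous_on UNIV (\<lambda>x. kern s {e<..} x y)"
proof -
  let ?n = "real DIM('a)"
  define a where "a = s / 2 - 1 - ?n / 2"
  have a: "a < -1" using s by (simp add: a_def)
  have pw: "t powr (s / 2 - 1) * wide_gauss t z \<le> t powr a" if "t > 0" for t and z :: 'a
  proof -
    have "t powr (s / 2 - 1) * wide_gauss t z \<le> t powr (s / 2 - 1) * t powr (- ?n / 2)"
      by (intro mult_left_mono wide_gauss_le that) auto
    also have "\<dots> = t powr a" unfolding powr_add[symmetric] a_def by simp
    finally show ?thesis .
  qed
  define B where "B = - (e powr (a + 1)) / (a + 1)"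
  have B: "B \<ge> 0" unfolding B_def using a by (intro divide_nonpos_neg) auto
  have "\<bar>kern s {e<..} x y\<bar> \<le> 1 / (Gamma (s / 2) * gauss_const TYPE('a)) * B" for x y
  proof (rule kern_abs_le(2))
    have "gauss_time s {e<..} (x - y)
      \<le> (\<integral>\<^sup>+t. ennreal (indicator {e..} t * t powr a) \<partial>lborel)"
    proof (rule nn_integral_mono)
      fix t
      show "ennreal (t powr (s / 2 - 1) * wide_gauss t (x - y)) * indicator {e<..} t \<le> ennreal (indicator {e..} t * t powr a)"
        using pw[of t "x - y"] e by (cases "t > e") (auto intro: ennreal_leI)
    qed
    also have "\<dots> = ennreal B" unfolding B_def by (rule nn_integral_powr_to_inf[OF a e])
    finally show "gauss_time s {e<..} (x - y) \<le> ennreal B" .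
  qed (use e s B in auto)
  then show "\<exists>B. \<forall>x y. \<bar>kern s {e<..} x y\<bar> \<le> B" by blast
  show "continuous_on UNIV (\<lambda>x. kern s {e<..} x y)"
  proof (rule continuous_at_imp_continuous_on, intro ballI, unfold continuous_at_sequentially, intro allI impI)
    fix x :: 'a and X :: "nat \<Rightarrow> 'a" assume X: "X \<longlonglongrightarrow> x"
    have "(\<lambda>n. \<integral>t. kern_integrand s {e<..} (X n) y t \<partial>lborel)
      \<longlonglongrightarrow> (\<integral>t. kern_integrand s {e<..} x y t \<partial>lborel)"
    proof (rule integral_dominated_convergence[where w="\<lambda>t. 1 / gauss_const TYPE('a) * (indicator {e..} t * t powr a)"])
      have "integrable lborel (\<lambda>t. indicator {e..} t * t powr a)"
        using nn_integral_powr_to_inf[OF a e] B unfolding B_def[symmetric]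
        by (intro integrableI_nn_integral_finite[where x=B]) auto
      then show "integrable lborel (\<lambda>t. 1 / gauss_const TYPE('a) * (indicator {e..} t * t powr a))" by simp
      show "AE t in lborel. (\<lambda>n. kern_integrand s {e<..} (X n) y t)
        \<longlonglongrightarrow> kern_integrand s {e<..} x y t"
      proof (rule AE_I2)
        fix t
        show "(\<lambda>n. kern_integrand s {e<..} (X n) y t)
          \<longlonglongrightarrow> kern_integrand s {e<..} x y t"
        proof (cases "t > e")
          case True
          then have "t > 0" using e by simp
          \<comment> \<open>Continuity is known in the second argument; symmetry transfers it to the
            first.\<close>
          from heat_kernel_continuous[OF this, of y] have "isCont (heat_kernel lam \<phi> t y) x"
            by (simp add: continuous_on_eq_continuous_at)
          then have "(\<lambda>n. heat_kernel lam \<phi> t y (X n)) \<longlonglongrightarrow> heat_kernel lam \<phi> t y x"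
            using X by (rule isCont_tendsto_compose)
          then have "(\<lambda>n. heat_kernel lam \<phi> t (X n) y) \<longlonglongrightarrow> heat_kernel lam \<phi> t x y"
            by (simp only: heat_kernel_sym[of t y])
          then show ?thesis by (intro tendsto_intros)
        qed simp
      qed
      show "AE t in lborel. norm (kern_integrand s {e<..} (X n) y t)
        \<le> 1 / gauss_const TYPE('a) * (indicator {e..} t * t powr a)" for n
      proof (rule AE_I2)
        fix t
        show "norm (kern_integrand s {e<..} (X n) y t)
          \<le> 1 / gauss_const TYPE('a) * (indicator {e..} t * t powr a)"
        proof (cases "t > e")
          case True
          then have t: "t > 0" using e by simp
          have "norm (kern_integrand s {e<..} (X n) y t)
            \<le> 1 / gauss_const TYPE('a) * (t powr (s / 2 - 1) * wide_gauss t (X n - y)) * indicator {e<..} t"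
            using kern_integrand_bound[of "{e<..}" t s "X n" y] e by auto
          also have "\<dots> \<le> 1 / gauss_const TYPE('a) * t powr a"
            using True pw[OF t, of "X n - y"] gauss_const_pos[where 'a='a]
            by (auto intro!: divide_right_mono)
          finally show ?thesis using True by simp
        qed (use gauss_const_pos[where 'a='a] in auto)
      qed
    qed (intro measurable_kern_integrand, simp)+
    then show "((\<lambda>x. kern s {e<..} x y) \<circ> X) \<longlonglongrightarrow> kern s {e<..} x y"
      unfolding kern_def comp_def by (intro tendsto_intros)
  qed
qed

end


section \<open>Spherical means of potentials\<close>

text \<open>Without integrability the left side is 0 by convention. Potentials can therefore be
  estimated at points where their integral diverges.\<close>

lemma ennreal_abs_integral_le:
  fixes f :: "'b \<Rightarrow> real"
  shows "ennreal \<bar>\<integral>x. f x \<partial>M\<bar> \<le> (\<integral>\<^sup>+x. ennreal \<bar>f x\<bar> \<partial>M)"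
proof (cases "integrable M f")
  case True
  then show ?thesis using integral_norm_bound_ennreal[of M f] by simp
qed (simp add: not_integrable_integral_eq)

text \<open>Homogeneity removes the normalisation that Young's inequality requires; the case
  \<open>A = 0\<close>, in which no normalisation is possible, is trivial.\<close>

lemma radial_riesz_bound_Lp:
  fixes s p :: real
  assumes p: "1 < p" and s1: "1 / p < s" and s2: "s < real DIM('a::euclidean_space) / p"
  shows "\<exists>C\<ge>0. \<forall>\<rho>>0. \<forall>(f::'a \<Rightarrow> real) A. f \<in> borel_measurable borel \<longrightarrow> A \<ge> 0 \<longrightarrow>
     (\<integral>\<^sup>+y. ennreal (\<bar>f y\<bar> powr p) \<partial>lborel) = ennreal A \<longrightarrow>
     riesz_mean s \<rho> (\<lambda>y. \<bar>f y\<bar>)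
       \<le> ennreal (C * \<rho> powr (s - real DIM('a) / p) * A powr (1 / p))"
proof -
  obtain C where C: "C \<ge> 0" "\<And>\<rho> F::'a \<Rightarrow> real. \<rho> > 0 \<Longrightarrow> F \<in> borel_measurable borel \<Longrightarrow> (\<forall>y. F y \<ge> 0) \<Longrightarrow>
     (\<integral>\<^sup>+y. ennreal (F y powr p) \<partial>lborel) \<le> 1 \<Longrightarrow>
     riesz_mean s \<rho> F
       \<le> ennreal (C * \<rho> powr (s - real DIM('a) / p))"
    using radial_riesz_bound[OF assms] by blast
  have "riesz_mean s \<rho> (\<lambda>y. \<bar>f y\<bar>)
       \<le> ennreal (C * \<rho> powr (s - real DIM('a) / p) * A powr (1 / p))"
    if \<rho>: "\<rho> > 0" and f[measurable]: "f \<in> borel_measurable borel" and A: "A \<ge> 0"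
      and fA: "(\<integral>\<^sup>+y. ennreal (\<bar>f y\<bar> powr p) \<partial>lborel) = ennreal A" for \<rho> A and f :: "'a \<Rightarrow> real"
  proof (cases "A = 0")
    case True
    then have "(\<integral>\<^sup>+y. ennreal (\<bar>f y\<bar> powr p) \<partial>lborel) = 0" using fA by simp
    then have "AE y in lborel. ennreal (\<bar>f y\<bar> powr p) = 0"
      by (subst (asm) nn_integral_0_iff_AE) auto
    then have "AE y in lborel. f y = 0" by eventually_elim (simp add: ennreal_eq_0_iff)
    then have "(\<integral>\<^sup>+y. ennreal (norm (\<rho> *\<^sub>R sgn z - y) powr (s - real DIM('a)) * \<bar>f y\<bar>) \<partial>lborel) = (\<integral>\<^sup>+(y::'a). 0 \<partial>lborel)" for z
      by (intro nn_integral_cong_AE) auto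
    then show ?thesis by simp
  next
    case False
    define N where "N = A powr (1 / p)"
    have N: "N > 0" using False A by (simp add: N_def)
    have Np: "N powr p = A" using False A p by (simp add: N_def powr_powr)
    define F where "F = (\<lambda>y. \<bar>f y\<bar> / N)"
    have [measurable]: "F \<in> borel_measurable borel" unfolding F_def by measurable
    have F0: "\<forall>y. F y \<ge> 0" using N by (simp add: F_def)
    have "(\<integral>\<^sup>+y. ennreal (F y powr p) \<partial>lborel) = (\<integral>\<^sup>+y. ennreal (1 / A) * ennreal (\<bar>f y\<bar> powr p) \<partial>lborel)"
      using N A Np by (intro nn_integral_cong) (simp add: F_def powr_divide ennreal_mult[symmetric])
    also have "\<dots> = ennreal (1 / A) * ennreal A" by (subst nn_integral_cmult) (simp_all add: fA)
    also have "\<dots> = 1" using False A by (simp add: ennreal_mult[symmetric])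
    finally have "(\<integral>\<^sup>+y. ennreal (F y powr p) \<partial>lborel) \<le> 1" by simp
    note main = C(2)[OF \<rho> _ F0 this]
    have inner: "(\<integral>\<^sup>+y. ennreal (norm (\<rho> *\<^sub>R sgn z - y) powr (s - real DIM('a)) * \<bar>f y\<bar>) \<partial>lborel)
      = ennreal N * (\<integral>\<^sup>+y. ennreal (norm (\<rho> *\<^sub>R sgn z - y) powr (s - real DIM('a)) * F y) \<partial>lborel)" for z
    proof -
      have "(\<integral>\<^sup>+y. ennreal (norm (\<rho> *\<^sub>R sgn z - y) powr (s - real DIM('a)) * \<bar>f y\<bar>) \<partial>lborel)
        = (\<integral>\<^sup>+y. ennreal N * ennreal (norm (\<rho> *\<^sub>R sgn z - y) powr (s - real DIM('a)) * F y) \<partial>lborel)"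
        using N by (intro nn_integral_cong) (simp add: F_def ennreal_mult[symmetric])
      then show ?thesis by (simp add: nn_integral_cmult)
    qed
    have m: "(\<lambda>z::'a. \<integral>\<^sup>+y. ennreal (norm (\<rho> *\<^sub>R sgn z - y) powr (s - real DIM('a)) * F y) \<partial>lborel) \<in> borel_measurable unif_ball"
      by (intro lborel.borel_measurable_nn_integral) measurable
    have "riesz_mean s \<rho> (\<lambda>y. \<bar>f y\<bar>)
      = ennreal N * riesz_mean s \<rho> F"
      unfolding inner by (rule nn_integral_cmult[OF m])
    also have "\<dots> \<le> ennreal N * ennreal (C * \<rho> powr (s - real DIM('a) / p))"
      by (intro mult_left_mono main) auto
    also have "\<dots> = ennreal (C * \<rho> powr (s - real DIM('a) / p) * A powr (1 / p))"
      using N C by (simp add: N_def ennreal_mult[symmetric] mult.commute)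
    finally show ?thesis .
  qed
  with C(1) show ?thesis by blast
qed

text \<open>Pointwise, \<open>\<bar>f y\<bar>\<close> is at most the indicator of the ball plus
  \<open>\<bar>f y\<bar> powr p\<close>.\<close>

lemma integrable_of_powr_compact_support:
  fixes f :: "'a::euclidean_space \<Rightarrow> real"
  assumes f[measurable]: "f \<in> borel_measurable borel" and supp: "\<And>y. y \<notin> ball 0 R \<Longrightarrow> f y = 0"
    and p: "1 \<le> p" and fin: "(\<integral>\<^sup>+y. ennreal (\<bar>f y\<bar> powr p) \<partial>lborel) < \<infinity>"
  shows "integrable lborel f"
proof (rule integrableI_bounded)
  have "(\<integral>\<^sup>+y. ennreal (norm (f y)) \<partial>lborel) \<le> (\<integral>\<^sup>+y. indicator (ball 0 R) y + ennreal (\<bar>f y\<bar> powr p) \<partial>lborel)"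
  proof (rule nn_integral_mono)
    fix y
    show "ennreal (norm (f y)) \<le> indicator (ball 0 R) y + ennreal (\<bar>f y\<bar> powr p)"
    proof (cases "y \<in> ball 0 R")
      case True
      show ?thesis
      proof (cases "\<bar>f y\<bar> \<le> 1")
        case True
        then have "ennreal (norm (f y)) \<le> 1" by (simp add: ennreal_le_1)
        then show ?thesis using \<open>y \<in> ball 0 R\<close> by (simp add: add_increasing2)
      next
        case False
        then have "\<bar>f y\<bar> powr 1 \<le> \<bar>f y\<bar> powr p" using p by (intro powr_mono) auto
        then show ?thesis using False by (intro add_increasing) (auto intro: ennreal_leI)
      qed
    qed (use supp in simp)
  qed
  also have "\<dots> = emeasure lborel (ball (0::'a) R) + (\<integral>\<^sup>+y. ennreal (\<bar>f y\<bar> powr p) \<partial>lborel)"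
    by (subst nn_integral_add) (auto intro!: borel_measurable_indicator)
  also have "\<dots> < \<infinity>" using fin emeasure_lborel_ball_finite[of "0::'a" R] by simp
  finally show "(\<integral>\<^sup>+y. ennreal (norm (f y)) \<partial>lborel) < \<infinity>" .
qed simp

context dirichlet_basis
begin

definition kernel_op :: "real \<Rightarrow> real set \<Rightarrow> ('a \<Rightarrow> real) \<Rightarrow> 'a \<Rightarrow> real" where
  "kernel_op s I f x = (\<integral>y. kern s I x y * f y \<partial>lborel)"

lemma measurable_kernel_op:
  assumes [measurable]: "I \<in> sets borel" "f \<in> borel_measurable borel"
  shows "kernel_op s I f \<in> borel_measurable borel"
proof -
  have "(\<lambda>(x, y). kern s I x y * f y) \<in> borel_measurable (borel \<Otimes>\<^sub>M lborel)"
    unfolding case_prod_unfold by (intro borel_measurable_times measurable_kern) measurable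
  from lborel.borel_measurable_lebesgue_integral[OF this]
  show ?thesis unfolding kernel_op_def[abs_def] by simp
qed

lemma kernel_op_large_time:
  assumes s: "0 < s" "s < real DIM('a)" and e: "e > 0" and f: "integrable lborel f"
  shows "integrable lborel (\<lambda>y. kern s {e<..} x y * f y)"
    and "\<exists>B. \<forall>x. \<bar>kernel_op s {e<..} f x\<bar> \<le> B"
    and "continuous_on UNIV (kernel_op s {e<..} f)"
proof -
  obtain B where B: "\<And>x y. \<bar>kern s {e<..} x y\<bar> \<le> B" using kern_large_time(1)[OF s e] by blast
  have [measurable]: "f \<in> borel_measurable borel" using borel_measurable_integrable[OF f] by simp
  have m: "(\<lambda>y. kern s {e<..} x y * f y) \<in> borel_measurable lborel" for x
    by (intro borel_measurable_times measurable_kern) auto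
  have intB: "integrable lborel (\<lambda>y. B * \<bar>f y\<bar>)" using f by simp
  have le: "norm (kern s {e<..} x y * f y) \<le> B * \<bar>f y\<bar>" for x y
    using B[of x y] by (simp add: abs_mult mult_right_mono)
  have B0: "B \<ge> 0" using B[of undefined undefined] by simp
  show int: "integrable lborel (\<lambda>y. kern s {e<..} x y * f y)" for x
    by (rule Bochner_Integration.integrable_bound[OF intB m]) (use le B0 in auto)
  have "\<bar>kernel_op s {e<..} f x\<bar> \<le> (\<integral>y. B * \<bar>f y\<bar> \<partial>lborel)" for x
  proof -
    have "\<bar>kernel_op s {e<..} f x\<bar> \<le> (\<integral>y. \<bar>kern s {e<..} x y * f y\<bar> \<partial>lborel)"
      unfolding kernel_op_def by (rule integral_abs_bound)
    also have "\<dots> \<le> (\<integral>y. B * \<bar>f y\<bar> \<partial>lborel)"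
      using le int intB by (intro integral_mono) auto
    finally show ?thesis .
  qed
  then show "\<exists>B. \<forall>x. \<bar>kernel_op s {e<..} f x\<bar> \<le> B" by blast
  show "continuous_on UNIV (kernel_op s {e<..} f)"
  proof (rule continuous_at_imp_continuous_on, intro ballI, unfold continuous_at_sequentially, intro allI impI)
    fix x :: 'a and X :: "nat \<Rightarrow> 'a" assume X: "X \<longlonglongrightarrow> x"
    have "(\<lambda>n. \<integral>y. kern s {e<..} (X n) y * f y \<partial>lborel) \<longlonglongrightarrow> (\<integral>y. kern s {e<..} x y * f y \<partial>lborel)"
    proof (rule integral_dominated_convergence[OF m m intB])
      show "AE y in lborel. (\<lambda>n. kern s {e<..} (X n) y * f y) \<longlonglongrightarrow> kern s {e<..} x y * f y"
      proof (intro AE_I2 tendsto_mult tendsto_const)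
        fix y
        have "isCont (\<lambda>x. kern s {e<..} x y) x"
          using kern_large_time(2)[OF s e] by (simp add: continuous_on_eq_continuous_at)
        then show "(\<lambda>n. kern s {e<..} (X n) y) \<longlonglongrightarrow> kern s {e<..} x y"
          using X by (rule isCont_tendsto_compose)
      qed
    qed (use le in auto)
    then show "(kernel_op s {e<..} f \<circ> X) \<longlonglongrightarrow> kernel_op s {e<..} f x"
      unfolding kernel_op_def comp_def .
  qed
qed

definition spherical_mean :: "('a \<Rightarrow> real) \<Rightarrow> 'a \<Rightarrow> real" where
  "spherical_mean v x = (\<integral>z. v (norm x *\<^sub>R sgn z) \<partial>unif_ball)"

lemma spherical_mean_continuous:
  assumes v: "continuous_on UNIV v" and B: "\<And>x. \<bar>v x\<bar> \<le> B"
  shows "continuous_on UNIV (spherical_mean v)"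
    and "integrable unif_ball (\<lambda>z. v (norm x *\<^sub>R sgn z))"
proof -
  interpret U: finite_measure "unif_ball :: 'a measure" by (rule finite_measure_unif_ball)
  have [measurable]: "v \<in> borel_measurable borel" by (rule borel_measurable_continuous_onI[OF v])
  have m: "(\<lambda>z. v (norm x *\<^sub>R sgn z)) \<in> borel_measurable unif_ball" for x by measurable
  show "integrable unif_ball (\<lambda>z. v (norm x *\<^sub>R sgn z))"
    by (rule U.integrable_const_bound[OF _ m]) (use B in auto)
  show "continuous_on UNIV (spherical_mean v)"
  proof (rule continuous_at_imp_continuous_on, intro ballI, unfold continuous_at_sequentially, intro allI impI)
    fix x :: 'a and X :: "nat \<Rightarrow> 'a" assume X: "X \<longlonglongrightarrow> x"
    have "(\<lambda>n. \<integral>z. v (norm (X n) *\<^sub>R sgn z) \<partial>unif_ball) \<longlonglongrightarrow> (\<integral>z. v (norm x *\<^sub>R sgn z) \<partial>unif_ball)"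
    proof (rule integral_dominated_convergence[OF m m, where w="\<lambda>_. B"])
      show "AE z in unif_ball. (\<lambda>n. v (norm (X n) *\<^sub>R sgn z)) \<longlonglongrightarrow> v (norm x *\<^sub>R sgn z)"
      proof (rule AE_I2)
        fix z :: 'a
        have "isCont v (norm x *\<^sub>R sgn z)" using v by (simp add: continuous_on_eq_continuous_at)
        then show "(\<lambda>n. v (norm (X n) *\<^sub>R sgn z)) \<longlonglongrightarrow> v (norm x *\<^sub>R sgn z)"
          by (rule isCont_tendsto_compose) (intro tendsto_intros X)
      qed
    qed (use B in auto)
    then show "(spherical_mean v \<circ> X) \<longlonglongrightarrow> spherical_mean v x"
      unfolding spherical_mean_def comp_def .
  qed
qed

text \<open>The potential \<open>T\<close> itself need not be continuous, or even converge at every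
  point; only its means over spheres are controlled. They are locally uniform limits, away from the
  origin, of the means of the truncated potentials \<open>Te e\<close>, which are bounded and
  continuous.\<close>

lemma spherical_mean_potential:
  assumes p: "1 < p" and s1: "1 / p < s" and s2: "s < real DIM('a) / p"
  shows "\<exists>C\<ge>0. \<forall>f A. f \<in> borel_measurable borel \<longrightarrow> (\<forall>y. y \<notin> ball 0 R \<longrightarrow> f y = 0) \<longrightarrow> A \<ge> 0 \<longrightarrow>
     (\<integral>\<^sup>+y. ennreal (\<bar>f y\<bar> powr p) \<partial>lborel) = ennreal A \<longrightarrow>
     continuous_on (- {0}) (spherical_mean (kernel_op s {0<..} f)) \<and>
     (\<forall>x. x \<noteq> 0 \<longrightarrow> \<bar>spherical_mean (kernel_op s {0<..} f) x\<bar> \<le> C * norm x powr (s - real DIM('a) / p) * A powr (1 / p))"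
proof -
  let ?n = "real DIM('a)"
  have "?n / p \<le> ?n" using p by (simp add: field_simps)
  then have sn: "s < ?n" using s2 by simp
  have "1 / p > 0" using p by simp
  then have s0: "s > 0" using s1 by (rule less_trans)
  \<comment> \<open>The midpoint still exceeds \<open>1 / p\<close>, so the radial bound holds for
    the order \<open>s'\<close>, and it lies below \<open>s\<close>, so
    \<open>e powr \<kappa>\<close> tends to 0 with \<open>e\<close>.\<close>
  define s' where "s' = (s + 1 / p) / 2"
  have s': "1 / p < s'" "s' < s" "s' < ?n / p" "0 < s'"
  proof -
    have mid: "a < (s + a) / 2 \<and> (s + a) / 2 < s \<and> (s + a) / 2 < b \<and> 0 < (s + a) / 2"
      if "0 < a" "a < s" "s < b" for a b :: real
      using that by (simp add: field_simps)
    show "1 / p < s'" "s' < s" "s' < ?n / p" "0 < s'"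
      using mid[OF \<open>1 / p > 0\<close> s1 s2] unfolding s'_def by blast+
  qed
  define \<kappa> where "\<kappa> = (s - s') / 2"
  have \<kappa>: "\<kappa> > 0" using s' by (simp add: \<kappa>_def)
  obtain CK where CK: "CK \<ge> 0" "\<And>x y. x \<noteq> y \<Longrightarrow> \<bar>kern s {0<..} x y\<bar> \<le> CK * norm (x - y) powr (s - ?n)"
    using kern_bound[OF s0 sn] by (metis (no_types, lifting) borel_open open_greaterThan order_refl)
  obtain CS where CS: "CS \<ge> 0" "\<And>e x y. e > 0 \<Longrightarrow> x \<noteq> y \<Longrightarrow>
    \<bar>kern s {0<..} x y - kern s {e<..} x y\<bar> \<le> CS * e powr \<kappa> * norm (x - y) powr (s' - ?n)"
    using kern_small_time[OF s'(4,2) sn] unfolding \<kappa>_def by blast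
  obtain CR where CR: "CR \<ge> 0" "\<And>\<rho> (f::'a \<Rightarrow> real) A. \<rho> > 0 \<Longrightarrow> f \<in> borel_measurable borel \<Longrightarrow> A \<ge> 0 \<Longrightarrow>
     (\<integral>\<^sup>+y. ennreal (\<bar>f y\<bar> powr p) \<partial>lborel) = ennreal A \<Longrightarrow>
     riesz_mean s \<rho> (\<lambda>y. \<bar>f y\<bar>)
       \<le> ennreal (CR * \<rho> powr (s - ?n / p) * A powr (1 / p))"
    using radial_riesz_bound_Lp[OF p s1 s2] by blast
  obtain CR' where CR': "CR' \<ge> 0" "\<And>\<rho> (f::'a \<Rightarrow> real) A. \<rho> > 0 \<Longrightarrow> f \<in> borel_measurable borel \<Longrightarrow> A \<ge> 0 \<Longrightarrow>
     (\<integral>\<^sup>+y. ennreal (\<bar>f y\<bar> powr p) \<partial>lborel) = ennreal A \<Longrightarrow>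
     riesz_mean s' \<rho> (\<lambda>y. \<bar>f y\<bar>)
       \<le> ennreal (CR' * \<rho> powr (s' - ?n / p) * A powr (1 / p))"
    using radial_riesz_bound_Lp[OF p s'(1,3)] by blast
  have main: "continuous_on (- {0}) (spherical_mean (kernel_op s {0<..} f)) \<and>
     (\<forall>x. x \<noteq> 0 \<longrightarrow> \<bar>spherical_mean (kernel_op s {0<..} f) x\<bar> \<le> (CK * CR) * norm x powr (s - ?n / p) * A powr (1 / p))"
    if f[measurable]: "f \<in> borel_measurable borel" and supp: "\<forall>y. y \<notin> ball 0 R \<longrightarrow> f y = 0" and A: "A \<ge> 0"
      and fA: "(\<integral>\<^sup>+y. ennreal (\<bar>f y\<bar> powr p) \<partial>lborel) = ennreal A" for f A
  proof -
    define N where "N = A powr (1 / p)"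
    have N: "N \<ge> 0" by (simp add: N_def)
    have intf: "integrable lborel f"
      by (rule integrable_of_powr_compact_support[where R=R and p=p]) (use supp p fA in auto)
    define T where "T = kernel_op s {0<..} f"
    define Te where "Te = (\<lambda>e. kernel_op s {e<..} f)"
    define J where "J = (\<lambda>\<sigma> x. \<integral>\<^sup>+y. ennreal (norm (x - y) powr (\<sigma> - ?n) * \<bar>f y\<bar>) \<partial>lborel)"
    have Tm[measurable]: "T \<in> borel_measurable borel" unfolding T_def by (rule measurable_kernel_op) auto
    have Tem[measurable]: "Te e \<in> borel_measurable borel" for e unfolding Te_def by (rule measurable_kernel_op) auto
    have Jm[measurable]: "J \<sigma> \<in> borel_measurable borel" for \<sigma>
      unfolding J_def by (intro lborel.borel_measurable_nn_integral) measurable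
    have ne: "AE y in lborel. y \<noteq> x" for x :: 'a by (rule AE_lborel_singleton)
    have mk: "(\<lambda>y. kern s {0<..} x y * f y) \<in> borel_measurable lborel" for x
      by (intro borel_measurable_times measurable_kern) auto
    have nnT: "(\<integral>\<^sup>+y. ennreal \<bar>kern s {0<..} x y * f y\<bar> \<partial>lborel) \<le> ennreal CK * J s x" for x
    proof -
      have "(\<integral>\<^sup>+y. ennreal \<bar>kern s {0<..} x y * f y\<bar> \<partial>lborel) \<le> (\<integral>\<^sup>+y. ennreal CK * ennreal (norm (x - y) powr (s - ?n) * \<bar>f y\<bar>) \<partial>lborel)"
        using ne[of x]
      proof (intro nn_integral_mono_AE, eventually_elim)
        case (elim y)
        then have "\<bar>kern s {0<..} x y * f y\<bar> \<le> CK * norm (x - y) powr (s - ?n) * \<bar>f y\<bar>"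
          unfolding abs_mult by (intro mult_right_mono CK(2)) auto
        then show ?case using CK(1) by (simp add: ennreal_mult[symmetric] mult.assoc ennreal_leI)
      qed
      also have "\<dots> = ennreal CK * J s x" unfolding J_def by (intro nn_integral_cmult) measurable
      finally show ?thesis .
    qed
    have Tle: "ennreal \<bar>T x\<bar> \<le> ennreal CK * J s x" for x
      unfolding T_def kernel_op_def using ennreal_abs_integral_le nnT by (rule order_trans)
    \<comment> \<open>Finiteness of \<open>J s x\<close> ensures that the integral defining
      \<open>T x\<close> converges absolutely. Otherwise \<open>T x\<close> could be the default
      value 0, and the difference would not be the integral of the difference.\<close>
    have Tdiff: "ennreal \<bar>T x - Te e x\<bar> \<le> ennreal (CS * e powr \<kappa>) * J s' x" if e: "e > 0" and J: "J s x < \<infinity>" for e x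
    proof -
      have i1: "integrable lborel (\<lambda>y. kern s {0<..} x y * f y)"
      proof (rule integrableI_bounded[OF mk])
        have "ennreal CK * J s x < \<infinity>" using J by (simp add: ennreal_mult_less_top)
        then show "(\<integral>\<^sup>+y. ennreal (norm (kern s {0<..} x y * f y)) \<partial>lborel) < \<infinity>"
          using nnT[of x] by (simp add: le_less_trans)
      qed
      have i2: "integrable lborel (\<lambda>y. kern s {e<..} x y * f y)" by (rule kernel_op_large_time(1)[OF s0 sn e intf])
      have "T x - Te e x = (\<integral>y. kern s {0<..} x y * f y - kern s {e<..} x y * f y \<partial>lborel)"
        unfolding T_def Te_def kernel_op_def using i1 i2 by simp
      then have "ennreal \<bar>T x - Te e x\<bar> \<le> (\<integral>\<^sup>+y. ennreal \<bar>kern s {0<..} x y * f y - kern s {e<..} x y * f y\<bar> \<partial>lborel)"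
        using ennreal_abs_integral_le by simp
      also have "\<dots> \<le> (\<integral>\<^sup>+y. ennreal (CS * e powr \<kappa>) * ennreal (norm (x - y) powr (s' - ?n) * \<bar>f y\<bar>) \<partial>lborel)"
        using ne[of x]
      proof (intro nn_integral_mono_AE, eventually_elim)
        case (elim y)
        then have "\<bar>kern s {0<..} x y * f y - kern s {e<..} x y * f y\<bar> \<le> CS * e powr \<kappa> * norm (x - y) powr (s' - ?n) * \<bar>f y\<bar>"
          unfolding left_diff_distrib[symmetric] abs_mult by (intro mult_right_mono CS(2) e) auto
        then show ?case using CS(1) by (simp add: ennreal_mult[symmetric] mult.assoc ennreal_leI)
      qed
      also have "\<dots> = ennreal (CS * e powr \<kappa>) * J s' x" unfolding J_def by (intro nn_integral_cmult) measurable
      finally show ?thesis .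
    qed
    have Js: "(\<integral>\<^sup>+z. J s (norm x *\<^sub>R sgn z) \<partial>unif_ball) \<le> ennreal (CR * norm x powr (s - ?n / p) * N)"
      if "x \<noteq> 0" for x :: 'a
      unfolding J_def N_def by (rule CR(2)[OF _ f A fA]) (use that in simp)
    have Js': "(\<integral>\<^sup>+z. J s' (norm x *\<^sub>R sgn z) \<partial>unif_ball) \<le> ennreal (CR' * norm x powr (s' - ?n / p) * N)"
      if "x \<noteq> 0" for x :: 'a
      unfolding J_def N_def by (rule CR'(2)[OF _ f A fA]) (use that in simp)
    have Tsph: "(\<integral>\<^sup>+z. ennreal \<bar>T (norm x *\<^sub>R sgn z)\<bar> \<partial>unif_ball) \<le> ennreal (CK * CR * norm x powr (s - ?n / p) * N)"
      if x: "x \<noteq> 0" for x :: 'a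
    proof -
      have "(\<integral>\<^sup>+z. ennreal \<bar>T (norm x *\<^sub>R sgn z)\<bar> \<partial>unif_ball) \<le> (\<integral>\<^sup>+z. ennreal CK * J s (norm x *\<^sub>R sgn z) \<partial>unif_ball)"
        by (intro nn_integral_mono Tle)
      also have "\<dots> = ennreal CK * (\<integral>\<^sup>+z. J s (norm x *\<^sub>R sgn z) \<partial>unif_ball)" by (intro nn_integral_cmult) measurable
      also have "\<dots> \<le> ennreal CK * ennreal (CR * norm x powr (s - ?n / p) * N)" by (rule mult_left_mono[OF Js[OF x]]) simp
      also have "\<dots> = ennreal (CK * CR * norm x powr (s - ?n / p) * N)"
        using CK(1) CR(1) N by (simp add: ennreal_mult[symmetric] mult.assoc)
      finally show ?thesis .
    qed
    have bound: "\<bar>spherical_mean T x\<bar> \<le> CK * CR * norm x powr (s - ?n / p) * N" if x: "x \<noteq> 0" for x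
    proof -
      have "ennreal \<bar>spherical_mean T x\<bar> \<le> ennreal (CK * CR * norm x powr (s - ?n / p) * N)"
        unfolding spherical_mean_def using ennreal_abs_integral_le Tsph[OF x] by (rule order_trans)
      then show ?thesis using CK(1) CR(1) N by simp
    qed
    have diff: "\<bar>spherical_mean T x - spherical_mean (Te e) x\<bar> \<le> CS * e powr \<kappa> * CR' * norm x powr (s' - ?n / p) * N"
      if x: "x \<noteq> 0" and e: "e > 0" for x e
    proof -
      have i1: "integrable unif_ball (\<lambda>z. T (norm x *\<^sub>R sgn z))"
        by (rule integrableI_bounded) (use Tsph[OF x] in \<open>auto simp: le_less_trans\<close>)
      have i2: "integrable unif_ball (\<lambda>z. Te e (norm x *\<^sub>R sgn z))"
      proof -
        obtain B where "\<And>x. \<bar>Te e x\<bar> \<le> B"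
          unfolding Te_def using kernel_op_large_time(2)[OF s0 sn e intf] by blast
        then show ?thesis
          unfolding Te_def by (intro spherical_mean_continuous(2) kernel_op_large_time(3)[OF s0 sn e intf])
      qed
      \<comment> \<open>A finite mean over the sphere makes \<open>J s\<close> finite almost
        everywhere on it, which is where \<open>Tdiff\<close> applies.\<close>
      have "(\<integral>\<^sup>+z. J s (norm x *\<^sub>R sgn z) \<partial>unif_ball) \<noteq> \<infinity>" using Js[OF x] by (auto simp: top_unique)
      then have fin: "AE z in unif_ball. J s (norm x *\<^sub>R sgn z) \<noteq> \<infinity>" by (intro nn_integral_PInf_AE) measurable
      have "spherical_mean T x - spherical_mean (Te e) x = (\<integral>z. T (norm x *\<^sub>R sgn z) - Te e (norm x *\<^sub>R sgn z) \<partial>unif_ball)"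
        unfolding spherical_mean_def using i1 i2 by simp
      then have "ennreal \<bar>spherical_mean T x - spherical_mean (Te e) x\<bar> \<le> (\<integral>\<^sup>+z. ennreal \<bar>T (norm x *\<^sub>R sgn z) - Te e (norm x *\<^sub>R sgn z)\<bar> \<partial>unif_ball)"
        using ennreal_abs_integral_le by simp
      also have "\<dots> \<le> (\<integral>\<^sup>+z. ennreal (CS * e powr \<kappa>) * J s' (norm x *\<^sub>R sgn z) \<partial>unif_ball)"
        using fin by (intro nn_integral_mono_AE, eventually_elim) (auto intro!: Tdiff e simp: less_top)
      also have "\<dots> = ennreal (CS * e powr \<kappa>) * (\<integral>\<^sup>+z. J s' (norm x *\<^sub>R sgn z) \<partial>unif_ball)" by (intro nn_integral_cmult) measurable
      also have "\<dots> \<le> ennreal (CS * e powr \<kappa>) * ennreal (CR' * norm x powr (s' - ?n / p) * N)"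
        by (rule mult_left_mono[OF Js'[OF x]]) simp
      also have "\<dots> = ennreal (CS * e powr \<kappa> * CR' * norm x powr (s' - ?n / p) * N)"
        using CS(1) CR'(1) N by (simp add: ennreal_mult[symmetric] mult.assoc)
      finally show ?thesis using CS(1) CR'(1) N by simp
    qed
    have contS: "continuous_on {x. norm x > d} (spherical_mean T)" if d: "d > 0" for d
    proof -
      \<comment> \<open>Because \<open>s' < n / p\<close>, the power of \<open>norm x\<close> is
        largest at the inner radius \<open>d\<close>; this gives uniformity on
        \<open>norm x > d\<close>.\<close>
      define E where "E = CS * CR' * d powr (s' - ?n / p) * N"
      have E: "E \<ge> 0" using CS(1) CR'(1) N by (simp add: E_def)
      define em where "em = (\<lambda>m. inverse (real (Suc m)))"
      have em: "em m > 0" for m by (simp add: em_def)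
      have lim: "(\<lambda>m. em m powr \<kappa> * E) \<longlonglongrightarrow> 0 powr \<kappa> * E"
        unfolding em_def by (intro tendsto_mult tendsto_const tendsto_powr2 LIMSEQ_inverse_real_of_nat) (use \<kappa> in auto)
      have "uniform_limit {x. norm x > d} (\<lambda>m. spherical_mean (Te (em m))) (spherical_mean T) sequentially"
      proof (rule uniform_limitI)
        fix r :: real assume r: "r > 0"
        have "\<forall>\<^sub>F m in sequentially. em m powr \<kappa> * E < r"
          by (rule order_tendstoD(2)[OF lim]) (use \<kappa> r in auto)
        then show "\<forall>\<^sub>F m in sequentially. \<forall>x\<in>{x. norm x > d}. dist (spherical_mean (Te (em m)) x) (spherical_mean T x) < r"
        proof (rule eventually_mono, intro ballI)
          fix m x assume m: "em m powr \<kappa> * E < r" and "x \<in> {x::'a. norm x > d}"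
          then have xd: "norm x > d" "x \<noteq> 0" using d by auto
          have "dist (spherical_mean (Te (em m)) x) (spherical_mean T x) \<le> CS * em m powr \<kappa> * CR' * norm x powr (s' - ?n / p) * N"
            using diff[OF xd(2) em, of m] by (simp add: dist_real_def abs_minus_commute)
          also have "\<dots> \<le> CS * em m powr \<kappa> * CR' * d powr (s' - ?n / p) * N"
            using xd d s' CS(1) CR'(1) N by (intro mult_right_mono mult_left_mono powr_mono2') auto
          also have "\<dots> = em m powr \<kappa> * E" by (simp add: E_def mult_ac)
          finally show "dist (spherical_mean (Te (em m)) x) (spherical_mean T x) < r" using m by simp
        qed
      qed
      moreover have "continuous_on {x. norm x > d} (spherical_mean (Te (em m)))" for m
      proof -
        obtain B where "\<And>x. \<bar>Te (em m) x\<bar> \<le> B"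
          unfolding Te_def using kernel_op_large_time(2)[OF s0 sn em intf] by blast
        then have "continuous_on UNIV (spherical_mean (Te (em m)))"
          unfolding Te_def by (intro spherical_mean_continuous(1) kernel_op_large_time(3)[OF s0 sn em intf])
        then show ?thesis by (rule continuous_on_subset) simp
      qed
      ultimately show ?thesis
        by (intro uniform_limit_theorem[where F=sequentially]) auto
    qed
    have "isCont (spherical_mean T) x" if "x \<noteq> 0" for x
    proof -
      have "open {y::'a. norm y > norm x / 2}" by (intro open_Collect_less continuous_intros)
      moreover have "x \<in> {y. norm y > norm x / 2}" using that by simp
      ultimately show ?thesis
        using contS[of "norm x / 2"] that continuous_on_eq_continuous_at by fastforce
    qed
    then have "continuous_on (- {0}) (spherical_mean T)"
      by (intro continuous_at_imp_continuous_on) auto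
    with bound show ?thesis unfolding T_def N_def by blast
  qed
  have "CK * CR \<ge> 0" using CK(1) CR(1) by simp
  with main show ?thesis by blast
qed

text \<open>An identity almost everywhere says nothing about a given sphere, but by
  \<open>AE_spheres\<close> it holds almost everywhere on almost every sphere. There
  \<open>u\<close> is constant, so \<open>u x\<close> is the mean of \<open>T\<close>.\<close>

lemma spherical_mean_eq_radial:
  assumes Tm: "T \<in> borel_measurable borel"
    and radial: "\<And>x y. x \<in> ball 0 R \<Longrightarrow> y \<in> ball 0 R \<Longrightarrow> norm x = norm y \<Longrightarrow> u x = u y"
    and ae: "AE x in lebesgue. x \<in> ball 0 R \<longrightarrow> u x = T x"
  shows "AE x in lebesgue. x \<in> ball 0 R \<longrightarrow> u x = spherical_mean T x"
proof -
  interpret U: finite_measure "unif_ball :: 'a measure" by (rule finite_measure_unif_ball)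
  have "AE x in lborel. x \<in> ball 0 R \<longrightarrow> u x = T x" using ae by (simp only: AE_completion_iff)
  \<comment> \<open>\<open>u\<close> is not assumed measurable, whereas \<open>AE_spheres\<close>
    wants a Borel predicate; membership in a Borel null set \<open>N\<close> is one.\<close>
  then obtain N where N: "\<And>x. x \<in> space lborel - N \<Longrightarrow> x \<in> ball 0 R \<longrightarrow> u x = T x" "N \<in> null_sets lborel"
    by (rule AE_E3) blast
  have [measurable]: "N \<in> sets borel" using N(2) by auto
  have "AE x in lborel. x \<notin> N" using N(2) by (rule AE_not_in)
  then have "AE x::'a in lborel. AE z in unif_ball. x \<noteq> 0 \<longrightarrow> norm x *\<^sub>R sgn z \<notin> N"
    by (intro AE_spheres) auto
  moreover have "AE x::'a in lborel. x \<noteq> 0" by (rule AE_lborel_singleton)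
  ultimately have "AE x in lborel. x \<in> ball 0 R \<longrightarrow> u x = spherical_mean T x"
  proof eventually_elim
    case (elim x)
    show ?case
    proof
      assume x: "x \<in> ball 0 R"
      have "AE z in unif_ball. z \<noteq> (0::'a)"
        unfolding unif_ball_def using AE_lborel_singleton[of "0::'a"] by (intro AE_uniform_measureI) (auto elim: eventually_mono)
      then have "AE z in unif_ball. T (norm x *\<^sub>R sgn z) = u x"
        using elim(1)
      proof eventually_elim
        case (elim z)
        have nz: "norm (norm x *\<^sub>R sgn z) = norm x" using elim by (simp add: norm_sgn)
        then have "norm x *\<^sub>R sgn z \<in> ball 0 R" using x unfolding mem_ball_0 by (simp only:)
        moreover have "norm x *\<^sub>R sgn z \<notin> N" using elim \<open>x \<noteq> 0\<close> by simp
        ultimately have "u (norm x *\<^sub>R sgn z) = T (norm x *\<^sub>R sgn z)" using N(1) by simp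
        moreover have "u (norm x *\<^sub>R sgn z) = u x"
          using \<open>norm x *\<^sub>R sgn z \<in> ball 0 R\<close> x nz by (rule radial)
        ultimately show ?case by simp
      qed
      then have "spherical_mean T x = (\<integral>(z::'a). u x \<partial>unif_ball)"
        unfolding spherical_mean_def using Tm by (intro integral_cong_AE) auto
      also have "\<dots> = u x" by (simp add: measure_def)
      finally show "u x = spherical_mean T x" by simp
    qed
  qed
  then show ?thesis by (simp only: AE_completion_iff)
qed

text \<open>Fubini and product measurability are used for Borel functions, so \<open>f\<close> is
  replaced by a Borel function that vanishes outside the ball. The kernel is only integrated against
  it, hence the potential is unchanged at every point, not merely almost everywhere.\<close>

lemma Lp_representative:
  assumes f: "Lp_on R p f"
  obtains h A where "h \<in> borel_measurable borel" "\<forall>y. y \<notin> ball 0 R \<longrightarrow> h y = 0" "A \<ge> 0"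
    "(\<integral>\<^sup>+y. ennreal (\<bar>h y\<bar> powr p) \<partial>lborel) = ennreal A" "A powr (1 / p) = Lp_norm_on R p f"
    "\<And>x s. dirichlet_riesz_potential R lam \<phi> s f x = kernel_op s {0<..} h x"
proof -
  let ?f = "\<lambda>x. indicator (ball 0 R) x * f x"
  have fm: "?f \<in> borel_measurable lebesgue" and fi: "integrable lebesgue (\<lambda>x. indicator (ball 0 R) x * \<bar>f x\<bar> powr p)"
    using f by (simp_all add: Lp_on_def set_borel_measurable_def set_integrable_def)
  obtain h0 where h0: "h0 \<in> borel_measurable lborel" "AE x in lborel. ?f x = h0 x"
    using completion_ex_borel_measurable_real[OF fm] by blast
  define h where "h = (\<lambda>x. indicator (ball 0 R) x * h0 x)"
  have h: "h \<in> borel_measurable borel"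
    unfolding h_def using h0(1) by (intro borel_measurable_times borel_measurable_indicator) auto
  have eq: "AE x in lebesgue. ?f x = h x"
    unfolding AE_completion_iff using h0(2) by eventually_elim (auto simp: h_def indicator_def)
  define A where "A = set_lebesgue_integral lebesgue (ball 0 R) (\<lambda>x. \<bar>f x\<bar> powr p)"
  have A0: "A \<ge> 0" unfolding A_def set_lebesgue_integral_def by (intro integral_nonneg_AE) auto
  have "(\<integral>\<^sup>+y. ennreal (\<bar>h y\<bar> powr p) \<partial>lborel) = (\<integral>\<^sup>+y. ennreal (\<bar>h y\<bar> powr p) \<partial>lebesgue)"
    by (rule nn_integral_completion[symmetric])
  also have "\<dots> = (\<integral>\<^sup>+y. ennreal (indicator (ball 0 R) y * \<bar>f y\<bar> powr p) \<partial>lebesgue)"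
  proof (rule nn_integral_cong_AE)
    show "AE y in lebesgue. ennreal (\<bar>h y\<bar> powr p) = ennreal (indicator (ball 0 R) y * \<bar>f y\<bar> powr p)"
      using eq
    proof eventually_elim
      case (elim y)
      show ?case unfolding elim[symmetric] by (simp add: indicator_def)
    qed
  qed
  also have "\<dots> = ennreal A"
    unfolding A_def set_lebesgue_integral_def real_scaleR_def by (rule nn_integral_eq_integral[OF fi]) auto
  finally have nn: "(\<integral>\<^sup>+y. ennreal (\<bar>h y\<bar> powr p) \<partial>lborel) = ennreal A" .
  have "dirichlet_riesz_potential R lam \<phi> s f x = kernel_op s {0<..} h x" for x s
  proof -
    have km: "kern s {0<..} x \<in> borel_measurable borel"
      by (rule measurable_kern[of _ "\<lambda>_. x" _ "\<lambda>y. y"]) auto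
    have kl: "kern s {0<..} x \<in> borel_measurable lebesgue"
      by (rule measurable_completion) (use km in simp)
    have hl: "h \<in> borel_measurable lebesgue"
      by (rule measurable_completion) (use h in simp)
    have "dirichlet_riesz_potential R lam \<phi> s f x = (\<integral>y. kern s {0<..} x y * ?f y \<partial>lebesgue)"
      unfolding dirichlet_riesz_potential_def set_lebesgue_integral_def riesz_kernel_eq
      by (simp add: mult_ac)
    also have "\<dots> = (\<integral>y. kern s {0<..} x y * h y \<partial>lebesgue)"
      using eq by (intro integral_cong_AE borel_measurable_times kl fm hl) auto
    also have "\<dots> = kernel_op s {0<..} h x"
      unfolding kernel_op_def using km h by (intro integral_completion) auto
    finally show ?thesis .
  qed
  then show ?thesis
    using that[OF h _ A0 nn] by (auto simp: h_def Lp_norm_on_def A_def)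
qed

end


section \<open>Radial potentials\<close>

text \<open>Only the values on the closed ball matter, so the system may be replaced by its
  extension by zero.\<close>

lemma dirichlet_eigenbasis_cong:
  assumes eq: "\<And>k x. x \<in> cball 0 R \<Longrightarrow> \<phi> k x = \<psi> k x" and eb: "dirichlet_eigenbasis R lam \<phi>"
  shows "dirichlet_eigenbasis R lam \<psi>"
proof -
  have "dirichlet_eigenpair R (lam k) (\<psi> k)" for k
  proof -
    have ep: "dirichlet_eigenpair R (lam k) (\<phi> k)" using eb by (simp add: dirichlet_eigenbasis_def)
    then obtain D D2 where c2: "\<forall>h k. continuous_on (ball 0 R) (\<lambda>y. D2 y h k)"
      and D: "\<forall>x\<in>ball 0 R. (\<phi> k has_derivative D x) (at x) \<and>
           (\<forall>h. ((\<lambda>y. D y h) has_derivative D2 x h) (at x)) \<and>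
           - (\<Sum>b\<in>Basis. D2 x b b) = lam k * \<phi> k x"
      unfolding dirichlet_eigenpair_def by blast
    have "(\<psi> k has_derivative D x) (at x)" if "x \<in> ball 0 R" for x
      by (rule has_derivative_transform_within_open[of "\<phi> k" _ _ _ "ball 0 R"]) (use D that eq in auto)
    moreover have "continuous_on (cball 0 R) (\<psi> k)"
      using ep eq by (subst continuous_on_cong[where g="\<phi> k"]) (auto simp: dirichlet_eigenpair_def)
    moreover have "\<forall>x. norm x = R \<longrightarrow> \<psi> k x = 0"
      using ep eq[of _ k] unfolding dirichlet_eigenpair_def by (metis mem_cball_0 order_refl)
    moreover have "\<phi> k x = \<psi> k x" if "x \<in> ball 0 R" for x using eq[of x k] that by simp
    ultimately show ?thesis
      unfolding dirichlet_eigenpair_def using c2 D by (intro conjI exI[of _ D] exI[of _ D2]) auto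
  qed
  moreover have "set_lebesgue_integral lebesgue (ball 0 R) (\<lambda>x. \<psi> j x * \<psi> k x)
      = set_lebesgue_integral lebesgue (ball 0 R) (\<lambda>x. \<phi> j x * \<phi> k x)" for j k
    by (rule set_lebesgue_integral_cong) (auto simp: eq)
  moreover have "set_lebesgue_integral lebesgue (ball 0 R) (\<lambda>x. g x * \<psi> k x)
      = set_lebesgue_integral lebesgue (ball 0 R) (\<lambda>x. g x * \<phi> k x)" for g k
    by (rule set_lebesgue_integral_cong) (auto simp: eq)
  ultimately show ?thesis
    using eb unfolding dirichlet_eigenbasis_def by simp
qed

lemma dirichlet_riesz_potential_cong:
  assumes eq: "\<And>k x. x \<in> ball 0 R \<Longrightarrow> \<phi> k x = \<psi> k x" and x: "x \<in> ball 0 R"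
  shows "dirichlet_riesz_potential R lam \<phi> s f x = dirichlet_riesz_potential R lam \<psi> s f x"
proof -
  have "riesz_kernel lam \<phi> s x y = riesz_kernel lam \<psi> s x y" if "y \<in> ball 0 R" for y
    unfolding riesz_kernel_def heat_kernel_def by (simp only: eq[OF x] eq[OF that])
  then show ?thesis
    unfolding dirichlet_riesz_potential_def
    by (intro set_lebesgue_integral_cong) auto
qed

text \<open>Membership of \<open>u\<close> in the potential space is expressed through a density
  \<open>f\<close> whose potential is \<open>u\<close> almost everywhere, and the norm of
  \<open>u\<close> is the \<open>L^p\<close> norm of \<open>f\<close>. The continuous representative
  \<open>g\<close> is the spherical mean of the potential.\<close>

theorem mainTheorem8:
  fixes R p s :: real
    and lam :: "nat \<Rightarrow> real"
    and \<phi> :: "nat \<Rightarrow> 'a::euclidean_space \<Rightarrow> real"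
  assumes "R > 0" and "1 < p" and "1 / p < s" and "s < real DIM('a) / p"
    and "dirichlet_eigenbasis R lam \<phi>"
  shows "\<exists>C. \<forall>(u::'a \<Rightarrow> real) f.
           Lp_on R p f \<and>
           (\<forall>x\<in>ball 0 R. \<forall>y\<in>ball 0 R. norm x = norm y \<longrightarrow> u x = u y) \<and>
           (AE x in lebesgue. x \<in> ball 0 R \<longrightarrow> u x = dirichlet_riesz_potential R lam \<phi> s f x)
           \<longrightarrow> (\<exists>g. continuous_on (ball 0 R - {0}) g \<and>
                   (AE x in lebesgue. x \<in> ball 0 R \<longrightarrow> u x = g x) \<and>
                   (\<forall>x\<in>ball 0 R - {0}.
                      \<bar>g x\<bar> \<le> C * norm x powr (s - real DIM('a) / p) * Lp_norm_on R p f))"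
proof -
  \<comment> \<open>The extension by zero that \<open>dirichlet_basis\<close> requires; it agrees
    with \<open>\<phi>\<close> on the closed ball because \<open>\<phi> k\<close> vanishes on the
    sphere.\<close>
  define \<psi> :: "nat \<Rightarrow> 'a \<Rightarrow> real" where "\<psi> = (\<lambda>k x. if norm x < R then \<phi> k x else 0)"
  have zero: "\<phi> k x = 0" if "norm x = R" for k x
    using assms(5) that by (simp add: dirichlet_eigenbasis_def dirichlet_eigenpair_def)
  have eq: "\<phi> k x = \<psi> k x" if "x \<in> cball 0 R" for k x
    using zero[of x k] that by (auto simp: \<psi>_def)
  interpret dirichlet_basis R lam \<psi>
  proof
    show "dirichlet_eigenbasis R lam \<psi>" by (rule dirichlet_eigenbasis_cong[OF eq assms(5)])
  qed (use assms(1) in \<open>auto simp: \<psi>_def\<close>)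
  obtain C where C: "\<And>h A. h \<in> borel_measurable borel \<Longrightarrow> (\<forall>y. y \<notin> ball 0 R \<longrightarrow> h y = 0) \<Longrightarrow> A \<ge> 0 \<Longrightarrow>
     (\<integral>\<^sup>+y. ennreal (\<bar>h y\<bar> powr p) \<partial>lborel) = ennreal A \<Longrightarrow>
     continuous_on (- {0}) (spherical_mean (kernel_op s {0<..} h)) \<and>
     (\<forall>x. x \<noteq> 0 \<longrightarrow> \<bar>spherical_mean (kernel_op s {0<..} h) x\<bar> \<le> C * norm x powr (s - real DIM('a) / p) * A powr (1 / p))"
    using spherical_mean_potential[OF assms(2-4)] by blast
  show ?thesis
  proof (intro exI[of _ C] allI impI, elim conjE)
    fix u f :: "'a \<Rightarrow> real"
    assume f: "Lp_on R p f"
      and radial: "\<forall>x\<in>ball 0 R. \<forall>y\<in>ball 0 R. norm x = norm y \<longrightarrow> u x = u y"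
      and ae: "AE x in lebesgue. x \<in> ball 0 R \<longrightarrow> u x = dirichlet_riesz_potential R lam \<phi> s f x"
    obtain h A where h: "h \<in> borel_measurable borel" "\<forall>y. y \<notin> ball 0 R \<longrightarrow> h y = 0" "A \<ge> 0"
      "(\<integral>\<^sup>+y. ennreal (\<bar>h y\<bar> powr p) \<partial>lborel) = ennreal A" "A powr (1 / p) = Lp_norm_on R p f"
      "\<And>x s. dirichlet_riesz_potential R lam \<psi> s f x = kernel_op s {0<..} h x"
      using Lp_representative[OF f] by blast
    let ?T = "kernel_op s {0<..} h"
    have "dirichlet_riesz_potential R lam \<phi> s f x = ?T x" if "x \<in> ball 0 R" for x
      unfolding h(6)[symmetric]
      by (rule dirichlet_riesz_potential_cong[OF eq that]) simp
    with ae have "AE x in lebesgue. x \<in> ball 0 R \<longrightarrow> u x = ?T x"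
      by (simp cong: imp_cong)
    then have "AE x in lebesgue. x \<in> ball 0 R \<longrightarrow> u x = spherical_mean ?T x"
    proof (rule spherical_mean_eq_radial[rotated 2])
      show "?T \<in> borel_measurable borel" using h(1) by (intro measurable_kernel_op) auto
    qed (use radial in blast)
    moreover have "continuous_on (ball 0 R - {0}) (spherical_mean ?T)"
      by (rule continuous_on_subset[of "- {0}"]) (use C[OF h(1-4)] in auto)
    ultimately show "\<exists>g. continuous_on (ball 0 R - {0}) g \<and>
                   (AE x in lebesgue. x \<in> ball 0 R \<longrightarrow> u x = g x) \<and>
                   (\<forall>x\<in>ball 0 R - {0}. \<bar>g x\<bar> \<le> C * norm x powr (s - real DIM('a) / p) * Lp_norm_on R p f)"
      using C[OF h(1-4)] unfolding h(5) by blast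
  qed
qed

end
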